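(* Let $L=(L_t)_{t\in[0,T)}$ be a càdlàg martingale with $L_t\in L_2$ for $t\in[0,T)$ and $L_0\equiv0$, let $\theta\in(0,1]$ and $b\in(0,T)$. Then $$\lim_{n\to\infty}\left\|\frac{2\theta n}{T}\int_{[0,1)}[L;\tau_n^{\theta,r}]_b\,dr-\big[\mathcal I^{\frac{1-\theta}{2}}L\big]_{b-}\right\|_{L_1}=0.$$
   Context: Fix $T\in(0,\infty)$ and a complete probability space $(\Omega,\mathcal F,\mathbb P)$ with a right-continuous filtration $(\mathcal F_t)_{t\in[0,T]}$ such that $\mathcal F_0$ is generated by the $\mathbb P$-null sets and $\mathcal F=\mathcal F_T$. $[M]$ denotes the (càdlàg) quadratic variation (square bracket) process of a martingale $M$, with $[M]_0\equiv 0$ if $M_0\equiv 0$, and $[M]_{b-}$ its left limit at $b$. $\mathcal I_t^\alpha L:=\frac{\alpha}{T^\alpha}\int_0^T(T-u)^{\alpha-1}L_{u\wedge t}\,du$ for $\alpha>0$, $\mathcal I_t^0L:=L_t$, $t\in[0,T)$ (path-wise); $\mathcal I^\alpha L=(\mathcal I_t^\alpha L)_{t\in[0,T)}$, which is again a martingale. For a net $\tau=\{t_i\}_{i=0}^m$ from $0$ to $T$ and $b\in[0,T)$, $[L;\tau]_b:=\int_0^b\big|L_u-\sum_{i=1}^mL_{t_{i-1}}\mathbf 1_{(t_{i-1},t_i]}(u)\big|^2du$. With $t_{i,n}^\theta:=T-T(1-\frac in)^{1/\theta}$, $i=0,\dots,n$, the shifted nets are, for $r\in[0,1)$, $$\tau_n^{\theta,r}:=\{0,\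 r\,t_{1,n}^\theta,\ t_{1,n}^\theta+r(t_{2,n}^\theta-t_{1,n}^\theta),\ \dots,\ t_{n-1,n}^\theta+r(T-t_{n-1,n}^\theta),\ T\}.$$ *)

theory Defs
  imports "HOL-Probability.Probability"
begin

text \<open>
  Processes are functions \<open>X t \<omega>\<close> of a real time \<open>t\<close>; only the values at times in
  \<open>{0..<T}\<close> (for filtrations: in \<open>{0..T}\<close>) are constrained or used.  The locale
  \<^locale>\<open>filtration\<close> of the library is not used because it needs a whole type as time set.
\<close>

definition usual_filtration :: "'a measure \<Rightarrow> real \<Rightarrow> (real \<Rightarrow> 'a measure) \<Rightarrow> bool" where
  "usual_filtration M T F \<longleftrightarrow>
     (\<forall>t\<in>{0..T}. subalgebra M (F t)) \<and>
     (\<forall>s\<in>{0..T}. \<forall>t\<in>{0..T}. s \<le> t \<longrightarrow> sets (F s) \<subseteq> sets (F t)) \<and>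
     (\<forall>t\<in>{0..<T}. sets (F t) = (\<Inter>s\<in>{t<..T}. sets (F s))) \<and>
     sets (F 0) = sigma_sets (space M) (null_sets M) \<and>
     sets (F T) = sets M"

definition cadlag_on :: "real \<Rightarrow> (real \<Rightarrow> real) \<Rightarrow> bool" where
  "cadlag_on T f \<longleftrightarrow>
     (\<forall>t\<in>{0..<T}. continuous (at_right t) f) \<and>
     (\<forall>t\<in>{0<..<T}. \<exists>l. (f \<longlongrightarrow> l) (at_left t))"

definition cadlag_martingale ::
  "'a measure \<Rightarrow> real \<Rightarrow> (real \<Rightarrow> 'a measure) \<Rightarrow> (real \<Rightarrow> 'a \<Rightarrow> real) \<Rightarrow> bool" where
  "cadlag_martingale M T F X \<longleftrightarrow>
     (\<forall>t\<in>{0..<T}. X t \<in> borel_measurable (F t) \<and> integrable M (X t)) \<and>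
     (\<forall>s\<in>{0..<T}. \<forall>t\<in>{0..<T}. s \<le> t \<longrightarrow> (AE \<omega> in M. real_cond_exp M (F s) (X t) \<omega> = X s \<omega>)) \<and>
     (\<forall>\<omega>\<in>space M. cadlag_on T (\<lambda>t. X t \<omega>))"

definition is_partition :: "real \<Rightarrow> nat \<Rightarrow> (nat \<Rightarrow> real) \<Rightarrow> bool" where
  "is_partition t m p \<longleftrightarrow> p 0 = 0 \<and> p m = t \<and> (\<forall>i<m. p i \<le> p (Suc i))"

text \<open>
  \<open>Q\<close> is a version of the square bracket \<open>[X]\<close> of a process \<open>X\<close> with \<open>X 0 = 0\<close>: a
  non-decreasing cadlag adapted process, null at \<open>0\<close>, such that \<open>Q t\<close> is the limit in
  probability of the sums of squared increments of \<open>X\<close> along every sequence of deterministic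
  partitions of \<open>{0..t}\<close> whose mesh tends to \<open>0\<close>.  These sums are
  \<open>X\<^sub>t\<^sup>2 - 2 \<Sum>\<^sub>i X\<^bsub>p i\<^esub> (X\<^bsub>p (i+1)\<^esub> - X\<^bsub>p i\<^esub>)\<close>, so that this is the
  process \<open>X\<^sup>2 - 2 \<integral> X\<^sub>- dX\<close>.  It is unique up to indistinguishability.
\<close>

definition square_bracket ::
  "'a measure \<Rightarrow> real \<Rightarrow> (real \<Rightarrow> 'a measure) \<Rightarrow> (real \<Rightarrow> 'a \<Rightarrow> real) \<Rightarrow> (real \<Rightarrow> 'a \<Rightarrow> real) \<Rightarrow> bool" where
  "square_bracket M T F X Q \<longleftrightarrow>
     (\<forall>t\<in>{0..<T}. Q t \<in> borel_measurable (F t)) \<and>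
     (\<forall>\<omega>\<in>space M. Q 0 \<omega> = 0 \<and> mono_on {0..<T} (\<lambda>t. Q t \<omega>) \<and> cadlag_on T (\<lambda>t. Q t \<omega>)) \<and>
     (\<forall>t\<in>{0..<T}. \<forall>m p.
        (\<forall>k. is_partition t (m k) (p k)) \<longrightarrow>
        (\<forall>\<delta>>0. \<forall>\<^sub>F k in sequentially. \<forall>i<m k. p k (Suc i) - p k i < \<delta>) \<longrightarrow>
        (\<forall>\<epsilon>>0. (\<lambda>k. measure M {\<omega>\<in>space M.
            \<bar>(\<Sum>i<m k. (X (p k (Suc i)) \<omega> - X (p k i) \<omega>)\<^sup>2) - Q t \<omega>\<bar> > \<epsilon>}) \<longlonglongrightarrow> 0))"

definition riemann_liouville ::
  "real \<Rightarrow> real \<Rightarrow> (real \<Rightarrow> 'a \<Rightarrow> real) \<Rightarrow> real \<Rightarrow> 'a \<Rightarrow> real" where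
  "riemann_liouville T \<alpha> X t \<omega> =
     (if \<alpha> = 0 then X t \<omega>
      else \<alpha> / T powr \<alpha> * (LBINT u:{0..T}. (T - u) powr (\<alpha> - 1) * X (min u t) \<omega>))"

text \<open>A net \<open>{p 0 \<le> \<dots> \<le> p m}\<close>; repeated points contribute empty intervals.\<close>

definition net_square_error ::
  "(real \<Rightarrow> 'a \<Rightarrow> real) \<Rightarrow> nat \<Rightarrow> (nat \<Rightarrow> real) \<Rightarrow> real \<Rightarrow> 'a \<Rightarrow> real" where
  "net_square_error X m p b \<omega> =
     (LBINT u:{0..b}. \<bar>X u \<omega> - (\<Sum>i=1..m. X (p (i - 1)) \<omega> * indicator {p (i - 1)<..p i} u)\<bar>\<^sup>2)"

definition theta_node :: "real \<Rightarrow> real \<Rightarrow> nat \<Rightarrow> nat \<Rightarrow> real" where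
  "theta_node T \<theta> n i = T - T * (1 - real i / real n) powr (1 / \<theta>)"

text \<open>The shifted net has the \<open>n + 2\<close> points with indices \<open>0, \<dots>, n + 1\<close>.\<close>

definition shifted_net :: "real \<Rightarrow> real \<Rightarrow> nat \<Rightarrow> real \<Rightarrow> nat \<Rightarrow> real" where
  "shifted_net T \<theta> n r i =
     (if i = 0 then 0
      else if i \<le> n then theta_node T \<theta> n (i - 1)
             + r * (theta_node T \<theta> n i - theta_node T \<theta> n (i - 1))
      else T)"

end

(* Let w(u) = ((T - u)/T)^((1 - theta)/2), X = I^((1 - theta)/2) L and let phi(y) = T - T (1 - y)^(1/theta), so that
   the unshifted net is the image under phi of an equidistant one.  Integration by parts gives
   X_v - X_s = w(v) (L_v - L_s) up to an error of order v - s in L_2, so [X] is the limit of the weighted square sums of L along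
   partitions.  The limit holds in L_1, uniformly over all partitions of small mesh, because square sums of a square
   integrable martingale are uniformly integrable (truncate the terminal value).

   On the other side, the average over r of the net error is an integral of (L_phi(z) - L_phi(y))^2 over a thin strip
   above the diagonal y = z.  The density is asymptotically 2 n^2 w(phi(z))^2 on 0 < z - y < 1/n, and since all
   integrands are nonnegative it is sandwiched between such densities for strips of slightly different width.  Writing
   z = y + v and y = rho + k v, the integral over the strip 0 < z - y < h becomes the average, over all steps v < h and
   all offsets rho < v, of complete weighted square sums along phi(rho), phi(rho + v), phi(rho + 2 v), ...; these nets
   stop before b, which is why the left limit of [X] appears. *)

theory Submission
  imports Defs
begin

section \<open>Square sums of discrete martingales\<close>

text \<open>\<open>square_bracket\<close> gives only limits in probability, along sequences of
  partitions of one fixed interval, whereas the strip average runs over a two-parameter family of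
  nets whose last node varies. So the convergence is first upgraded to a mesh threshold valid for
  all partitions at once, and then made uniform in the end point below b by joining b to two
  partitions and cancelling the common last increment. The order (1 - \<theta>)/2 is forced by the
  substitution u = phi(z), whose Jacobian is T/\<theta> times w(phi(z))^2. In the equidistant scale
  a shifted node has density about n, so the prefactor 2 \<theta> n / T turns into 2 n^2 w^2. The
  triangle of steps v < h and offsets \<rho> < v has area h^2/2, and for h = 1/n its normalising
  constant is this same 2 n^2. Other widths occur because the derivative of phi is only nearly
  constant across a cell. Neither the cell from 0 to the first shifted node nor the increment up to
  phi(\<rho>) belongs to the strip. Both are controlled by E L_t^2 for t near 0, whose smallness is
  read off from the right-continuity of the bracket at 0.\<close>

lemma integrable_mult_of_squares:
  fixes f g :: "'a \<Rightarrow> real"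
  assumes [measurable]: "f \<in> borel_measurable M" "g \<in> borel_measurable M"
    and "integrable M (\<lambda>x. (f x)\<^sup>2)" "integrable M (\<lambda>x. (g x)\<^sup>2)"
  shows "integrable M (\<lambda>x. f x * g x)"
proof (rule Bochner_Integration.integrable_bound)
  show "integrable M (\<lambda>x. (f x)\<^sup>2 + (g x)\<^sup>2)" using assms by simp
  have "\<bar>a * b\<bar> \<le> a\<^sup>2 + b\<^sup>2" for a b :: real
  proof -
    have "0 \<le> (\<bar>a\<bar> - \<bar>b\<bar>)\<^sup>2" "0 \<le> a\<^sup>2" "0 \<le> b\<^sup>2" by simp_all
    moreover have "0 \<le> \<bar>a\<bar> * \<bar>b\<bar>" by simp
    ultimately show ?thesis unfolding power2_diff abs_mult by (simp, linarith)
  qed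
  then show "AE x in M. norm (f x * g x) \<le> norm ((f x)\<^sup>2 + (g x)\<^sup>2)"
    by (intro AE_I2) simp
qed simp

lemma integrable_square_add:
  fixes f g :: "'a \<Rightarrow> real"
  assumes "f \<in> borel_measurable M" "g \<in> borel_measurable M"
    and "integrable M (\<lambda>x. (f x)\<^sup>2)" "integrable M (\<lambda>x. (g x)\<^sup>2)"
  shows "integrable M (\<lambda>x. (f x + g x)\<^sup>2)"
  unfolding power2_sum
  using assms integrable_mult_of_squares[OF assms] by (simp add: mult.assoc)

lemma integrable_square_diff:
  fixes f g :: "'a \<Rightarrow> real"
  assumes "f \<in> borel_measurable M" "g \<in> borel_measurable M"
    and "integrable M (\<lambda>x. (f x)\<^sup>2)" "integrable M (\<lambda>x. (g x)\<^sup>2)"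
  shows "integrable M (\<lambda>x. (f x - g x)\<^sup>2)"
  unfolding power2_diff
  using assms integrable_mult_of_squares[OF assms] by (simp add: mult.assoc)

lemma square_add_le: "(a + b)\<^sup>2 \<le> 2 * a\<^sup>2 + 2 * b\<^sup>2" for a b :: real
  using zero_le_power2[of "a - b"] by (simp add: power2_diff power2_sum)

lemma square_diff_le: "(a - b)\<^sup>2 \<le> 2 * a\<^sup>2 + 2 * b\<^sup>2" for a b :: real
  using square_add_le[of a "- b"] by simp

text \<open>Where x > a one has x \<le> x^2/a; this converts second moment bounds into tail
  bounds.\<close>

lemma pos_part_le_square: "max 0 (x - a) \<le> x\<^sup>2 / a" if "0 < a" "0 \<le> x" for x a :: real
proof (cases "x \<le> a")
  case False
  then have "x * a \<le> x * x" using that by (intro mult_left_mono) auto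
  then have "x \<le> x\<^sup>2 / a" using that by (simp add: field_simps power2_eq_square)
  then show ?thesis using that False by simp
qed (use that in auto)

text \<open>The martingale property is put in weak form, tested against square integrable
  \<open>H\<close>. This is exactly what orthogonality of increments uses, and it passes to
  differences by linearity.\<close>

definition square_martingale :: "'a measure \<Rightarrow> (nat \<Rightarrow> 'a measure) \<Rightarrow> nat \<Rightarrow> (nat \<Rightarrow> 'a \<Rightarrow> real) \<Rightarrow> bool" where
  "square_martingale M G m Z \<longleftrightarrow>
     (\<forall>i\<le>m. subalgebra M (G i) \<and> Z i \<in> borel_measurable (G i) \<and> integrable M (\<lambda>\<omega>. (Z i \<omega>)\<^sup>2)) \<and>
     (\<forall>i<m. sets (G i) \<subseteq> sets (G (Suc i))) \<and>
     (\<forall>i<m. \<forall>H\<in>borel_measurable (G i). integrable M (\<lambda>\<omega>. (H \<omega>)\<^sup>2) \<longrightarrow>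
        (\<integral>\<omega>. Z (Suc i) \<omega> * H \<omega> \<partial>M) = (\<integral>\<omega>. Z i \<omega> * H \<omega> \<partial>M))"

context
  fixes M :: "'a measure" and G m Z
  assumes mart: "square_martingale M G m Z"
begin

lemma square_martingale_meas_G: "i \<le> m \<Longrightarrow> Z i \<in> borel_measurable (G i)"
  and square_martingale_sub: "i \<le> m \<Longrightarrow> subalgebra M (G i)"
  and square_martingale_sq: "i \<le> m \<Longrightarrow> integrable M (\<lambda>\<omega>. (Z i \<omega>)\<^sup>2)"
  and square_martingale_mono: "i < m \<Longrightarrow> sets (G i) \<subseteq> sets (G (Suc i))"
  and square_martingale_eq: "i < m \<Longrightarrow> H \<in> borel_measurable (G i) \<Longrightarrow> integrable M (\<lambda>\<omega>. (H \<omega>)\<^sup>2) \<Longrightarrow>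
        (\<integral>\<omega>. Z (Suc i) \<omega> * H \<omega> \<partial>M) = (\<integral>\<omega>. Z i \<omega> * H \<omega> \<partial>M)"
  using mart unfolding square_martingale_def by auto

lemma square_martingale_meas: "i \<le> m \<Longrightarrow> Z i \<in> borel_measurable M"
  using square_martingale_meas_G square_martingale_sub measurable_from_subalg by blast

lemma square_martingale_meas_mono: "i < m \<Longrightarrow> f \<in> borel_measurable (G i) \<Longrightarrow> f \<in> borel_measurable (G (Suc i))"
  using square_martingale_mono[of i] square_martingale_sub[of i] square_martingale_sub[of "Suc i"]
  by (intro measurable_from_subalg[of "G (Suc i)" "G i"]) (auto simp: subalgebra_def)

text \<open>Testing with \<open>H = Z i\<close> gives E(Z_{i+1} Z_i) = E(Z_i^2), that is,
  orthogonality of the increment to the past.\<close>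

lemma square_martingale_increment_square:
  assumes "i < m"
  shows "integrable M (\<lambda>\<omega>. (Z (Suc i) \<omega> - Z i \<omega>)\<^sup>2)"
    and "(\<integral>\<omega>. (Z (Suc i) \<omega> - Z i \<omega>)\<^sup>2 \<partial>M) = (\<integral>\<omega>. (Z (Suc i) \<omega>)\<^sup>2 \<partial>M) - (\<integral>\<omega>. (Z i \<omega>)\<^sup>2 \<partial>M)"
proof -
  have i: "integrable M (\<lambda>\<omega>. (Z (Suc i) \<omega>)\<^sup>2)" "integrable M (\<lambda>\<omega>. (Z i \<omega>)\<^sup>2)"
    and ms: "Z (Suc i) \<in> borel_measurable M" "Z i \<in> borel_measurable M"
    using assms square_martingale_sq square_martingale_meas by auto
  have p: "integrable M (\<lambda>\<omega>. Z (Suc i) \<omega> * Z i \<omega>)"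
    using integrable_mult_of_squares i ms by blast
  show "integrable M (\<lambda>\<omega>. (Z (Suc i) \<omega> - Z i \<omega>)\<^sup>2)"
    using integrable_square_diff ms i by blast
  have "(\<integral>\<omega>. Z (Suc i) \<omega> * Z i \<omega> \<partial>M) = (\<integral>\<omega>. (Z i \<omega>)\<^sup>2 \<partial>M)"
    using square_martingale_eq[OF assms, of "Z i"] square_martingale_meas_G[of i] i assms by (simp add: power2_eq_square)
  then show "(\<integral>\<omega>. (Z (Suc i) \<omega> - Z i \<omega>)\<^sup>2 \<partial>M) = (\<integral>\<omega>. (Z (Suc i) \<omega>)\<^sup>2 \<partial>M) - (\<integral>\<omega>. (Z i \<omega>)\<^sup>2 \<partial>M)"
    using i p by (simp add: power2_diff mult.assoc)
qed

lemma square_martingale_energy: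
  "integrable M (\<lambda>\<omega>. \<Sum>i<m. (Z (Suc i) \<omega> - Z i \<omega>)\<^sup>2)"
  "(\<integral>\<omega>. (\<Sum>i<m. (Z (Suc i) \<omega> - Z i \<omega>)\<^sup>2) \<partial>M) = (\<integral>\<omega>. (Z m \<omega>)\<^sup>2 \<partial>M) - (\<integral>\<omega>. (Z 0 \<omega>)\<^sup>2 \<partial>M)"
proof -
  show "integrable M (\<lambda>\<omega>. \<Sum>i<m. (Z (Suc i) \<omega> - Z i \<omega>)\<^sup>2)"
    using square_martingale_increment_square(1) by (intro Bochner_Integration.integrable_sum) auto
  have "(\<integral>\<omega>. (\<Sum>i<m. (Z (Suc i) \<omega> - Z i \<omega>)\<^sup>2) \<partial>M)
      = (\<Sum>i<m. (\<integral>\<omega>. (Z (Suc i) \<omega>)\<^sup>2 \<partial>M) - (\<integral>\<omega>. (Z i \<omega>)\<^sup>2 \<partial>M))"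
    using square_martingale_increment_square by (subst Bochner_Integration.integral_sum) auto
  also have "\<dots> = (\<integral>\<omega>. (Z m \<omega>)\<^sup>2 \<partial>M) - (\<integral>\<omega>. (Z 0 \<omega>)\<^sup>2 \<partial>M)"
    by (rule sum_lessThan_telescope)
  finally show "(\<integral>\<omega>. (\<Sum>i<m. (Z (Suc i) \<omega> - Z i \<omega>)\<^sup>2) \<partial>M) = (\<integral>\<omega>. (Z m \<omega>)\<^sup>2 \<partial>M) - (\<integral>\<omega>. (Z 0 \<omega>)\<^sup>2 \<partial>M)" .
qed

text \<open>The sum is the discrete stochastic integral of Z against itself, and its increments are
  orthogonal. Measurability and square integrability are proved in the same induction because the
  next cross term needs the sum so far as part of a test function.\<close>

lemma square_martingale_bounded_transform:
  assumes "\<And>i \<omega>. i \<le> m \<Longrightarrow> \<bar>Z i \<omega>\<bar> \<le> K" and "finite_measure M" and "k \<le> m"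
  shows "(\<lambda>\<omega>. \<Sum>i<k. Z i \<omega> * (Z (Suc i) \<omega> - Z i \<omega>)) \<in> borel_measurable (G k) \<and>
    integrable M (\<lambda>\<omega>. (\<Sum>i<k. Z i \<omega> * (Z (Suc i) \<omega> - Z i \<omega>))\<^sup>2) \<and>
    (\<integral>\<omega>. (\<Sum>i<k. Z i \<omega> * (Z (Suc i) \<omega> - Z i \<omega>))\<^sup>2 \<partial>M)
      \<le> K\<^sup>2 * ((\<integral>\<omega>. (Z k \<omega>)\<^sup>2 \<partial>M) - (\<integral>\<omega>. (Z 0 \<omega>)\<^sup>2 \<partial>M))"
  using \<open>k \<le> m\<close>
proof (induction k)
  case 0
  interpret finite_measure M by fact
  show ?case by simp
next
  case (Suc k)
  interpret finite_measure M by fact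
  define V where "V k \<omega> = (\<Sum>i<k. Z i \<omega> * (Z (Suc i) \<omega> - Z i \<omega>))" for k \<omega>
  have km: "k < m" "k \<le> m" using Suc.prems by auto
  have IH: "V k \<in> borel_measurable (G k)" "integrable M (\<lambda>\<omega>. (V k \<omega>)\<^sup>2)"
    "(\<integral>\<omega>. (V k \<omega>)\<^sup>2 \<partial>M) \<le> K\<^sup>2 * ((\<integral>\<omega>. (Z k \<omega>)\<^sup>2 \<partial>M) - (\<integral>\<omega>. (Z 0 \<omega>)\<^sup>2 \<partial>M))"
    using Suc.IH km unfolding V_def by auto
  have V_Suc: "V (Suc k) = (\<lambda>\<omega>. V k \<omega> + Z k \<omega> * (Z (Suc k) \<omega> - Z k \<omega>))"
    by (simp add: V_def fun_eq_iff)
  note [measurable] = square_martingale_meas_mono[OF km(1) IH(1)] square_martingale_meas_mono[OF km(1) square_martingale_meas_G[OF km(2)]]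
     square_martingale_meas_G[OF Suc.prems]
  have m1: "V (Suc k) \<in> borel_measurable (G (Suc k))" unfolding V_Suc by measurable
  have VM: "V k \<in> borel_measurable M" using IH(1) square_martingale_sub[OF km(2)] measurable_from_subalg by blast
  have ZM: "Z k \<in> borel_measurable M" "Z (Suc k) \<in> borel_measurable M" using km square_martingale_meas by auto
  have Kb: "\<bar>Z k \<omega>\<bar> \<le> K" for \<omega> using assms(1) km by auto
  have K0: "0 \<le> K" using Kb[of undefined] by linarith
  define d where "d = (\<lambda>\<omega>. Z k \<omega> * (Z (Suc k) \<omega> - Z k \<omega>))"
  have dM: "d \<in> borel_measurable M" using ZM unfolding d_def by measurable
  have dle: "(d \<omega>)\<^sup>2 \<le> K\<^sup>2 * (Z (Suc k) \<omega> - Z k \<omega>)\<^sup>2" for \<omega>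
    using power_mono[OF Kb[of \<omega>], of 2] unfolding d_def power_mult_distrib
    by (intro mult_right_mono) auto
  have d2: "integrable M (\<lambda>\<omega>. (d \<omega>)\<^sup>2)"
    by (rule Bochner_Integration.integrable_bound[OF integrable_mult_right[OF square_martingale_increment_square(1)[OF km(1)], of "K\<^sup>2"]])
       (use dle dM in \<open>auto simp: abs_mult\<close>)
  have d2le: "(\<integral>\<omega>. (d \<omega>)\<^sup>2 \<partial>M) \<le> K\<^sup>2 * ((\<integral>\<omega>. (Z (Suc k) \<omega>)\<^sup>2 \<partial>M) - (\<integral>\<omega>. (Z k \<omega>)\<^sup>2 \<partial>M))"
  proof -
    have "(\<integral>\<omega>. (d \<omega>)\<^sup>2 \<partial>M) \<le> (\<integral>\<omega>. K\<^sup>2 * (Z (Suc k) \<omega> - Z k \<omega>)\<^sup>2 \<partial>M)"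
      by (intro integral_mono d2 integrable_mult_right square_martingale_increment_square(1)[OF km(1)] dle)
    then show ?thesis using square_martingale_increment_square(2)[OF km(1)] by simp
  qed
  \<comment> \<open>Boundedness of Z enters here: it makes the product \<open>V k * Z k\<close> an
    admissible test function, so that the cross term vanishes.\<close>
  have VZ: "integrable M (\<lambda>\<omega>. (V k \<omega> * Z k \<omega>)\<^sup>2)"
  proof (rule Bochner_Integration.integrable_bound[OF integrable_mult_right[OF IH(2), of "K\<^sup>2"]])
    have "(Z k \<omega>)\<^sup>2 * (V k \<omega>)\<^sup>2 \<le> K\<^sup>2 * (V k \<omega>)\<^sup>2" for \<omega>
      using power_mono[OF Kb[of \<omega>], of 2] by (intro mult_right_mono) auto
    then show "AE x in M. norm ((V k x * Z k x)\<^sup>2) \<le> norm (K\<^sup>2 * (V k x)\<^sup>2)"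
      by (auto simp: power_mult_distrib abs_mult mult.commute)
  qed (use VM ZM in measurable)
  have VZm: "(\<lambda>\<omega>. V k \<omega> * Z k \<omega>) \<in> borel_measurable (G k)"
    using IH(1) square_martingale_meas_G[OF km(2)] by measurable
  have cross: "(\<integral>\<omega>. V k \<omega> * d \<omega> \<partial>M) = 0"
  proof -
    have "(\<integral>\<omega>. V k \<omega> * d \<omega> \<partial>M)
        = (\<integral>\<omega>. Z (Suc k) \<omega> * (V k \<omega> * Z k \<omega>) - Z k \<omega> * (V k \<omega> * Z k \<omega>) \<partial>M)"
      by (intro Bochner_Integration.integral_cong) (auto simp: d_def algebra_simps)
    also have "\<dots> = (\<integral>\<omega>. Z (Suc k) \<omega> * (V k \<omega> * Z k \<omega>) \<partial>M) - (\<integral>\<omega>. Z k \<omega> * (V k \<omega> * Z k \<omega>) \<partial>M)"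
      using VZ VM ZM km square_martingale_sq by (intro Bochner_Integration.integral_diff integrable_mult_of_squares) auto
    also have "\<dots> = 0" using square_martingale_eq[OF km(1) VZm VZ] by simp
    finally show ?thesis .
  qed
  have Vd: "integrable M (\<lambda>\<omega>. V k \<omega> * d \<omega>)"
    by (rule integrable_mult_of_squares[OF VM dM IH(2) d2])
  have "(\<integral>\<omega>. (V (Suc k) \<omega>)\<^sup>2 \<partial>M) = (\<integral>\<omega>. (V k \<omega>)\<^sup>2 + (d \<omega>)\<^sup>2 + 2 * (V k \<omega> * d \<omega>) \<partial>M)"
    by (intro Bochner_Integration.integral_cong) (auto simp: V_Suc d_def power2_sum)
  also have "\<dots> = (\<integral>\<omega>. (V k \<omega>)\<^sup>2 \<partial>M) + (\<integral>\<omega>. (d \<omega>)\<^sup>2 \<partial>M)"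
    using IH(2) d2 Vd cross by simp
  also have "\<dots> \<le> K\<^sup>2 * ((\<integral>\<omega>. (Z (Suc k) \<omega>)\<^sup>2 \<partial>M) - (\<integral>\<omega>. (Z 0 \<omega>)\<^sup>2 \<partial>M))"
    using IH(3) d2le by (simp add: algebra_simps)
  finally have m3: "(\<integral>\<omega>. (V (Suc k) \<omega>)\<^sup>2 \<partial>M) \<le> K\<^sup>2 * ((\<integral>\<omega>. (Z (Suc k) \<omega>)\<^sup>2 \<partial>M) - (\<integral>\<omega>. (Z 0 \<omega>)\<^sup>2 \<partial>M))" .
  have m2: "integrable M (\<lambda>\<omega>. (V (Suc k) \<omega>)\<^sup>2)"
    using integrable_square_add[OF VM dM IH(2) d2] by (simp add: V_Suc d_def)
  show ?case using m1 m2 m3 unfolding V_def by auto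
qed

text \<open>Discrete Ito formula, obtained by summing (y - x)^2 = y^2 - x^2 - 2 x (y - x).\<close>

lemma sum_squares_by_parts:
  fixes z :: "nat \<Rightarrow> real"
  shows "(\<Sum>i<k. (z (Suc i) - z i)\<^sup>2) = (z k)\<^sup>2 - (z 0)\<^sup>2 - 2 * (\<Sum>i<k. z i * (z (Suc i) - z i))"
  by (induction k) (auto simp: power2_eq_square algebra_simps)

text \<open>By the discrete Ito formula the square sum is a boundary term of size at most K^2 minus
  2 V. Squaring gives at most 2 K^4 + 8 V^2, and E V^2 \<le> K^4 by the transform bound, whence the
  10.\<close>

lemma square_martingale_bounded_square_sum:
  assumes Kb: "\<And>i \<omega>. i \<le> m \<Longrightarrow> \<bar>Z i \<omega>\<bar> \<le> K" and "prob_space M"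
  shows "integrable M (\<lambda>\<omega>. (\<Sum>i<m. (Z (Suc i) \<omega> - Z i \<omega>)\<^sup>2)\<^sup>2)"
    and "(\<integral>\<omega>. (\<Sum>i<m. (Z (Suc i) \<omega> - Z i \<omega>)\<^sup>2)\<^sup>2 \<partial>M) \<le> 10 * K ^ 4"
proof -
  interpret prob_space M by fact
  define S where "S \<omega> = (\<Sum>i<m. (Z (Suc i) \<omega> - Z i \<omega>)\<^sup>2)" for \<omega>
  define V where "V \<omega> = (\<Sum>i<m. Z i \<omega> * (Z (Suc i) \<omega> - Z i \<omega>))" for \<omega>
  have S_eq: "S \<omega> = (Z m \<omega>)\<^sup>2 - (Z 0 \<omega>)\<^sup>2 - 2 * V \<omega>" for \<omega>
    unfolding S_def V_def by (rule sum_squares_by_parts)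
  have Vi: "integrable M (\<lambda>\<omega>. (V \<omega>)\<^sup>2)"
    and Vle: "(\<integral>\<omega>. (V \<omega>)\<^sup>2 \<partial>M) \<le> K\<^sup>2 * ((\<integral>\<omega>. (Z m \<omega>)\<^sup>2 \<partial>M) - (\<integral>\<omega>. (Z 0 \<omega>)\<^sup>2 \<partial>M))"
    using square_martingale_bounded_transform[of K m] Kb finite_measure_axioms unfolding V_def by auto
  have Z2: "(Z i \<omega>)\<^sup>2 \<le> K\<^sup>2" if "i \<le> m" for i \<omega>
    using power_mono[OF Kb[OF that, of \<omega>], of 2] by auto
  have "(\<integral>\<omega>. (Z m \<omega>)\<^sup>2 \<partial>M) \<le> (\<integral>\<omega>. K\<^sup>2 \<partial>M)"
    using Z2 square_martingale_sq by (intro integral_mono) auto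
  then have "(\<integral>\<omega>. (Z m \<omega>)\<^sup>2 \<partial>M) \<le> K\<^sup>2" by (simp add: prob_space)
  moreover have "0 \<le> (\<integral>\<omega>. (Z 0 \<omega>)\<^sup>2 \<partial>M)" by simp
  ultimately have "(\<integral>\<omega>. (Z m \<omega>)\<^sup>2 \<partial>M) - (\<integral>\<omega>. (Z 0 \<omega>)\<^sup>2 \<partial>M) \<le> K\<^sup>2" by linarith
  then have V4: "(\<integral>\<omega>. (V \<omega>)\<^sup>2 \<partial>M) \<le> K ^ 4"
    using Vle mult_left_mono[of "(\<integral>\<omega>. (Z m \<omega>)\<^sup>2 \<partial>M) - (\<integral>\<omega>. (Z 0 \<omega>)\<^sup>2 \<partial>M)" "K\<^sup>2" "K\<^sup>2"]
    by (simp add: power4_eq_xxxx power2_eq_square)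
  have le: "(S \<omega>)\<^sup>2 \<le> 2 * K ^ 4 + 8 * (V \<omega>)\<^sup>2" for \<omega>
  proof -
    have "\<bar>(Z m \<omega>)\<^sup>2 - (Z 0 \<omega>)\<^sup>2\<bar> \<le> K\<^sup>2"
      using Z2[of m \<omega>] Z2[of 0 \<omega>] zero_le_power2[of "Z m \<omega>"] zero_le_power2[of "Z 0 \<omega>"]
      by linarith
    then have "((Z m \<omega>)\<^sup>2 - (Z 0 \<omega>)\<^sup>2)\<^sup>2 \<le> K ^ 4"
      using power_mono[of "\<bar>(Z m \<omega>)\<^sup>2 - (Z 0 \<omega>)\<^sup>2\<bar>" "K\<^sup>2" 2] by (simp add: power_mult[symmetric])
    then show ?thesis
      using square_diff_le[of "(Z m \<omega>)\<^sup>2 - (Z 0 \<omega>)\<^sup>2" "2 * V \<omega>"] unfolding S_eq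
      by (simp add: power_mult_distrib)
  qed
  have SM: "S \<in> borel_measurable M"
    unfolding S_def using square_martingale_meas by (intro borel_measurable_sum) (auto intro!: borel_measurable_diff borel_measurable_power)
  have bi: "integrable M (\<lambda>\<omega>. 2 * K ^ 4 + 8 * (V \<omega>)\<^sup>2)" using Vi by simp
  have SI: "integrable M (\<lambda>\<omega>. (S \<omega>)\<^sup>2)"
    by (rule Bochner_Integration.integrable_bound[OF bi]) (use SM le in \<open>auto intro!: AE_I2 order_trans[OF le]\<close>)
  have "(\<integral>\<omega>. (S \<omega>)\<^sup>2 \<partial>M) \<le> (\<integral>\<omega>. 2 * K ^ 4 + 8 * (V \<omega>)\<^sup>2 \<partial>M)"
    by (intro integral_mono SI bi le)
  also have "\<dots> \<le> 10 * K ^ 4" using V4 Vi by (simp add: prob_space)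
  finally show "(\<integral>\<omega>. (\<Sum>i<m. (Z (Suc i) \<omega> - Z i \<omega>)\<^sup>2)\<^sup>2 \<partial>M) \<le> 10 * K ^ 4" unfolding S_def .
  show "integrable M (\<lambda>\<omega>. (\<Sum>i<m. (Z (Suc i) \<omega> - Z i \<omega>)\<^sup>2)\<^sup>2)" using SI unfolding S_def .
qed

end

section \<open>Truncation of the terminal value\<close>

lemma square_martingale_diff:
  assumes "square_martingale M G m Y" "square_martingale M G m Z"
  shows "square_martingale M G m (\<lambda>i \<omega>. Y i \<omega> - Z i \<omega>)"
  unfolding square_martingale_def
proof (intro conjI allI impI ballI)
  fix i assume i: "i \<le> m"
  show "subalgebra M (G i)" using square_martingale_sub assms i by blast
  show "(\<lambda>\<omega>. Y i \<omega> - Z i \<omega>) \<in> borel_measurable (G i)"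
    using square_martingale_meas_G[OF assms(1) i] square_martingale_meas_G[OF assms(2) i] by simp
  show "integrable M (\<lambda>\<omega>. (Y i \<omega> - Z i \<omega>)\<^sup>2)"
    using square_martingale_meas[OF assms(1) i] square_martingale_meas[OF assms(2) i] square_martingale_sq[OF assms(1) i] square_martingale_sq[OF assms(2) i]
    by (intro integrable_square_diff)
next
  fix i assume "i < m" then show "sets (G i) \<subseteq> sets (G (Suc i))" using square_martingale_mono[OF assms(1)] by blast
next
  fix i and H :: "'a \<Rightarrow> real" assume i: "i < m" and H: "H \<in> borel_measurable (G i)" "integrable M (\<lambda>\<omega>. (H \<omega>)\<^sup>2)"
  have HM: "H \<in> borel_measurable M" using H(1) square_martingale_sub[OF assms(1), of i] i by (intro measurable_from_subalg[of M "G i"]) auto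
  have "integrable M (\<lambda>\<omega>. Y j \<omega> * H \<omega>)" "integrable M (\<lambda>\<omega>. Z j \<omega> * H \<omega>)" if "j \<le> m" for j
    using that square_martingale_meas[OF assms(1)] square_martingale_meas[OF assms(2)] square_martingale_sq[OF assms(1)] square_martingale_sq[OF assms(2)] H HM
    by (auto intro!: integrable_mult_of_squares)
  then show "(\<integral>\<omega>. (Y (Suc i) \<omega> - Z (Suc i) \<omega>) * H \<omega> \<partial>M) = (\<integral>\<omega>. (Y i \<omega> - Z i \<omega>) * H \<omega> \<partial>M)"
    using square_martingale_eq[OF assms(1) i H] square_martingale_eq[OF assms(2) i H] i by (simp add: left_diff_distrib)
qed

text \<open>The martingale closed by Y, that is, its conditional expectations. The bound K is
  obtained for every outcome, as the estimates for bounded martingales require.\<close>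

lemma square_martingale_closed_bounded:
  fixes Y :: "'a \<Rightarrow> real"
  assumes "prob_space M" and sub: "\<And>i. i \<le> m \<Longrightarrow> subalgebra M (G i)"
    and mono: "\<And>i. i < m \<Longrightarrow> sets (G i) \<subseteq> sets (G (Suc i))"
    and Y: "Y \<in> borel_measurable (G m)" and Yb: "\<And>\<omega>. \<bar>Y \<omega>\<bar> \<le> (K :: real)"
  obtains Z :: "nat \<Rightarrow> 'a \<Rightarrow> real" where "square_martingale M G m Z" "\<And>i \<omega>. \<bar>Z i \<omega>\<bar> \<le> K" "Z m = Y"
proof -
  interpret prob_space M by fact
  have K0: "0 \<le> K" using Yb[of undefined] by linarith
  have YM: "Y \<in> borel_measurable M" using Y sub[of m] measurable_from_subalg by blast
  \<comment> \<open>Conditional expectations are bounded and determined only almost everywhere.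
    Clipping makes the bound pointwise, and the separate case \<open>i = m\<close> makes the last
    value literally Y.\<close>
  define Z where "Z i = (if i = m then Y else (\<lambda>\<omega>. max (- K) (min K (real_cond_exp M (G i) Y \<omega>))))" for i
  have Yi: "integrable M Y"
    by (rule integrable_const_bound[of _ K]) (use Yb YM in auto)
  have Zb: "\<bar>Z i \<omega>\<bar> \<le> K" for i \<omega>
    using Yb[of \<omega>] K0 unfolding Z_def by (auto simp: abs_le_iff max_def min_def)
  have Zm: "Z i \<in> borel_measurable (G i)" if "i \<le> m" for i
    using Y unfolding Z_def by (cases "i = m") auto
  have ZM: "Z i \<in> borel_measurable M" if "i \<le> m" for i
    using Zm[OF that] sub[OF that] measurable_from_subalg by blast
  have Z2: "integrable M (\<lambda>\<omega>. (Z i \<omega>)\<^sup>2)" if "i \<le> m" for i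
  proof (rule integrable_const_bound[of _ "K\<^sup>2"])
    show "AE x in M. norm ((Z i x)\<^sup>2) \<le> K\<^sup>2" using power_mono[OF Zb[of i], where n=2] by auto
  qed (use ZM[OF that] in measurable)
  have key: "(\<integral>\<omega>. Z i \<omega> * H \<omega> \<partial>M) = (\<integral>\<omega>. Y \<omega> * H \<omega> \<partial>M)"
    if i: "i \<le> m" and H: "H \<in> borel_measurable (G i)" "integrable M (\<lambda>\<omega>. (H \<omega>)\<^sup>2)" for i and H :: "'a \<Rightarrow> real"
  proof (cases "i = m")
    case False
    interpret S: finite_measure_subalgebra M "G i"
      using sub[OF i] by unfold_locales auto
    have HM: "H \<in> borel_measurable M" using H(1) sub[OF i] measurable_from_subalg by blast
    have Y2: "integrable M (\<lambda>\<omega>. (Y \<omega>)\<^sup>2)" using Z2[of m] by (simp add: Z_def)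
    have HY: "integrable M (\<lambda>\<omega>. H \<omega> * Y \<omega>)"
      by (rule integrable_mult_of_squares[OF HM YM H(2) Y2])
    have ub: "AE \<omega> in M. real_cond_exp M (G i) Y \<omega> \<le> K"
      by (rule S.real_cond_exp_le_c[OF Yi]) (use Yb in \<open>auto simp: abs_le_iff\<close>)
    have lb: "AE \<omega> in M. - K \<le> real_cond_exp M (G i) Y \<omega>"
      by (rule S.real_cond_exp_ge_c[OF Yi]) (use Yb in \<open>auto simp: abs_le_iff minus_le_iff\<close>)
    have "AE \<omega> in M. Z i \<omega> * H \<omega> = H \<omega> * real_cond_exp M (G i) Y \<omega>"
      using ub lb by eventually_elim (use False in \<open>auto simp: Z_def\<close>)
    then have "(\<integral>\<omega>. Z i \<omega> * H \<omega> \<partial>M) = (\<integral>\<omega>. H \<omega> * real_cond_exp M (G i) Y \<omega> \<partial>M)"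
      using ZM[OF i] HM by (intro integral_cong_AE) auto
    also have "\<dots> = (\<integral>\<omega>. H \<omega> * Y \<omega> \<partial>M)" by (rule S.real_cond_exp_intg(2)[OF HY H(1) YM])
    finally show ?thesis by (simp add: mult.commute)
  qed (simp add: Z_def)
  have "square_martingale M G m Z"
    unfolding square_martingale_def
  proof (intro conjI allI impI ballI)
    fix i and H :: "'a \<Rightarrow> real" assume i: "i < m" and H: "H \<in> borel_measurable (G i)" "integrable M (\<lambda>\<omega>. (H \<omega>)\<^sup>2)"
    have "H \<in> borel_measurable (G (Suc i))"
      using mono[OF i] sub[of i] sub[of "Suc i"] i H(1)
      by (intro measurable_from_subalg[of "G (Suc i)" "G i"]) (auto simp: subalgebra_def)
    then show "(\<integral>\<omega>. Z (Suc i) \<omega> * H \<omega> \<partial>M) = (\<integral>\<omega>. Z i \<omega> * H \<omega> \<partial>M)"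
      using key[of i H] key[of "Suc i" H] i H by simp
  qed (use sub Zm Z2 mono in auto)
  then show ?thesis using that[of Z] Zb by (simp add: Z_def)
qed

text \<open>The square sums of all discretisations of a martingale with terminal value \<open>Z m\<close> are uniformly
  integrable, because truncating the terminal value changes them by little in \<open>L\<^sub>1\<close> and bounds them in \<open>L\<^sub>2\<close>.\<close>

lemma square_sum_pos_part:
  assumes "prob_space M" and Z: "square_martingale M G m Z" and "0 < a" "0 \<le> K"
  shows "(\<integral>\<omega>. max 0 ((\<Sum>i<m. (Z (Suc i) \<omega> - Z i \<omega>)\<^sup>2) - a) \<partial>M)
     \<le> 2 * (\<integral>\<omega>. (Z m \<omega>)\<^sup>2 * indicator {\<omega>. \<bar>Z m \<omega>\<bar> > K} \<omega> \<partial>M) + 40 * K ^ 4 / a"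
proof -
  interpret prob_space M by fact
  define U where "U \<omega> = (if \<bar>Z m \<omega>\<bar> \<le> K then Z m \<omega> else 0)" for \<omega>
  have Zmm[measurable]: "Z m \<in> borel_measurable (G m)" using square_martingale_meas_G[OF Z] by simp
  have Um: "U \<in> borel_measurable (G m)" unfolding U_def by measurable
  have Ub: "\<bar>U \<omega>\<bar> \<le> K" for \<omega> using \<open>0 \<le> K\<close> by (auto simp: U_def)
  obtain Y where Y: "square_martingale M G m Y" and Yb: "\<And>i \<omega>. \<bar>Y i \<omega>\<bar> \<le> K" and YU: "Y m = U"
    using square_martingale_closed_bounded[OF \<open>prob_space M\<close>, of m G U K] square_martingale_sub[OF Z] square_martingale_mono[OF Z] Um Ub
    by metis
  define R where "R i \<omega> = Z i \<omega> - Y i \<omega>" for i \<omega>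
  have R: "square_martingale M G m R"
    using square_martingale_diff[OF Z Y] unfolding R_def .
  define SZ SY SR where "SZ \<omega> = (\<Sum>i<m. (Z (Suc i) \<omega> - Z i \<omega>)\<^sup>2)"
    and "SY \<omega> = (\<Sum>i<m. (Y (Suc i) \<omega> - Y i \<omega>)\<^sup>2)" and "SR \<omega> = (\<Sum>i<m. (R (Suc i) \<omega> - R i \<omega>)\<^sup>2)" for \<omega>
  have "SZ \<omega> \<le> 2 * SY \<omega> + 2 * SR \<omega>" for \<omega>
    unfolding SZ_def SY_def SR_def sum_distrib_left sum.distrib[symmetric]
  proof (intro sum_mono)
    fix i
    show "(Z (Suc i) \<omega> - Z i \<omega>)\<^sup>2 \<le> 2 * (Y (Suc i) \<omega> - Y i \<omega>)\<^sup>2 + 2 * (R (Suc i) \<omega> - R i \<omega>)\<^sup>2"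
      using square_add_le[of "Y (Suc i) \<omega> - Y i \<omega>" "R (Suc i) \<omega> - R i \<omega>"] by (simp add: R_def)
  qed
  \<comment> \<open>The L_2 bound on the bounded part becomes a tail bound. The 4 comes from
    squaring 2 SY, and with 10 K^4 it gives the 40 of the statement.\<close>
  moreover have "max 0 (2 * SY \<omega> - a) \<le> 4 * (SY \<omega>)\<^sup>2 / a" for \<omega>
    using pos_part_le_square[OF \<open>0 < a\<close>, of "2 * SY \<omega>"] by (simp add: SY_def sum_nonneg)
  moreover have "0 \<le> SR \<omega>" for \<omega> by (simp add: SR_def sum_nonneg)
  ultimately have le: "max 0 (SZ \<omega> - a) \<le> 2 * SR \<omega> + 4 * (SY \<omega>)\<^sup>2 / a" for \<omega>
    by (smt (verit, best))
  have SRi: "integrable M SR" and SRe: "(\<integral>\<omega>. SR \<omega> \<partial>M) \<le> (\<integral>\<omega>. (R m \<omega>)\<^sup>2 \<partial>M)"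
    using square_martingale_energy[OF R] unfolding SR_def by auto
  have SYi: "integrable M (\<lambda>\<omega>. (SY \<omega>)\<^sup>2)" and SYe: "(\<integral>\<omega>. (SY \<omega>)\<^sup>2 \<partial>M) \<le> 10 * K ^ 4"
    using square_martingale_bounded_square_sum[OF Y Yb \<open>prob_space M\<close>] unfolding SY_def by auto
  have SZi: "integrable M SZ" using square_martingale_energy[OF Z] unfolding SZ_def by auto
  have "(\<integral>\<omega>. max 0 (SZ \<omega> - a) \<partial>M) \<le> (\<integral>\<omega>. 2 * SR \<omega> + 4 * (SY \<omega>)\<^sup>2 / a \<partial>M)"
    using SRi SYi SZi by (intro integral_mono le) auto
  also have "\<dots> = 2 * (\<integral>\<omega>. SR \<omega> \<partial>M) + 4 * (\<integral>\<omega>. (SY \<omega>)\<^sup>2 \<partial>M) / a"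
    using SRi SYi by simp
  also have "\<dots> \<le> 2 * (\<integral>\<omega>. (R m \<omega>)\<^sup>2 \<partial>M) + 40 * K ^ 4 / a"
    using SRe SYe \<open>0 < a\<close> by (intro add_mono) (auto simp: divide_simps)
  also have "(\<lambda>\<omega>. (R m \<omega>)\<^sup>2) = (\<lambda>\<omega>. (Z m \<omega>)\<^sup>2 * indicator {\<omega>. \<bar>Z m \<omega>\<bar> > K} \<omega>)"
    by (auto simp: R_def YU U_def fun_eq_iff indicator_def)
  finally show ?thesis unfolding SZ_def .
qed

section \<open>From uniform integrability to convergence in L_1\<close>

lemma integrable_tail_vanishes:
  fixes f :: "'a \<Rightarrow> real"
  assumes "integrable M (\<lambda>\<omega>. (f \<omega>)\<^sup>2)" and [measurable]: "f \<in> borel_measurable M"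
  shows "(\<lambda>k. \<integral>\<omega>. (f \<omega>)\<^sup>2 * indicator {\<omega>. \<bar>f \<omega>\<bar> > real k} \<omega> \<partial>M) \<longlonglongrightarrow> 0"
proof -
  have "(\<lambda>k. \<integral>\<omega>. (f \<omega>)\<^sup>2 * indicator {\<omega>. \<bar>f \<omega>\<bar> > real k} \<omega> \<partial>M) \<longlonglongrightarrow> (\<integral>\<omega>. 0 \<partial>M)"
  proof (rule integral_dominated_convergence[where w="\<lambda>\<omega>. (f \<omega>)\<^sup>2"])
    have "eventually (\<lambda>k. (f \<omega>)\<^sup>2 * indicator {\<omega>. \<bar>f \<omega>\<bar> > real k} \<omega> = 0) sequentially" for \<omega>
      using eventually_ge_at_top[of "nat \<lceil>\<bar>f \<omega>\<bar>\<rceil>"]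
      by eventually_elim (auto simp: indicator_def)
    then show "AE x in M. (\<lambda>k. (f x)\<^sup>2 * indicator {\<omega>. \<bar>f \<omega>\<bar> > real k} x) \<longlonglongrightarrow> 0"
      by (intro AE_I2 tendsto_eventually)
    show "AE x in M. norm ((f x)\<^sup>2 * indicator {\<omega>. \<bar>f \<omega>\<bar> > real k} x) \<le> (f x)\<^sup>2" for k
      by (auto simp: indicator_def)
    show "(\<lambda>x. (f x)\<^sup>2 * indicator {\<omega>. real k < \<bar>f \<omega>\<bar>} x) \<in> borel_measurable M" for k
    proof -
      have "(\<lambda>x. (f x)\<^sup>2 * indicator {\<omega>. real k < \<bar>f \<omega>\<bar>} x) = (\<lambda>x. if real k < \<bar>f x\<bar> then (f x)\<^sup>2 else 0)"
        by (auto simp: indicator_def)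
      then show ?thesis by simp
    qed
  qed (use assms in auto)
  then show ?thesis by simp
qed

text \<open>Vitali's convergence theorem, with uniform integrability expressed by positive parts.\<close>

lemma (in prob_space) L1_convergence_of_uniformly_integrable:
  fixes W :: "nat \<Rightarrow> 'a \<Rightarrow> real" and Q :: "'a \<Rightarrow> real"
  assumes Wi: "\<And>k. integrable M (W k)" and W0: "\<And>k \<omega>. \<omega> \<in> space M \<Longrightarrow> 0 \<le> W k \<omega>"
    and Qm[measurable]: "Q \<in> borel_measurable M" and Q0: "\<And>\<omega>. \<omega> \<in> space M \<Longrightarrow> 0 \<le> Q \<omega>"
    and prob: "\<And>\<epsilon>. 0 < \<epsilon> \<Longrightarrow> (\<lambda>k. measure M {\<omega>\<in>space M. \<bar>W k \<omega> - Q \<omega>\<bar> > \<epsilon>}) \<longlonglongrightarrow> 0"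
    and ui: "\<And>\<epsilon>. 0 < \<epsilon> \<Longrightarrow> \<exists>a>0. \<forall>k. (\<integral>\<omega>. max 0 (W k \<omega> - a) \<partial>M) \<le> \<epsilon>"
  shows "integrable M Q" and "(\<lambda>k. \<integral>\<omega>. \<bar>W k \<omega> - Q \<omega>\<bar> \<partial>M) \<longlonglongrightarrow> 0"
proof -
  have Wm[measurable]: "W k \<in> borel_measurable M" for k using Wi by auto
  have trunc_int: "integrable M (\<lambda>\<omega>. min (f \<omega>) a)" if "f \<in> borel_measurable M" "0 \<le> a" "\<And>\<omega>. \<omega> \<in> space M \<Longrightarrow> 0 \<le> f \<omega>" for f and a :: real
    by (rule integrable_const_bound[of _ a]) (use that in \<open>auto intro!: AE_I2\<close>)
  \<comment> \<open>Below the level a, convergence in probability suffices: the truncated difference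
    is at most e/2 off the event of a deviation above e/2 and at most a on it, and the event
    eventually has probability below e/(2 a).\<close>
  have trunc: "(\<lambda>k. \<integral>\<omega>. \<bar>min (W k \<omega>) a - min (Q \<omega>) a\<bar> \<partial>M) \<longlonglongrightarrow> 0" if a: "0 < a" for a
  proof (rule LIMSEQ_I)
    fix e :: real assume e: "0 < e"
    have "eventually (\<lambda>k. measure M {\<omega>\<in>space M. \<bar>W k \<omega> - Q \<omega>\<bar> > e / 2} < e / (2 * a)) sequentially"
      using order_tendstoD(2)[OF prob[of "e/2"], of "e / (2*a)"] e a by simp
    then obtain N where N: "\<And>k. k \<ge> N \<Longrightarrow> measure M {\<omega>\<in>space M. \<bar>W k \<omega> - Q \<omega>\<bar> > e / 2} < e / (2 * a)"
      unfolding eventually_sequentially by blast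
    have "norm ((\<integral>\<omega>. \<bar>min (W k \<omega>) a - min (Q \<omega>) a\<bar> \<partial>M) - 0) < e" if "N \<le> k" for k
    proof -
      let ?A = "{\<omega>\<in>space M. \<bar>W k \<omega> - Q \<omega>\<bar> > e / 2}"
      have "(\<integral>\<omega>. \<bar>min (W k \<omega>) a - min (Q \<omega>) a\<bar> \<partial>M) \<le> (\<integral>\<omega>. e / 2 + a * indicator ?A \<omega> \<partial>M)"
      proof (rule integral_mono)
        show "integrable M (\<lambda>\<omega>. \<bar>min (W k \<omega>) a - min (Q \<omega>) a\<bar>)"
          using trunc_int[of "W k" a] trunc_int[of Q a] W0 Q0 a by auto
        show "integrable M (\<lambda>\<omega>. e / 2 + a * indicator ?A \<omega>)"
          by (auto intro!: Bochner_Integration.integrable_add integrable_mult_right integrable_real_indicator simp: emeasure_eq_measure)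
        fix \<omega> assume w: "\<omega> \<in> space M"
        show "\<bar>min (W k \<omega>) a - min (Q \<omega>) a\<bar> \<le> e / 2 + a * indicator ?A \<omega>"
          using W0[OF w, of k] Q0[OF w] a e w by (auto simp: indicator_def min_def abs_if split: if_splits)
      qed
      also have "\<dots> = e / 2 + a * measure M ?A"
        by (subst Bochner_Integration.integral_add) (auto simp: prob_space emeasure_eq_measure intro!: integrable_real_indicator)
      also have "\<dots> < e" using N[OF that] a e by (simp add: field_simps)
      finally show ?thesis by simp
    qed
    then show "\<exists>no. \<forall>k\<ge>no. norm ((\<integral>\<omega>. \<bar>min (W k \<omega>) a - min (Q \<omega>) a\<bar> \<partial>M) - 0) < e" by blast
  qed
  \<comment> \<open>Integrability of Q is still to be shown. The tail bound of W therefore passes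
    first to Q cut at height c, where \<open>trunc\<close> allows k to tend to infinity, and then c
    is removed by Fatou.\<close>
  have Qtail: "(\<integral>\<^sup>+\<omega>. ennreal (max 0 (Q \<omega> - a)) \<partial>M) \<le> ennreal \<epsilon>"
    if a: "0 < a" and ua: "\<And>k. (\<integral>\<omega>. max 0 (W k \<omega> - a) \<partial>M) \<le> \<epsilon>" and e0: "0 \<le> \<epsilon>" for a \<epsilon> :: real
  proof -
    have c: "(\<integral>\<omega>. max 0 (min (Q \<omega>) (real c) - a) \<partial>M) \<le> \<epsilon>" for c :: nat
    proof (cases "c = 0")
      case True
      have "(\<integral>\<omega>. max 0 (min (Q \<omega>) (real c) - a) \<partial>M) = (\<integral>\<omega>. 0 \<partial>M)"
        using True a Q0 by (intro Bochner_Integration.integral_cong) auto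
      then show ?thesis using e0 by simp
    next
      case False
      have "(\<integral>\<omega>. max 0 (min (Q \<omega>) (real c) - a) \<partial>M) \<le> \<epsilon> + (\<integral>\<omega>. \<bar>min (W k \<omega>) (real c) - min (Q \<omega>) (real c)\<bar> \<partial>M)" for k
      proof -
        have i1: "integrable M (\<lambda>\<omega>. \<bar>min (W k \<omega>) (real c) - min (Q \<omega>) (real c)\<bar>)"
          using trunc_int[of "W k" "real c"] trunc_int[of Q "real c"] W0 Q0 a by auto
        have i2: "integrable M (\<lambda>\<omega>. max 0 (W k \<omega> - a))" using Wi[of k] by auto
        have i3: "integrable M (\<lambda>\<omega>. max 0 (min (Q \<omega>) (real c) - a))"
          using trunc_int[of Q "real c"] Q0 by auto
        have "(\<integral>\<omega>. max 0 (min (Q \<omega>) (real c) - a) \<partial>M)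
          \<le> (\<integral>\<omega>. max 0 (W k \<omega> - a) + \<bar>min (W k \<omega>) (real c) - min (Q \<omega>) (real c)\<bar> \<partial>M)"
          by (intro integral_mono i3 Bochner_Integration.integrable_add i1 i2) (auto simp: min_def max_def abs_if)
        also have "\<dots> \<le> \<epsilon> + (\<integral>\<omega>. \<bar>min (W k \<omega>) (real c) - min (Q \<omega>) (real c)\<bar> \<partial>M)"
          using i1 i2 ua[of k] by simp
        finally show ?thesis .
      qed
      moreover have "(\<lambda>k. \<epsilon> + (\<integral>\<omega>. \<bar>min (W k \<omega>) (real c) - min (Q \<omega>) (real c)\<bar> \<partial>M)) \<longlonglongrightarrow> \<epsilon> + 0"
        using False by (intro tendsto_intros trunc) auto
      ultimately show ?thesis
        using LIMSEQ_le_const[of _ "\<epsilon> + 0"] by auto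
    qed
    have "(\<integral>\<^sup>+\<omega>. ennreal (max 0 (Q \<omega> - a)) \<partial>M)
        = (\<integral>\<^sup>+\<omega>. liminf (\<lambda>c. ennreal (max 0 (min (Q \<omega>) (real c) - a))) \<partial>M)"
    proof (rule nn_integral_cong)
      fix \<omega>
      have "eventually (\<lambda>c. ennreal (max 0 (min (Q \<omega>) (real c) - a)) = ennreal (max 0 (Q \<omega> - a))) sequentially"
        using eventually_ge_at_top[of "nat \<lceil>Q \<omega>\<rceil>"] by eventually_elim (auto simp: min_def)
      then have "(\<lambda>c. ennreal (max 0 (min (Q \<omega>) (real c) - a))) \<longlonglongrightarrow> ennreal (max 0 (Q \<omega> - a))"
        by (rule tendsto_eventually)
      then show "ennreal (max 0 (Q \<omega> - a)) = liminf (\<lambda>c. ennreal (max 0 (min (Q \<omega>) (real c) - a)))"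
        using lim_imp_Liminf sequentially_bot by metis
    qed
    also have "\<dots> \<le> liminf (\<lambda>c. \<integral>\<^sup>+\<omega>. ennreal (max 0 (min (Q \<omega>) (real c) - a)) \<partial>M)"
      by (rule nn_integral_liminf) auto
    also have "\<dots> \<le> liminf (\<lambda>c::nat. ennreal \<epsilon>)"
    proof (rule Liminf_mono, rule always_eventually, rule allI)
      fix c :: nat
      have "integrable M (\<lambda>\<omega>. max 0 (min (Q \<omega>) (real c) - a))"
        using trunc_int[of Q "real c"] Q0 by auto
      then show "(\<integral>\<^sup>+\<omega>. ennreal (max 0 (min (Q \<omega>) (real c) - a)) \<partial>M) \<le> ennreal \<epsilon>"
        using c[of c] by (subst nn_integral_eq_integral) (auto intro: ennreal_leI)
    qed
    also have "\<dots> = ennreal \<epsilon>" by (simp add: Liminf_const)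
    finally show ?thesis .
  qed
  have Qtail_int: "integrable M (\<lambda>\<omega>. max 0 (Q \<omega> - a))" if a: "0 < a" and ua: "\<And>k. (\<integral>\<omega>. max 0 (W k \<omega> - a) \<partial>M) \<le> \<epsilon>" for a \<epsilon> :: real
  proof (rule integrableI_nonneg)
    have "0 \<le> \<epsilon>" using ua[of 0] by (rule order_trans[rotated]) simp
    then show "(\<integral>\<^sup>+\<omega>. ennreal (max 0 (Q \<omega> - a)) \<partial>M) < \<infinity>"
      using Qtail[OF a ua] by (auto simp: less_top[symmetric] top_unique)
  qed auto
  show Qi: "integrable M Q"
  proof -
    obtain a where a: "a > 0" "\<And>k. (\<integral>\<omega>. max 0 (W k \<omega> - a) \<partial>M) \<le> 1" using ui[of 1] by auto
    have "integrable M (\<lambda>\<omega>. min (Q \<omega>) a + max 0 (Q \<omega> - a))"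
      using Qtail_int[OF a] trunc_int[of Q a] a Q0 by auto
    moreover have "(\<lambda>\<omega>. min (Q \<omega>) a + max 0 (Q \<omega> - a)) = Q" by (auto simp: min_def max_def)
    ultimately show ?thesis by simp
  qed
  show "(\<lambda>k. \<integral>\<omega>. \<bar>W k \<omega> - Q \<omega>\<bar> \<partial>M) \<longlonglongrightarrow> 0"
  proof (rule LIMSEQ_I)
    fix e :: real assume e: "0 < e"
    obtain a where a: "a > 0" "\<And>k. (\<integral>\<omega>. max 0 (W k \<omega> - a) \<partial>M) \<le> e / 3" using ui[of "e/3"] e by auto
    obtain N where N: "\<And>k. k \<ge> N \<Longrightarrow> (\<integral>\<omega>. \<bar>min (W k \<omega>) a - min (Q \<omega>) a\<bar> \<partial>M) < e / 3"
      using order_tendstoD(2)[OF trunc[OF a(1)], of "e/3"] e unfolding eventually_sequentially by auto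
    have Qa: "(\<integral>\<omega>. max 0 (Q \<omega> - a) \<partial>M) \<le> e / 3"
      using Qtail[OF a] e nn_integral_eq_integral[OF Qtail_int[OF a]] by simp
    have "norm ((\<integral>\<omega>. \<bar>W k \<omega> - Q \<omega>\<bar> \<partial>M) - 0) < e" if "N \<le> k" for k
    proof -
      have i1: "integrable M (\<lambda>\<omega>. \<bar>min (W k \<omega>) a - min (Q \<omega>) a\<bar>)"
        using trunc_int[of "W k" a] trunc_int[of Q a] W0 Q0 a by auto
      have i2: "integrable M (\<lambda>\<omega>. max 0 (W k \<omega> - a))" using Wi[of k] by auto
      have i3: "integrable M (\<lambda>\<omega>. max 0 (Q \<omega> - a))" using Qi by auto
      have "(\<integral>\<omega>. \<bar>W k \<omega> - Q \<omega>\<bar> \<partial>M) \<le>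
        (\<integral>\<omega>. \<bar>min (W k \<omega>) a - min (Q \<omega>) a\<bar> + max 0 (W k \<omega> - a) + max 0 (Q \<omega> - a) \<partial>M)"
        by (intro integral_mono integrable_abs Bochner_Integration.integrable_diff Bochner_Integration.integrable_add Wi Qi i1 i2 i3)
          (auto simp: min_def max_def abs_if)
      also have "\<dots> = (\<integral>\<omega>. \<bar>min (W k \<omega>) a - min (Q \<omega>) a\<bar> \<partial>M) + (\<integral>\<omega>. max 0 (W k \<omega> - a) \<partial>M) + (\<integral>\<omega>. max 0 (Q \<omega> - a) \<partial>M)"
        using i1 i2 i3 by simp
      also have "\<dots> < e" using N[OF that] a(2)[of k] Qa by linarith
      finally show ?thesis by simp
    qed
    then show "\<exists>no. \<forall>k\<ge>no. norm ((\<integral>\<omega>. \<bar>W k \<omega> - Q \<omega>\<bar> \<partial>M) - 0) < e" by blast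
  qed
qed

section \<open>Martingales on a half-open interval and their fractional integrals\<close>

lemma is_partition_mono:
  assumes "is_partition t m p" "i \<le> j" "j \<le> m"
  shows "p i \<le> p j"
  using assms(2,3)
proof (induction j rule: dec_induct)
  case (step n)
  then show ?case using assms(1) unfolding is_partition_def by (meson Suc_le_lessD less_imp_le order_trans)
qed simp

lemma is_partition_range:
  assumes "is_partition t m p" "i \<le> m"
  shows "p i \<in> {0..t}"
  using is_partition_mono[OF assms(1), of 0 i] is_partition_mono[OF assms(1), of i m] assms
  unfolding is_partition_def by auto

definition square_sum :: "(real \<Rightarrow> 'a \<Rightarrow> real) \<Rightarrow> nat \<Rightarrow> (nat \<Rightarrow> real) \<Rightarrow> 'a \<Rightarrow> real" where
  "square_sum X m p \<omega> = (\<Sum>i<m. (X (p (Suc i)) \<omega> - X (p i) \<omega>)\<^sup>2)"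

text \<open>Cauchy-Schwarz against the constant 1, read off from the nonnegative integral of (f -
  c)^2 with c the mean of f. The mean divides by the total mass, so a null space is treated
  apart.\<close>

lemma integral_square_le:
  fixes f :: "'a \<Rightarrow> real"
  assumes "finite_measure N" "integrable N f" "integrable N (\<lambda>x. (f x)\<^sup>2)"
  shows "(\<integral>x. f x \<partial>N)\<^sup>2 \<le> measure N (space N) * (\<integral>x. (f x)\<^sup>2 \<partial>N)"
proof (cases "measure N (space N) = 0")
  case True
  interpret finite_measure N by fact
  have "AE x in N. f x = 0"
    using True by (intro AE_I[of _ _ "space N"]) (auto simp: emeasure_eq_measure)
  then have "(\<integral>x. f x \<partial>N) = 0" by (rule integral_eq_zero_AE)
  then show ?thesis using True by simp
next
  case False
  interpret finite_measure N by fact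
  let ?V = "measure N (space N)" and ?I = "\<integral>x. f x \<partial>N"
  define c where "c = ?I / ?V"
  have V: "0 < ?V" using False by (simp add: zero_less_measure_iff)
  have "0 \<le> (\<integral>x. (f x - c)\<^sup>2 \<partial>N)" by simp
  also have "(\<integral>x. (f x - c)\<^sup>2 \<partial>N) = (\<integral>x. (f x)\<^sup>2 - 2 * c * f x + c\<^sup>2 \<partial>N)"
    by (intro Bochner_Integration.integral_cong) (auto simp: power2_diff)
  also have "\<dots> = (\<integral>x. (f x)\<^sup>2 \<partial>N) - 2 * c * ?I + c\<^sup>2 * ?V"
    using assms by (simp add: mult.assoc mult.commute)
  also have "\<dots> = (\<integral>x. (f x)\<^sup>2 \<partial>N) - ?I\<^sup>2 / ?V"
    using V by (simp add: c_def power2_eq_square field_simps)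
  finally show ?thesis using V by (simp add: field_simps)
qed

text \<open>The reflection u = T - x moves the singularity to 0, where the integral of a power is
  known. It supplies the normalisation of the Riemann-Liouville kernel and its mass beyond
  v.\<close>

lemma nn_integral_power_kernel:
  assumes "0 < \<alpha>" "v \<le> T"
  shows "(\<integral>\<^sup>+u. ennreal (indicator {v..T} u * (T - u) powr (\<alpha> - 1)) \<partial>lborel) = ennreal ((T - v) powr \<alpha> / \<alpha>)"
proof -
  have "((\<lambda>x. x powr (\<alpha> - 1)) has_integral (T - v) powr (\<alpha> - 1 + 1) / (\<alpha> - 1 + 1)) {0..T - v}"
    by (rule has_integral_powr_from_0) (use assms in auto)
  then have "((\<lambda>x. if x \<in> {0..T - v} then x powr (\<alpha> - 1) else 0) has_integral (T - v) powr \<alpha> / \<alpha>) UNIV"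
    by (subst has_integral_restrict_UNIV) simp
  also have "(\<lambda>x. if x \<in> {0..T - v} then x powr (\<alpha> - 1) else 0) = (\<lambda>x. indicator {0..T - v} x * x powr (\<alpha> - 1))"
    by (auto simp: indicator_def)
  finally have "((\<lambda>x. indicator {0..T - v} x * x powr (\<alpha> - 1)) has_integral (T - v) powr \<alpha> / \<alpha>) UNIV" .
  from this have "(\<integral>\<^sup>+x. ennreal (indicator {0..T - v} x * x powr (\<alpha> - 1)) \<partial>lborel) = ennreal ((T - v) powr \<alpha> / \<alpha>)"
    by (intro nn_integral_has_integral_lborel) (auto simp: indicator_def)
  moreover have "(\<integral>\<^sup>+u. ennreal (indicator {v..T} u * (T - u) powr (\<alpha> - 1)) \<partial>lborel)
      = (\<integral>\<^sup>+x. ennreal (indicator {0..T - v} x * x powr (\<alpha> - 1)) \<partial>lborel)"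
  proof -
    have "indicator {0..T - v} (T - x) = (indicator {v..T} x :: real)" for x by (auto simp: indicator_def)
    then show ?thesis
      by (subst (2) nn_integral_real_affine[of _ "-1" T]) (auto simp: algebra_simps)
  qed
  ultimately show ?thesis by simp
qed

locale l2_process = prob_space M for M :: "'a measure" +
  fixes F :: "real \<Rightarrow> 'a measure" and L :: "real \<Rightarrow> 'a \<Rightarrow> real" and T :: real
  assumes T_pos: "0 < T"
    and filt: "usual_filtration M T F"
    and mart: "cadlag_martingale M T F L"
    and sq: "t \<in> {0..<T} \<Longrightarrow> integrable M (\<lambda>\<omega>. (L t \<omega>)\<^sup>2)"
    and L_0: "\<omega> \<in> space M \<Longrightarrow> L 0 \<omega> = 0"
begin

section \<open>Second moments of the martingale and of its increments\<close>

definition energy :: "real \<Rightarrow> real" where "energy t = (\<integral>\<omega>. (L t \<omega>)\<^sup>2 \<partial>M)"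

lemma subalg: "t \<in> {0..<T} \<Longrightarrow> subalgebra M (F t)"
  and F_mono: "s \<in> {0..<T} \<Longrightarrow> t \<in> {0..<T} \<Longrightarrow> s \<le> t \<Longrightarrow> sets (F s) \<subseteq> sets (F t)"
  using filt unfolding usual_filtration_def by auto

lemma L_adapted: "t \<in> {0..<T} \<Longrightarrow> L t \<in> borel_measurable (F t)"
  using mart unfolding cadlag_martingale_def by auto

lemma L_meas: "t \<in> {0..<T} \<Longrightarrow> L t \<in> borel_measurable M"
  using L_adapted subalg measurable_from_subalg by blast

text \<open>The pull-out property of conditional expectations turns the martingale identity into the
  tested form of \<open>square_martingale\<close>.\<close>

lemma square_martingale_partition:
  assumes p: "is_partition t m p" and t: "t < T"
  shows "square_martingale M (\<lambda>i. F (p i)) m (\<lambda>i. L (p i))"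
proof -
  have r: "p i \<in> {0..<T}" if "i \<le> m" for i using is_partition_range[OF p that] t by auto
  have mono: "p i \<le> p (Suc i)" if "i < m" for i using is_partition_mono[OF p] that by auto
  show ?thesis
    unfolding square_martingale_def
  proof (intro conjI allI impI ballI)
    fix i and H :: "'a \<Rightarrow> real" assume i: "i < m" and H: "H \<in> borel_measurable (F (p i))" "integrable M (\<lambda>\<omega>. (H \<omega>)\<^sup>2)"
    have ri: "p i \<in> {0..<T}" "p (Suc i) \<in> {0..<T}" using r i by auto
    interpret S: finite_measure_subalgebra M "F (p i)"
      using subalg[OF ri(1)] by unfold_locales auto
    have HM: "H \<in> borel_measurable M" using H(1) subalg[OF ri(1)] measurable_from_subalg by blast
    have HL: "integrable M (\<lambda>\<omega>. H \<omega> * L (p (Suc i)) \<omega>)"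
      using integrable_mult_of_squares[OF HM L_meas[OF ri(2)] H(2) sq[OF ri(2)]] .
    have ae: "AE \<omega> in M. real_cond_exp M (F (p i)) (L (p (Suc i))) \<omega> = L (p i) \<omega>"
      using mart mono[OF i] ri unfolding cadlag_martingale_def by blast
    have "(\<integral>\<omega>. L (p (Suc i)) \<omega> * H \<omega> \<partial>M) = (\<integral>\<omega>. H \<omega> * real_cond_exp M (F (p i)) (L (p (Suc i))) \<omega> \<partial>M)"
      using S.real_cond_exp_intg(2)[OF HL H(1) L_meas[OF ri(2)]] by (simp add: mult.commute)
    also have "\<dots> = (\<integral>\<omega>. L (p i) \<omega> * H \<omega> \<partial>M)"
      using ae HM L_meas[OF ri(1)] by (intro integral_cong_AE) (auto simp: mult.commute)
    finally show "(\<integral>\<omega>. L (p (Suc i)) \<omega> * H \<omega> \<partial>M) = (\<integral>\<omega>. L (p i) \<omega> * H \<omega> \<partial>M)" .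
  qed (use r subalg L_adapted sq F_mono mono in auto)
qed

lemma increment_energy:
  assumes "0 \<le> s" "s \<le> t" "t < T"
  shows "integrable M (\<lambda>\<omega>. (L t \<omega> - L s \<omega>)\<^sup>2)"
    and "(\<integral>\<omega>. (L t \<omega> - L s \<omega>)\<^sup>2 \<partial>M) = energy t - energy s"
proof -
  \<comment> \<open>A partition must start at 0, so the increment from s to t appears as the second
    step of the net 0, s, t.\<close>
  define p where "p = (\<lambda>i::nat. if i = 0 then 0 else if i = 1 then s else t)"
  have "is_partition t 2 p" using assms by (auto simp: is_partition_def p_def)
  from square_martingale_partition[OF this \<open>t < T\<close>]
  have sm: "square_martingale M (\<lambda>i. F (p i)) 2 (\<lambda>i. L (p i))" .
  show "integrable M (\<lambda>\<omega>. (L t \<omega> - L s \<omega>)\<^sup>2)" "(\<integral>\<omega>. (L t \<omega> - L s \<omega>)\<^sup>2 \<partial>M) = energy t - energy s"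
    using square_martingale_increment_square[OF sm, of 1] by (simp_all add: p_def energy_def)
qed

lemma nn_increment_energy:
  assumes "0 \<le> s" "s \<le> t" "t < T"
  shows "(\<integral>\<^sup>+\<omega>. ennreal ((L t \<omega> - L s \<omega>)\<^sup>2) \<partial>M) = ennreal (energy t - energy s)"
  using increment_energy[OF assms] by (subst nn_integral_eq_integral) auto

lemma energy_mono: "0 \<le> s \<Longrightarrow> s \<le> t \<Longrightarrow> t < T \<Longrightarrow> energy s \<le> energy t"
  using increment_energy(2)[of s t] Bochner_Integration.integral_nonneg[of M "\<lambda>\<omega>. (L t \<omega> - L s \<omega>)\<^sup>2"] by simp

lemma energy_0: "energy 0 = 0"
  unfolding energy_def by (subst Bochner_Integration.integral_cong[of M M _ "\<lambda>_. 0"]) (auto simp: L_0)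

lemma energy_nonneg: "0 \<le> energy t"
  unfolding energy_def by simp

lemma square_sum_energy:
  assumes "is_partition t m p" "t < T"
  shows "integrable M (square_sum L m p)" "(\<integral>\<omega>. square_sum L m p \<omega> \<partial>M) = energy t"
  using square_martingale_energy[OF square_martingale_partition[OF assms]] assms(1) energy_0
  by (auto simp: square_sum_def[abs_def] energy_def is_partition_def)

text \<open>Both terms in \<open>square_sum_pos_part\<close> see the partition only through its
  terminal value L t. Hence k is chosen from the tail of L t alone, then a from k, and both serve
  all partitions of {0..t}.\<close>

lemma square_sum_uniformly_integrable:
  assumes t: "0 \<le> t" "t < T" and e: "0 < \<epsilon>"
  shows "\<exists>a>0. \<forall>m p. is_partition t m p \<longrightarrow> (\<integral>\<omega>. max 0 (square_sum L m p \<omega> - a) \<partial>M) \<le> \<epsilon>"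
proof -
  have "(\<lambda>k. \<integral>\<omega>. (L t \<omega>)\<^sup>2 * indicator {\<omega>. \<bar>L t \<omega>\<bar> > real k} \<omega> \<partial>M) \<longlonglongrightarrow> 0"
    using t by (intro integrable_tail_vanishes sq L_meas) auto
  from order_tendstoD(2)[OF this, of "\<epsilon> / 4"] e
  obtain k where k: "(\<integral>\<omega>. (L t \<omega>)\<^sup>2 * indicator {\<omega>. \<bar>L t \<omega>\<bar> > real k} \<omega> \<partial>M) < \<epsilon> / 4"
    unfolding eventually_sequentially by auto
  \<comment> \<open>Chosen so that 40 k^4 / a \<le> \<epsilon>/2; the summand 1 keeps a positive for
    k = 0.\<close>
  define a where "a = 80 * (real k ^ 4 + 1) / \<epsilon>"
  have a: "0 < a" using e by (auto simp: a_def intro!: divide_pos_pos add_nonneg_pos)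
  have "80 * real k ^ 4 \<le> a * \<epsilon>" using e by (simp add: a_def)
  then have "40 * real k ^ 4 / a \<le> \<epsilon> / 2" using a by (simp add: field_simps)
  moreover have "(\<integral>\<omega>. max 0 (square_sum L m p \<omega> - a) \<partial>M)
     \<le> 2 * (\<integral>\<omega>. (L t \<omega>)\<^sup>2 * indicator {\<omega>. \<bar>L t \<omega>\<bar> > real k} \<omega> \<partial>M) + 40 * real k ^ 4 / a"
    if p: "is_partition t m p" for m p
    using square_sum_pos_part[OF prob_space_axioms square_martingale_partition[OF p t(2)] a, of "real k"] p
    by (simp add: square_sum_def is_partition_def)
  ultimately show ?thesis using k a by (intro exI[of _ a]) fastforce
qed

section \<open>Joint measurability in time and outcome, and integrability of paths\<close>

text \<open>The extension by \<open>0\<close> makes the process jointly measurable without reference to the time interval.\<close>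

definition Lz :: "real \<Rightarrow> 'a \<Rightarrow> real" where "Lz u \<omega> = (if u \<in> {0..<T} then L u \<omega> else 0)"

lemma Lz_eq: "0 \<le> u \<Longrightarrow> u < T \<Longrightarrow> Lz u = L u"
  by (auto simp: Lz_def fun_eq_iff)

lemma Lz_meas: "Lz u \<in> borel_measurable M"
  using L_meas[of u] unfolding Lz_def by (cases "u \<in> {0..<T}") auto

text \<open>By right-continuity, L at u is the limit of L at the next point of the grid with step
  1/(k + 1) strictly to the right of u. Each approximation takes time arguments from a countable set
  and is therefore jointly measurable.\<close>

lemma Lz_jointly_measurable: "(\<lambda>(u, \<omega>). Lz u \<omega>) \<in> borel_measurable (borel \<Otimes>\<^sub>M M)"
proof -
  define a where "a k u = (real_of_int \<lfloor>u * real (Suc k)\<rfloor> + 1) / real (Suc k)" for k :: nat and u :: real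
  have a_gt: "u < a k u" for k u
    using floor_correct[of "u * real (Suc k)"] unfolding a_def by (subst pos_less_divide_eq) auto
  have a_le: "a k u \<le> u + 1 / real (Suc k)" for k u
  proof -
    have "real_of_int \<lfloor>u * real (Suc k)\<rfloor> + 1 \<le> (u + 1 / real (Suc k)) * real (Suc k)"
      unfolding distrib_right using of_int_floor_le[of "u * real (Suc k)"] by simp
    then show ?thesis unfolding a_def by (subst pos_divide_le_eq) auto
  qed
  have a_lim: "(\<lambda>k. a k u) \<longlonglongrightarrow> u" for u
  proof (rule tendsto_sandwich[of "\<lambda>_. u" _ _ "\<lambda>k. u + 1 / real (Suc k)"])
    have "(\<lambda>k. u + 1 / real (Suc k)) \<longlonglongrightarrow> u + 0"
      by (intro tendsto_intros LIMSEQ_Suc[OF lim_1_over_n])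
    then show "(\<lambda>k. u + 1 / real (Suc k)) \<longlonglongrightarrow> u" by simp
  qed (use a_gt a_le in \<open>auto intro!: always_eventually less_imp_le simp del: of_nat_Suc\<close>)
  have "(\<lambda>x. indicator {0..<T} (fst x) * Lz (a k (fst x)) (snd x)) \<in> borel_measurable (borel \<Otimes>\<^sub>M M)" for k
  proof -
    have "(\<lambda>x. Lz ((real_of_int \<lfloor>fst x * real (Suc k)\<rfloor> + 1) / real (Suc k)) (snd x)) \<in> borel_measurable (borel \<Otimes>\<^sub>M M)"
    proof (rule measurable_compose_countable[of "\<lambda>i x. Lz ((real_of_int i + 1) / real (Suc k)) (snd x)" _ _ "\<lambda>x. \<lfloor>fst x * real (Suc k)\<rfloor>"])
      show "(\<lambda>x. Lz ((real_of_int i + 1) / real (Suc k)) (snd x)) \<in> borel_measurable (borel \<Otimes>\<^sub>M M)" for i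
        by (rule measurable_compose[OF measurable_snd Lz_meas])
    qed measurable
    then show ?thesis unfolding a_def by measurable
  qed
  moreover have "(\<lambda>k. indicator {0..<T} (fst x) * Lz (a k (fst x)) (snd x)) \<longlonglongrightarrow> Lz (fst x) (snd x)"
    if x: "x \<in> space (borel \<Otimes>\<^sub>M M)" for x
  proof (cases "fst x \<in> {0..<T}")
    case True
    have w: "snd x \<in> space M" using x by (auto simp: space_pair_measure)
    have "continuous (at_right (fst x)) (\<lambda>t. L t (snd x))"
      using mart True w unfolding cadlag_martingale_def cadlag_on_def by blast
    then have c: "((\<lambda>t. L t (snd x)) \<longlongrightarrow> L (fst x) (snd x)) (at_right (fst x))"
      by (simp add: continuous_within)
    have "filterlim (\<lambda>k. a k (fst x)) (at_right (fst x)) sequentially"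
      unfolding filterlim_at using a_lim[of "fst x"] a_gt by (auto intro!: always_eventually, metis less_irrefl)
    from filterlim_compose[OF c this]
    have lim: "(\<lambda>k. L (a k (fst x)) (snd x)) \<longlonglongrightarrow> L (fst x) (snd x)" .
    have "eventually (\<lambda>k. a k (fst x) < T) sequentially"
      using order_tendstoD(2)[OF a_lim[of "fst x"]] True by auto
    then have "eventually (\<lambda>k. L (a k (fst x)) (snd x) = indicator {0..<T} (fst x) * Lz (a k (fst x)) (snd x)) sequentially"
    proof eventually_elim
      case (elim k)
      then show ?case using True a_gt[of "fst x" k] by (auto simp: Lz_def)
    qed
    with lim have "(\<lambda>k. indicator {0..<T} (fst x) * Lz (a k (fst x)) (snd x)) \<longlonglongrightarrow> L (fst x) (snd x)"
      by (rule Lim_transform_eventually)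
    then show ?thesis using True by (simp add: Lz_def)
  qed (auto simp: Lz_def)
  ultimately have "(\<lambda>x. Lz (fst x) (snd x)) \<in> borel_measurable (borel \<Otimes>\<^sub>M M)"
    by (rule borel_measurable_LIMSEQ_real[rotated])
  then show ?thesis by (simp add: case_prod_beta')
qed

lemma Lz_measurable[measurable (raw)]:
  assumes "f \<in> borel_measurable N" "h \<in> measurable N M"
  shows "(\<lambda>x. Lz (f x) (h x)) \<in> borel_measurable N"
  using measurable_compose[OF measurable_Pair[OF assms] Lz_jointly_measurable] by simp

text \<open>By Tonelli the expected integral of L^2 over [0, v] is at most v times
  \<open>energy v\<close>, so it is almost surely finite. Integrability of L follows from |x| \<le>
  1 + x^2 on a bounded interval.\<close>

lemma AE_path_integrable:
  assumes v: "0 \<le> v" "v < T"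
  shows "AE \<omega> in M. set_integrable lborel {0..v} (\<lambda>u. L u \<omega>) \<and> set_integrable lborel {0..v} (\<lambda>u. (L u \<omega>)\<^sup>2)"
proof -
  interpret P: pair_sigma_finite M lborel by unfold_locales
  have "(\<integral>\<^sup>+\<omega>. (\<integral>\<^sup>+u. ennreal (indicator {0..v} u * (Lz u \<omega>)\<^sup>2) \<partial>lborel) \<partial>M)
      = (\<integral>\<^sup>+u. (\<integral>\<^sup>+\<omega>. ennreal (indicator {0..v} u * (Lz u \<omega>)\<^sup>2) \<partial>M) \<partial>lborel)"
    by (rule P.Fubini'[symmetric]) measurable
  also have "\<dots> \<le> (\<integral>\<^sup>+u. ennreal (energy v) * indicator {0..v} u \<partial>lborel)"
  proof (rule nn_integral_mono)
    fix u
    show "(\<integral>\<^sup>+\<omega>. ennreal (indicator {0..v} u * (Lz u \<omega>)\<^sup>2) \<partial>M) \<le> ennreal (energy v) * indicator {0..v} u"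
    proof (cases "u \<in> {0..v}")
      case True
      then have "(\<integral>\<^sup>+\<omega>. ennreal ((L u \<omega>)\<^sup>2) \<partial>M) = ennreal (energy u)"
        unfolding energy_def using v by (intro nn_integral_eq_integral sq) auto
      then show ?thesis using True v by (auto simp: Lz_eq intro!: ennreal_leI energy_mono)
    qed simp
  qed
  also have "\<dots> < \<infinity>" using v by (simp add: nn_integral_cmult ennreal_mult_less_top)
  finally have "AE \<omega> in M. (\<integral>\<^sup>+u. ennreal (indicator {0..v} u * (Lz u \<omega>)\<^sup>2) \<partial>lborel) \<noteq> \<infinity>"
    by (intro nn_integral_PInf_AE) (auto simp: top.not_eq_extremum)
  moreover have "AE \<omega> in M. \<omega> \<in> space M" by simp
  ultimately show ?thesis
  proof eventually_elim
    case (elim \<omega>)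
    have [measurable]: "(\<lambda>u. Lz u \<omega>) \<in> borel_measurable borel"
      by (rule Lz_measurable[of "\<lambda>u. u"]) (use elim in auto)
    have 1: "integrable lborel (\<lambda>u. indicator {0..v} u * (Lz u \<omega>)\<^sup>2)"
      by (rule integrableI_nonneg) (use elim in \<open>auto simp: top.not_eq_extremum\<close>)
    have 2: "integrable lborel (\<lambda>u. indicator {0..v} u + indicator {0..v} u * (Lz u \<omega>)\<^sup>2)"
      using 1 v by (intro Bochner_Integration.integrable_add integrable_real_indicator) auto
    have "\<bar>x\<bar> \<le> 1 + x\<^sup>2" for x :: real
      using zero_le_power2[of "\<bar>x\<bar> - 1"] by (simp add: power2_diff)
    then have 3: "integrable lborel (\<lambda>u. indicator {0..v} u * Lz u \<omega>)"
      by (intro Bochner_Integration.integrable_bound[OF 2]) (auto simp: indicator_def abs_le_iff)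
    have e: "indicator {0..v} u * Lz u \<omega> = indicator {0..v} u *\<^sub>R L u \<omega>"
      "indicator {0..v} u * (Lz u \<omega>)\<^sup>2 = indicator {0..v} u *\<^sub>R (L u \<omega>)\<^sup>2" for u
      using v by (auto simp: indicator_def Lz_def)
    show ?case using 1 3 unfolding set_integrable_def e by simp
  qed
qed

section \<open>The fractional integral and its increments\<close>

lemma riemann_liouville_meas:
  assumes "0 \<le> t" "t < T"
  shows "riemann_liouville T \<alpha> L t \<in> borel_measurable M"
proof (cases "\<alpha> = 0")
  case True
  then show ?thesis using L_meas[of t] assms by (auto simp: riemann_liouville_def[abs_def])
next
  case False
  have eq: "riemann_liouville T \<alpha> L t
      = (\<lambda>\<omega>. \<alpha> / T powr \<alpha> * (\<integral>u. indicator {0..T} u * ((T - u) powr (\<alpha> - 1) * Lz (min u t) \<omega>) \<partial>lborel))"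
  proof
    fix \<omega>
    have e: "indicator {0..T} u *\<^sub>R ((T - u) powr (\<alpha> - 1) * L (min u t) \<omega>)
        = indicator {0..T} u * ((T - u) powr (\<alpha> - 1) * Lz (min u t) \<omega>)" for u
      using assms by (auto simp: indicator_def Lz_def)
    show "riemann_liouville T \<alpha> L t \<omega>
      = \<alpha> / T powr \<alpha> * (\<integral>u. indicator {0..T} u * ((T - u) powr (\<alpha> - 1) * Lz (min u t) \<omega>) \<partial>lborel)"
      unfolding riemann_liouville_def set_lebesgue_integral_def e using False by simp
  qed
  show ?thesis unfolding eq by measurable
qed

text \<open>For \<alpha> > 0 this is the mass which the normalised kernel \<alpha>/T^\<alpha> (T -
  u)^(\<alpha> - 1) puts on [v, T]; for \<alpha> = 0 and v < T it is 1.\<close>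

definition wt :: "real \<Rightarrow> real \<Rightarrow> real" where "wt \<alpha> v = ((T - v) / T) powr \<alpha>"

definition remainder :: "real \<Rightarrow> real \<Rightarrow> real \<Rightarrow> 'a \<Rightarrow> real" where
  "remainder \<alpha> s v \<omega> = \<alpha> / T powr \<alpha> * (LBINT u:{s..v}. (T - u) powr (\<alpha> - 1) * (L u \<omega> - L s \<omega>))"

lemma wt_bounds: "0 \<le> \<alpha> \<Longrightarrow> 0 \<le> v \<Longrightarrow> v < T \<Longrightarrow> 0 < wt \<alpha> v \<and> wt \<alpha> v \<le> 1"
  unfolding wt_def using T_pos by (auto intro!: powr_le1)

lemma wt_antimono: "0 \<le> \<alpha> \<Longrightarrow> 0 \<le> u \<Longrightarrow> u \<le> v \<Longrightarrow> v < T \<Longrightarrow> wt \<alpha> v \<le> wt \<alpha> u"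
  unfolding wt_def using T_pos by (intro powr_mono2) (auto intro!: divide_right_mono)

lemma kernel_bound:
  assumes "\<alpha> \<le> 1" "0 \<le> u" "u \<le> v" "v < T"
  shows "(T - u) powr (\<alpha> - 1) \<le> (T - v) powr (\<alpha> - 1)"
  using assms by (intro powr_mono2') auto

text \<open>Pathwise integration by parts, with the weight taken at the right end point.\<close>

lemma riemann_liouville_increment:
  assumes sv: "0 \<le> s" "s \<le> v" "v < T" and al: "0 \<le> \<alpha>" "\<alpha> \<le> 1"
    and int: "set_integrable lborel {0..v} (\<lambda>u. L u \<omega>)"
  shows "riemann_liouville T \<alpha> L v \<omega> - riemann_liouville T \<alpha> L s \<omega>
     = wt \<alpha> v * (L v \<omega> - L s \<omega>) + remainder \<alpha> s v \<omega>"
proof (cases "\<alpha> = 0")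
  case True
  then show ?thesis using sv by (simp add: riemann_liouville_def wt_def remainder_def)
next
  case False
  then have al0: "0 < \<alpha>" using al by auto
  let ?k = "\<lambda>u. (T - u) powr (\<alpha> - 1)"
  have kint: "integrable lborel (\<lambda>u. indicator {x..T} u * ?k u)"
    and kval: "(\<integral>u. indicator {x..T} u * ?k u \<partial>lborel) = (T - x) powr \<alpha> / \<alpha>" if "x \<le> T" for x
  proof -
    show i: "integrable lborel (\<lambda>u. indicator {x..T} u * ?k u)"
      by (rule integrableI_nonneg) (use nn_integral_power_kernel[OF al0 that] in \<open>auto simp: ennreal_less_top\<close>)
    have "ennreal (\<integral>u. indicator {x..T} u * ?k u \<partial>lborel) = ennreal ((T - x) powr \<alpha> / \<alpha>)"
      using nn_integral_eq_integral[OF i] nn_integral_power_kernel[OF al0 that] by simp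
    then show "(\<integral>u. indicator {x..T} u * ?k u \<partial>lborel) = (T - x) powr \<alpha> / \<alpha>"
      using al0 that by (subst (asm) ennreal_inj) auto
  qed
  have Li: "integrable lborel (\<lambda>u. indicator {0..x} u * (?k u * L u \<omega>))" if x: "0 \<le> x" "x \<le> v" for x
  proof -
    have m: "(\<lambda>u. indicator {0..v} u * L u \<omega>) \<in> borel_measurable borel"
      using int unfolding set_integrable_def by (auto dest!: borel_measurable_integrable)
    have m2: "(\<lambda>u. indicator {0..x} u * (?k u * L u \<omega>)) = (\<lambda>u. indicator {0..x} u * ?k u * (indicator {0..v} u * L u \<omega>))"
      using x by (auto simp: indicator_def)
    have mm: "(\<lambda>u. indicator {0..x} u * (?k u * L u \<omega>)) \<in> borel_measurable lborel"
      unfolding m2 using m by measurable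
    \<comment> \<open>For \<alpha> \<le> 1 the kernel increases in u, so up to v < T it is dominated
      by its value at v, and the singularity at T is not met.\<close>
    have b: "integrable lborel (\<lambda>u. ?k v * (indicator {0..v} u * L u \<omega>))"
      using int unfolding set_integrable_def by simp
    show ?thesis
    proof (rule Bochner_Integration.integrable_bound[OF b mm], rule AE_I2)
      fix u
      show "norm (indicator {0..x} u * (?k u * L u \<omega>)) \<le> norm (?k v * (indicator {0..v} u * L u \<omega>))"
        using kernel_bound[OF al(2), of u v] sv x by (auto simp: indicator_def abs_mult intro!: mult_right_mono)
    qed
  qed
  have RLint: "integrable lborel (\<lambda>u. indicator {0..T} u * (?k u * L (min u x) \<omega>))" if x: "0 \<le> x" "x \<le> v" for x
  proof -
    have "integrable lborel (\<lambda>u. indicator {0..x} u * (?k u * L u \<omega>) + L x \<omega> * (indicator {x..T} u * ?k u))"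
      using Li[OF x] kint[of x] x sv by (intro Bochner_Integration.integrable_add integrable_mult_right) auto
    then show ?thesis
    proof (rule integrable_cong_AE_imp)
      show "(\<lambda>u. indicator {0..T} u * (?k u * L (min u x) \<omega>)) \<in> borel_measurable lborel"
      proof -
        have "(\<lambda>u. indicator {0..T} u * (?k u * L (min u x) \<omega>))
          = (\<lambda>u. indicator {0..x} u * (?k u * L u \<omega>) + L x \<omega> * (indicator {x<..T} u * ?k u))"
          using x sv by (auto simp: indicator_def fun_eq_iff min_def)
        then show ?thesis using borel_measurable_integrable[OF Li[OF x]] by simp
      qed
      have "AE u in lborel. u \<noteq> x" by (rule AE_lborel_singleton)
      then show "AE u in lborel. indicator {0..x} u * (?k u * L u \<omega>) + L x \<omega> * (indicator {x..T} u * ?k u)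
          = indicator {0..T} u * (?k u * L (min u x) \<omega>)"
        by eventually_elim (use x sv in \<open>auto simp: indicator_def min_def\<close>)
    qed
  qed
  have R: "integrable lborel (\<lambda>u. indicator {s..v} u * (?k u * (L u \<omega> - L s \<omega>)))"
  proof -
    have "integrable lborel (\<lambda>u. indicator {s..v} u * (indicator {0..v} u * (?k u * L u \<omega>)))"
      using integrable_mult_indicator[OF _ Li[of v], of "{s..v}"] sv by simp
    moreover have "integrable lborel (\<lambda>u. indicator {s..v} u * (indicator {s..T} u * ?k u))"
      using integrable_mult_indicator[OF _ kint[of s], of "{s..v}"] sv by simp
    ultimately have "integrable lborel (\<lambda>u. indicator {s..v} u * (indicator {0..v} u * (?k u * L u \<omega>))
        - L s \<omega> * (indicator {s..v} u * (indicator {s..T} u * ?k u)))"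
      by (intro Bochner_Integration.integrable_diff integrable_mult_right)
    moreover have "(\<lambda>u. indicator {s..v} u * (indicator {0..v} u * (?k u * L u \<omega>))
        - L s \<omega> * (indicator {s..v} u * (indicator {s..T} u * ?k u))) = (\<lambda>u. indicator {s..v} u * (?k u * (L u \<omega> - L s \<omega>)))"
      using sv by (auto simp: indicator_def fun_eq_iff algebra_simps)
    ultimately show ?thesis by simp
  qed
  have "(\<integral>u. indicator {0..T} u * (?k u * L (min u v) \<omega>) \<partial>lborel) - (\<integral>u. indicator {0..T} u * (?k u * L (min u s) \<omega>) \<partial>lborel)
     = (\<integral>u. indicator {0..T} u * (?k u * L (min u v) \<omega>) - indicator {0..T} u * (?k u * L (min u s) \<omega>) \<partial>lborel)"
    using RLint sv by (intro Bochner_Integration.integral_diff[symmetric]) auto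
  \<comment> \<open>The stopped paths differ by 0 before s, by L_u - L_s on [s, v] and by the
    constant L_v - L_s after v. The equality is only almost everywhere because closed intervals
    count u = v twice.\<close>
  also have "\<dots> = (\<integral>u. indicator {s..v} u * (?k u * (L u \<omega> - L s \<omega>)) + (L v \<omega> - L s \<omega>) * (indicator {v..T} u * ?k u) \<partial>lborel)"
  proof (rule integral_cong_AE)
    have "AE u in lborel. u \<noteq> v" by (rule AE_lborel_singleton)
    moreover have "AE u in lborel. u \<noteq> s" by (rule AE_lborel_singleton)
    ultimately show "AE u in lborel. indicator {0..T} u * (?k u * L (min u v) \<omega>) - indicator {0..T} u * (?k u * L (min u s) \<omega>)
       = indicator {s..v} u * (?k u * (L u \<omega> - L s \<omega>)) + (L v \<omega> - L s \<omega>) * (indicator {v..T} u * ?k u)"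
      by eventually_elim (use sv in \<open>auto simp: indicator_def min_def algebra_simps\<close>)
  qed (use RLint sv R kint in \<open>auto intro!: borel_measurable_integrable\<close>)
  also have "\<dots> = (\<integral>u. indicator {s..v} u * (?k u * (L u \<omega> - L s \<omega>)) \<partial>lborel) + (L v \<omega> - L s \<omega>) * ((T - v) powr \<alpha> / \<alpha>)"
    using R kint[of v] kval[of v] sv by simp
  finally have *: "(\<integral>u. indicator {0..T} u * (?k u * L (min u v) \<omega>) \<partial>lborel) - (\<integral>u. indicator {0..T} u * (?k u * L (min u s) \<omega>) \<partial>lborel) = \<dots>" .
  have "riemann_liouville T \<alpha> L v \<omega> - riemann_liouville T \<alpha> L s \<omega>
     = \<alpha> / T powr \<alpha> * ((\<integral>u. indicator {0..T} u * (?k u * L (min u v) \<omega>) \<partial>lborel) - (\<integral>u. indicator {0..T} u * (?k u * L (min u s) \<omega>) \<partial>lborel))"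
    using False by (simp add: riemann_liouville_def set_lebesgue_integral_def right_diff_distrib)
  also have "\<dots> = wt \<alpha> v * (L v \<omega> - L s \<omega>) + remainder \<alpha> s v \<omega>"
    unfolding * using al0 sv T_pos
    by (simp add: remainder_def set_lebesgue_integral_def wt_def powr_divide field_simps)
  finally show ?thesis .
qed

lemma remainder_meas:
  assumes "0 \<le> s" "s \<le> v" "v < T"
  shows "remainder \<alpha> s v \<in> borel_measurable M"
proof -
  have eq: "remainder \<alpha> s v
      = (\<lambda>\<omega>. \<alpha> / T powr \<alpha> * (\<integral>u. indicator {s..v} u * ((T - u) powr (\<alpha> - 1) * (Lz u \<omega> - Lz s \<omega>)) \<partial>lborel))"
  proof
    fix \<omega>
    have e: "indicator {s..v} u *\<^sub>R ((T - u) powr (\<alpha> - 1) * (L u \<omega> - L s \<omega>))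
        = indicator {s..v} u * ((T - u) powr (\<alpha> - 1) * (Lz u \<omega> - Lz s \<omega>))" for u
      using assms by (auto simp: indicator_def Lz_def)
    show "remainder \<alpha> s v \<omega>
      = \<alpha> / T powr \<alpha> * (\<integral>u. indicator {s..v} u * ((T - u) powr (\<alpha> - 1) * (Lz u \<omega> - Lz s \<omega>)) \<partial>lborel)"
      unfolding remainder_def set_lebesgue_integral_def e ..
  qed
  show ?thesis unfolding eq by measurable
qed

text \<open>For \<alpha> \<le> 1, the square of the largest value of the normalised kernel on
  [0, t].\<close>

definition rem_const :: "real \<Rightarrow> real \<Rightarrow> real" where
  "rem_const \<alpha> t = (\<alpha> / T powr \<alpha> * (T - t) powr (\<alpha> - 1))\<^sup>2"

text \<open>Cauchy-Schwarz on [s, v] gives one factor v - s, and integrating the energies of L_u -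
  L_s over [s, v] gives another. The remaining energy difference telescopes when such bounds are
  summed over a partition.\<close>

lemma remainder_energy:
  assumes sv: "0 \<le> s" "s \<le> v" "v \<le> t" "t < T" and al: "0 \<le> \<alpha>" "\<alpha> \<le> 1"
  shows "(\<integral>\<^sup>+\<omega>. ennreal ((remainder \<alpha> s v \<omega>)\<^sup>2) \<partial>M) \<le> ennreal (rem_const \<alpha> t * (v - s)\<^sup>2 * (energy v - energy s))"
proof -
  have vT: "v < T" using sv by auto
  interpret P: pair_sigma_finite M lborel by unfold_locales
  let ?D = "\<lambda>\<omega> u. indicator {s..v} u * (Lz u \<omega> - Lz s \<omega>)\<^sup>2"
  have ae: "AE \<omega> in M. ennreal ((remainder \<alpha> s v \<omega>)\<^sup>2)
     \<le> ennreal (rem_const \<alpha> t * (v - s)) * (\<integral>\<^sup>+u. ennreal (?D \<omega> u) \<partial>lborel)"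
    using AE_path_integrable[of v, OF order_trans[OF sv(1,2)] vT] AE_space
  proof eventually_elim
    case (elim \<omega>)
    define N where "N = restrict_space lborel {s..v}"
    define \<kappa> where "\<kappa> = (T - t) powr (\<alpha> - 1)"
    define f where "f u = (T - u) powr (\<alpha> - 1) * (Lz u \<omega> - Lz s \<omega>)" for u
    have k: "(T - u) powr (\<alpha> - 1) \<le> \<kappa>" if "u \<in> {s..v}" for u
      unfolding \<kappa>_def using kernel_bound[OF al(2), of u t] that sv by auto
    have [measurable]: "(\<lambda>u. Lz u \<omega>) \<in> borel_measurable borel"
      by (rule Lz_measurable[of "\<lambda>u. u"]) (use elim in auto)
    have fm[measurable]: "f \<in> borel_measurable borel" unfolding f_def by measurable
    have L2: "integrable lborel (\<lambda>u. indicator {0..v} u * (L u \<omega>)\<^sup>2)"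
      using elim unfolding set_integrable_def by simp
    have Di: "integrable lborel (?D \<omega>)"
    proof (rule Bochner_Integration.integrable_bound)
      show "integrable lborel (\<lambda>u. 2 * (indicator {0..v} u * (L u \<omega>)\<^sup>2) + 2 * (L s \<omega>)\<^sup>2 * indicator {s..v} u)"
        using L2 sv by (intro Bochner_Integration.integrable_add integrable_mult_right integrable_real_indicator) auto
      show "AE u in lborel. norm (?D \<omega> u) \<le> norm (2 * (indicator {0..v} u * (L u \<omega>)\<^sup>2) + 2 * (L s \<omega>)\<^sup>2 * indicator {s..v} u)"
      proof (rule AE_I2)
        fix u
        show "norm (?D \<omega> u) \<le> norm (2 * (indicator {0..v} u * (L u \<omega>)\<^sup>2) + 2 * (L s \<omega>)\<^sup>2 * indicator {s..v} u)"
          using square_diff_le[of "L u \<omega>" "L s \<omega>"] sv by (cases "u \<in> {s..v}") (auto simp: Lz_eq)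
      qed
    qed measurable
    have f2: "indicator {s..v} u * (f u)\<^sup>2 \<le> \<kappa>\<^sup>2 * ?D \<omega> u" for u
    proof (cases "u \<in> {s..v}")
      case True
      have "((T - u) powr (\<alpha> - 1))\<^sup>2 \<le> \<kappa>\<^sup>2" using k[OF True] by (intro power_mono) auto
      then show ?thesis using True by (simp add: f_def power_mult_distrib mult_right_mono)
    qed simp
    have f2i: "integrable lborel (\<lambda>u. indicator {s..v} u * (f u)\<^sup>2)"
      by (rule Bochner_Integration.integrable_bound[OF integrable_mult_right[OF Di, of "\<kappa>\<^sup>2"]])
        (use f2 in \<open>auto simp: abs_mult intro!: AE_I2 order_trans[OF f2]\<close>)
    have abs_le: "\<bar>x\<bar> \<le> 1 + x\<^sup>2" for x :: real
      using zero_le_power2[of "\<bar>x\<bar> - 1"] by (simp add: power2_diff)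
    have fi: "integrable lborel (\<lambda>u. indicator {s..v} u * f u)"
    proof (rule Bochner_Integration.integrable_bound)
      show "integrable lborel (\<lambda>u. indicator {s..v} u + indicator {s..v} u * (f u)\<^sup>2)"
        using f2i sv by (intro Bochner_Integration.integrable_add integrable_real_indicator) auto
      have "norm (indicator {s..v} u * f u) \<le> norm (indicator {s..v} u + indicator {s..v} u * (f u)\<^sup>2)" for u
        using abs_le[of "f u"] by (cases "u \<in> {s..v}") auto
      then show "AE u in lborel. norm (indicator {s..v} u * f u) \<le> norm (indicator {s..v} u + indicator {s..v} u * (f u)\<^sup>2)"
        by (rule AE_I2)
    qed measurable
    have fin: "finite_measure N"
      by (rule finite_measureI) (use sv in \<open>auto simp: N_def space_restrict_space emeasure_restrict_space\<close>)
    have mN: "measure N (space N) = v - s"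
      using sv by (simp add: N_def space_restrict_space measure_restrict_space)
    have If: "(\<integral>u. indicator {s..v} u * f u \<partial>lborel)\<^sup>2 \<le> (v - s) * (\<integral>u. indicator {s..v} u * (f u)\<^sup>2 \<partial>lborel)"
      using integral_square_le[OF fin, of f] fi f2i mN
      by (simp add: N_def integrable_restrict_space integral_restrict_space)
    have e: "indicator {s..v} u *\<^sub>R ((T - u) powr (\<alpha> - 1) * (L u \<omega> - L s \<omega>)) = indicator {s..v} u * f u" for u
      using sv by (auto simp: indicator_def Lz_eq f_def)
    have "(remainder \<alpha> s v \<omega>)\<^sup>2 = (\<alpha> / T powr \<alpha>)\<^sup>2 * (\<integral>u. indicator {s..v} u * f u \<partial>lborel)\<^sup>2"
      unfolding remainder_def set_lebesgue_integral_def e by (simp only: power_mult_distrib)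
    also have "\<dots> \<le> (\<alpha> / T powr \<alpha>)\<^sup>2 * ((v - s) * (\<integral>u. \<kappa>\<^sup>2 * ?D \<omega> u \<partial>lborel))"
      using If f2 f2i Di sv
      by (intro mult_left_mono order_trans[OF If] integral_mono integrable_mult_right) auto
    also have "\<dots> = rem_const \<alpha> t * (v - s) * (\<integral>u. ?D \<omega> u \<partial>lborel)"
      by (simp add: rem_const_def \<kappa>_def power_mult_distrib power_divide)
    finally have "ennreal ((remainder \<alpha> s v \<omega>)\<^sup>2) \<le> ennreal (rem_const \<alpha> t * (v - s) * (\<integral>u. ?D \<omega> u \<partial>lborel))"
      by (rule ennreal_leI)
    also have "\<dots> = ennreal (rem_const \<alpha> t * (v - s)) * ennreal (\<integral>u. ?D \<omega> u \<partial>lborel)"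
      using sv by (intro ennreal_mult) (auto simp: rem_const_def)
    also have "ennreal (\<integral>u. ?D \<omega> u \<partial>lborel) = (\<integral>\<^sup>+u. ennreal (?D \<omega> u) \<partial>lborel)"
      by (rule nn_integral_eq_integral[symmetric, OF Di]) auto
    finally show ?case .
  qed
  have "(\<integral>\<^sup>+\<omega>. ennreal ((remainder \<alpha> s v \<omega>)\<^sup>2) \<partial>M)
      \<le> (\<integral>\<^sup>+\<omega>. ennreal (rem_const \<alpha> t * (v - s)) * (\<integral>\<^sup>+u. ennreal (?D \<omega> u) \<partial>lborel) \<partial>M)"
    by (rule nn_integral_mono_AE[OF ae])
  also have "\<dots> = ennreal (rem_const \<alpha> t * (v - s)) * (\<integral>\<^sup>+\<omega>. (\<integral>\<^sup>+u. ennreal (?D \<omega> u) \<partial>lborel) \<partial>M)"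
    by (rule nn_integral_cmult) measurable
  also have "(\<integral>\<^sup>+\<omega>. (\<integral>\<^sup>+u. ennreal (?D \<omega> u) \<partial>lborel) \<partial>M) = (\<integral>\<^sup>+u. (\<integral>\<^sup>+\<omega>. ennreal (?D \<omega> u) \<partial>M) \<partial>lborel)"
    by (rule P.Fubini'[symmetric]) measurable
  also have "\<dots> \<le> (\<integral>\<^sup>+u. ennreal (energy v - energy s) * indicator {s..v} u \<partial>lborel)"
  proof (rule nn_integral_mono)
    fix u
    show "(\<integral>\<^sup>+\<omega>. ennreal (?D \<omega> u) \<partial>M) \<le> ennreal (energy v - energy s) * indicator {s..v} u"
    proof (cases "u \<in> {s..v}")
      case True
      then have "(\<integral>\<^sup>+\<omega>. ennreal ((L u \<omega> - L s \<omega>)\<^sup>2) \<partial>M) = ennreal (energy u - energy s)"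
        using sv by (intro nn_increment_energy) auto
      then show ?thesis using True sv energy_mono[of u v] by (auto simp: Lz_eq intro!: ennreal_leI)
    qed simp
  qed
  also have "\<dots> = ennreal (energy v - energy s) * ennreal (v - s)"
    using sv by (simp add: nn_integral_cmult)
  finally have "(\<integral>\<^sup>+\<omega>. ennreal ((remainder \<alpha> s v \<omega>)\<^sup>2) \<partial>M)
     \<le> ennreal (rem_const \<alpha> t * (v - s)) * (ennreal (energy v - energy s) * ennreal (v - s))"
    by (metis mult_left_mono zero_le)
  also have "\<dots> = ennreal (rem_const \<alpha> t * (v - s) * ((energy v - energy s) * (v - s)))"
    using sv energy_mono[OF sv(1,2) vT] by (subst (1 2) ennreal_mult) (auto simp: rem_const_def)
  also have "rem_const \<alpha> t * (v - s) * ((energy v - energy s) * (v - s)) = rem_const \<alpha> t * (v - s)\<^sup>2 * (energy v - energy s)"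
    by (simp add: power2_eq_square)
  finally show ?thesis .
qed

end

section \<open>Weighted square sums and the square bracket\<close>

definition uniform_net :: "real \<Rightarrow> nat \<Rightarrow> nat \<Rightarrow> real" where
  "uniform_net t n i = t * real i / real n"

lemma uniform_net_partition: "0 \<le> t \<Longrightarrow> 0 < n \<Longrightarrow> is_partition t n (uniform_net t n)"
  by (auto simp: is_partition_def uniform_net_def intro!: divide_right_mono mult_left_mono)

lemma uniform_net_step: "uniform_net t n (Suc i) - uniform_net t n i = t / real n"
  by (simp add: uniform_net_def diff_divide_distrib[symmetric] algebra_simps)

locale l2_bracket = l2_process +
  fixes \<alpha> :: real and Q :: "real \<Rightarrow> 'a \<Rightarrow> real"
  assumes al: "0 \<le> \<alpha>" "\<alpha> \<le> 1"
    and bracket: "square_bracket M T F (riemann_liouville T \<alpha> L) Q"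
begin

abbreviation X :: "real \<Rightarrow> 'a \<Rightarrow> real" where "X \<equiv> riemann_liouville T \<alpha> L"

text \<open>The weight sits at the right end of each step, to match
  \<open>riemann_liouville_increment\<close>. It is deterministic, so this choice does not interfere
  with the martingale property.\<close>

definition weighted_sum :: "nat \<Rightarrow> (nat \<Rightarrow> real) \<Rightarrow> 'a \<Rightarrow> real" where
  "weighted_sum m p \<omega> = (\<Sum>i<m. (wt \<alpha> (p (Suc i)))\<^sup>2 * (L (p (Suc i)) \<omega> - L (p i) \<omega>)\<^sup>2)"

lemma weighted_sum_nonneg: "0 \<le> weighted_sum m p \<omega>"
  by (simp add: weighted_sum_def sum_nonneg)

lemma weighted_sum_le:
  assumes "is_partition t m p" "t < T"
  shows "weighted_sum m p \<omega> \<le> square_sum L m p \<omega>"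
  unfolding weighted_sum_def square_sum_def
proof (intro sum_mono)
  fix i assume "i \<in> {..<m}"
  then have "0 < wt \<alpha> (p (Suc i)) \<and> wt \<alpha> (p (Suc i)) \<le> 1"
    using is_partition_range[OF assms(1), of "Suc i"] assms(2) al by (intro wt_bounds) auto
  then have "(wt \<alpha> (p (Suc i)))\<^sup>2 \<le> 1" by (simp add: power_le_one)
  then show "(wt \<alpha> (p (Suc i)))\<^sup>2 * (L (p (Suc i)) \<omega> - L (p i) \<omega>)\<^sup>2 \<le> (L (p (Suc i)) \<omega> - L (p i) \<omega>)\<^sup>2"
    using mult_right_mono[of "(wt \<alpha> (p (Suc i)))\<^sup>2" 1 "(L (p (Suc i)) \<omega> - L (p i) \<omega>)\<^sup>2"] by simp
qed

lemma weighted_sum_meas: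
  assumes "is_partition t m p" "t < T"
  shows "weighted_sum m p \<in> borel_measurable M"
proof -
  have "L (p i) \<in> borel_measurable M" if "i \<le> m" for i
    using is_partition_range[OF assms(1) that] assms(2) by (intro L_meas) auto
  then show ?thesis
    unfolding weighted_sum_def[abs_def]
    by (intro borel_measurable_sum borel_measurable_times borel_measurable_power borel_measurable_diff) auto
qed

lemma weighted_sum_integrable:
  assumes "is_partition t m p" "t < T"
  shows "integrable M (weighted_sum m p)"
  by (rule Bochner_Integration.integrable_bound[OF square_sum_energy(1)[OF assms] weighted_sum_meas[OF assms]])
    (use weighted_sum_le[OF assms] weighted_sum_nonneg in \<open>auto intro!: AE_I2 order_trans[OF weighted_sum_le[OF assms]]\<close>)

lemma square_sum_riemann_liouville_meas:
  assumes "is_partition t m p" "t < T"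
  shows "square_sum X m p \<in> borel_measurable M"
proof -
  have "X (p i) \<in> borel_measurable M" if "i \<le> m" for i
    using is_partition_range[OF assms(1) that] assms(2) by (intro riemann_liouville_meas) auto
  then show ?thesis
    unfolding square_sum_def[abs_def]
    by (intro borel_measurable_sum borel_measurable_power borel_measurable_diff) auto
qed

text \<open>An increment of X is a + R with a the weighted increment of L. Young's inequality with
  parameter \<delta> gives |(a + R)^2 - a^2| \<le> \<delta> a^2 + (1 + 1/\<delta>) R^2. Since E R^2
  carries a factor \<delta>^2, the mesh bound itself can serve as the parameter, and (1 +
  1/\<delta>) \<delta>^2 = \<delta>^2 + \<delta>. The energy differences add up to
  \<open>energy t\<close>.\<close>

lemma square_sum_approx:
  assumes p: "is_partition t m p" and t: "t < T"
    and mesh: "\<And>i. i < m \<Longrightarrow> p (Suc i) - p i \<le> \<delta>" and d: "0 < \<delta>"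
  shows "integrable M (\<lambda>\<omega>. \<bar>square_sum X m p \<omega> - weighted_sum m p \<omega>\<bar>)"
    and "(\<integral>\<omega>. \<bar>square_sum X m p \<omega> - weighted_sum m p \<omega>\<bar> \<partial>M) \<le> (\<delta> + (\<delta>\<^sup>2 + \<delta>) * rem_const \<alpha> t) * energy t"
proof -
  have r: "0 \<le> p i" "p i \<le> t" if "i \<le> m" for i using is_partition_range[OF p that] by auto
  have mono: "p i \<le> p (Suc i)" if "i < m" for i using is_partition_mono[OF p] that by auto
  have t0: "0 \<le> t" using r[of 0] by auto
  define d where "d i \<omega> = L (p (Suc i)) \<omega> - L (p i) \<omega>" for i \<omega>
  define R where "R i = remainder \<alpha> (p i) (p (Suc i))" for i
  define c where "c = 1 + 1 / \<delta>"
  have c: "0 < c" unfolding c_def using d by (simp add: add_pos_pos)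
  have Rm: "R i \<in> borel_measurable M" if "i < m" for i
    unfolding R_def using r[of i] r[of "Suc i"] mono[OF that] that t by (intro remainder_meas) auto
  have dm: "d i \<in> borel_measurable M" if "i < m" for i
    unfolding d_def using r[of i] r[of "Suc i"] that t by (intro borel_measurable_diff L_meas) auto
  note Xm = square_sum_riemann_liouville_meas[OF p t]
  have ae: "AE \<omega> in M. \<bar>square_sum X m p \<omega> - weighted_sum m p \<omega>\<bar> \<le> (\<Sum>i<m. \<delta> * (d i \<omega>)\<^sup>2 + c * (R i \<omega>)\<^sup>2)"
    using AE_path_integrable[OF t0 t]
  proof eventually_elim
    case (elim \<omega>)
    have eq: "square_sum X m p \<omega> - weighted_sum m p \<omega>
        = (\<Sum>i<m. (X (p (Suc i)) \<omega> - X (p i) \<omega>)\<^sup>2 - (wt \<alpha> (p (Suc i)))\<^sup>2 * (d i \<omega>)\<^sup>2)"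
      by (simp add: square_sum_def weighted_sum_def d_def sum_subtractf)
    have "\<bar>square_sum X m p \<omega> - weighted_sum m p \<omega>\<bar> \<le> (\<Sum>i<m. \<bar>(X (p (Suc i)) \<omega> - X (p i) \<omega>)\<^sup>2 - (wt \<alpha> (p (Suc i)))\<^sup>2 * (d i \<omega>)\<^sup>2\<bar>)"
      unfolding eq by (rule sum_abs)
    also have "\<dots> \<le> (\<Sum>i<m. \<delta> * (d i \<omega>)\<^sup>2 + c * (R i \<omega>)\<^sup>2)"
    proof (rule sum_mono)
      fix i assume "i \<in> {..<m}"
      then have i: "i < m" by simp
      have b: "0 \<le> p i" "p i \<le> p (Suc i)" "p (Suc i) < T" "p (Suc i) \<le> t"
        using r[of i] r[of "Suc i"] mono[OF i] i t by auto
      have "set_integrable lborel {0..p (Suc i)} (\<lambda>u. L u \<omega>)"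
        by (rule set_integrable_subset[of _ "{0..t}"]) (use elim b in auto)
      from riemann_liouville_increment[OF b(1-3) al this]
      have X: "X (p (Suc i)) \<omega> - X (p i) \<omega> = wt \<alpha> (p (Suc i)) * d i \<omega> + R i \<omega>"
        by (simp add: d_def R_def)
      define a where "a = wt \<alpha> (p (Suc i)) * d i \<omega>"
      have "0 < wt \<alpha> (p (Suc i)) \<and> wt \<alpha> (p (Suc i)) \<le> 1" using b al by (intro wt_bounds) auto
      then have "(wt \<alpha> (p (Suc i)))\<^sup>2 \<le> 1" by (simp add: power_le_one)
      then have a2: "a\<^sup>2 \<le> (d i \<omega>)\<^sup>2"
        using mult_right_mono[of "(wt \<alpha> (p (Suc i)))\<^sup>2" 1 "(d i \<omega>)\<^sup>2"] by (simp add: a_def power_mult_distrib)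
      have y: "\<bar>2 * a * y\<bar> \<le> \<delta> * a\<^sup>2 + y\<^sup>2 / \<delta>" for y
      proof -
        have "0 \<le> (\<delta> * \<bar>a\<bar> - \<bar>y\<bar>)\<^sup>2" by simp
        also have "\<dots> = \<delta> * \<delta> * a\<^sup>2 + y\<^sup>2 - 2 * \<delta> * \<bar>a\<bar> * \<bar>y\<bar>"
          by (simp add: power2_diff power_mult_distrib) (simp add: power2_eq_square)
        also have "\<dots> = \<delta> * (\<delta> * a\<^sup>2 + y\<^sup>2 / \<delta> - 2 * \<bar>a\<bar> * \<bar>y\<bar>)"
          using d by (simp add: right_diff_distrib distrib_left)
        finally have "0 \<le> \<delta> * a\<^sup>2 + y\<^sup>2 / \<delta> - 2 * \<bar>a\<bar> * \<bar>y\<bar>"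
          using d by (simp add: zero_le_mult_iff)
        then show ?thesis by (simp add: abs_mult)
      qed
      have eq: "(a + R i \<omega>)\<^sup>2 - a\<^sup>2 = 2 * a * R i \<omega> + (R i \<omega>)\<^sup>2" by (simp add: power2_sum)
      have "\<bar>(a + R i \<omega>)\<^sup>2 - a\<^sup>2\<bar> \<le> \<delta> * a\<^sup>2 + c * (R i \<omega>)\<^sup>2"
      proof -
        have "c * (R i \<omega>)\<^sup>2 = (R i \<omega>)\<^sup>2 + (R i \<omega>)\<^sup>2 / \<delta>" by (simp add: c_def distrib_right)
        then show ?thesis
          unfolding eq using y[of "R i \<omega>"] abs_triangle_ineq[of "2 * a * R i \<omega>" "(R i \<omega>)\<^sup>2"] by (simp only: abs_power2)
      qed
      also have "\<dots> \<le> \<delta> * (d i \<omega>)\<^sup>2 + c * (R i \<omega>)\<^sup>2" using a2 d by simp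
      finally show "\<bar>(X (p (Suc i)) \<omega> - X (p i) \<omega>)\<^sup>2 - (wt \<alpha> (p (Suc i)))\<^sup>2 * (d i \<omega>)\<^sup>2\<bar> \<le> \<delta> * (d i \<omega>)\<^sup>2 + c * (R i \<omega>)\<^sup>2"
        unfolding X a_def by (simp add: power_mult_distrib)
    qed
    finally show ?case .
  qed
  define e where "e i = energy (p (Suc i)) - energy (p i)" for i
  have e0: "0 \<le> e i" if "i < m" for i
    unfolding e_def using energy_mono[of "p i" "p (Suc i)"] r[of i] r[of "Suc i"] mono[OF that] that t by auto
  have esum: "(\<Sum>i<m. e i) = energy t"
    unfolding e_def using p energy_0 by (subst sum_lessThan_telescope) (auto simp: is_partition_def)
  have rc0: "0 \<le> rem_const \<alpha> t" by (simp add: rem_const_def)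
  have nn: "(\<integral>\<^sup>+\<omega>. ennreal \<bar>square_sum X m p \<omega> - weighted_sum m p \<omega>\<bar> \<partial>M)
      \<le> ennreal ((\<delta> + (\<delta>\<^sup>2 + \<delta>) * rem_const \<alpha> t) * energy t)"
  proof -
    have "(\<integral>\<^sup>+\<omega>. ennreal \<bar>square_sum X m p \<omega> - weighted_sum m p \<omega>\<bar> \<partial>M)
       \<le> (\<integral>\<^sup>+\<omega>. (\<Sum>i<m. ennreal \<delta> * ennreal ((d i \<omega>)\<^sup>2) + ennreal c * ennreal ((R i \<omega>)\<^sup>2)) \<partial>M)"
    proof (rule nn_integral_mono_AE)
      show "AE \<omega> in M. ennreal \<bar>square_sum X m p \<omega> - weighted_sum m p \<omega>\<bar>
        \<le> (\<Sum>i<m. ennreal \<delta> * ennreal ((d i \<omega>)\<^sup>2) + ennreal c * ennreal ((R i \<omega>)\<^sup>2))"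
        using ae
      proof eventually_elim
        case (elim \<omega>)
        have "ennreal \<bar>square_sum X m p \<omega> - weighted_sum m p \<omega>\<bar> \<le> ennreal (\<Sum>i<m. \<delta> * (d i \<omega>)\<^sup>2 + c * (R i \<omega>)\<^sup>2)"
          using elim by (rule ennreal_leI)
        also have "\<dots> = (\<Sum>i<m. ennreal \<delta> * ennreal ((d i \<omega>)\<^sup>2) + ennreal c * ennreal ((R i \<omega>)\<^sup>2))"
          using d c by (subst sum_ennreal[symmetric]) (auto simp: ennreal_mult ennreal_plus)
        finally show ?case .
      qed
    qed
    also have "\<dots> = (\<Sum>i<m. ennreal \<delta> * (\<integral>\<^sup>+\<omega>. ennreal ((d i \<omega>)\<^sup>2) \<partial>M) + ennreal c * (\<integral>\<^sup>+\<omega>. ennreal ((R i \<omega>)\<^sup>2) \<partial>M))"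
      using dm Rm by (subst nn_integral_sum) (auto simp: nn_integral_add nn_integral_cmult intro!: sum.cong)
    also have "\<dots> \<le> (\<Sum>i<m. ennreal ((\<delta> + (\<delta>\<^sup>2 + \<delta>) * rem_const \<alpha> t) * e i))"
    proof (rule sum_mono)
      fix i assume "i \<in> {..<m}"
      then have i: "i < m" by simp
      have b: "0 \<le> p i" "p i \<le> p (Suc i)" "p (Suc i) < T" "p (Suc i) \<le> t"
        using r[of i] r[of "Suc i"] mono[OF i] i t by auto
      have "(\<integral>\<^sup>+\<omega>. ennreal ((d i \<omega>)\<^sup>2) \<partial>M) = ennreal (e i)"
        unfolding d_def e_def by (rule nn_increment_energy[OF b(1-3)])
      moreover have "(\<integral>\<^sup>+\<omega>. ennreal ((R i \<omega>)\<^sup>2) \<partial>M) \<le> ennreal (rem_const \<alpha> t * \<delta>\<^sup>2 * e i)"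
      proof -
        have "(\<integral>\<^sup>+\<omega>. ennreal ((R i \<omega>)\<^sup>2) \<partial>M) \<le> ennreal (rem_const \<alpha> t * (p (Suc i) - p i)\<^sup>2 * e i)"
          unfolding R_def e_def by (rule remainder_energy[OF b(1,2,4) t al])
        also have "\<dots> \<le> ennreal (rem_const \<alpha> t * \<delta>\<^sup>2 * e i)"
          using mesh[OF i] b e0[OF i] rc0 by (intro ennreal_leI mult_right_mono mult_left_mono power_mono) auto
        finally show ?thesis .
      qed
      ultimately have "ennreal \<delta> * (\<integral>\<^sup>+\<omega>. ennreal ((d i \<omega>)\<^sup>2) \<partial>M) + ennreal c * (\<integral>\<^sup>+\<omega>. ennreal ((R i \<omega>)\<^sup>2) \<partial>M)
        \<le> ennreal \<delta> * ennreal (e i) + ennreal c * ennreal (rem_const \<alpha> t * \<delta>\<^sup>2 * e i)"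
        by (intro add_mono mult_left_mono) auto
      also have "\<dots> = ennreal (\<delta> * e i + c * (rem_const \<alpha> t * \<delta>\<^sup>2 * e i))"
        using d c e0[OF i] rc0 by (simp add: ennreal_mult[symmetric] ennreal_plus[symmetric] del: ennreal_plus)
      also have "\<delta> * e i + c * (rem_const \<alpha> t * \<delta>\<^sup>2 * e i) = (\<delta> + (\<delta>\<^sup>2 + \<delta>) * rem_const \<alpha> t) * e i"
        using d by (simp add: c_def field_simps power2_eq_square)
      finally show "ennreal \<delta> * (\<integral>\<^sup>+\<omega>. ennreal ((d i \<omega>)\<^sup>2) \<partial>M) + ennreal c * (\<integral>\<^sup>+\<omega>. ennreal ((R i \<omega>)\<^sup>2) \<partial>M)
        \<le> ennreal ((\<delta> + (\<delta>\<^sup>2 + \<delta>) * rem_const \<alpha> t) * e i)" .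
    qed
    also have "\<dots> = ennreal ((\<delta> + (\<delta>\<^sup>2 + \<delta>) * rem_const \<alpha> t) * energy t)"
      using e0 d rc0 by (subst sum_ennreal) (auto simp: sum_distrib_left[symmetric] esum)
    finally show ?thesis .
  qed
  have m: "(\<lambda>\<omega>. \<bar>square_sum X m p \<omega> - weighted_sum m p \<omega>\<bar>) \<in> borel_measurable M"
    using Xm weighted_sum_meas[OF p t] by measurable
  show i: "integrable M (\<lambda>\<omega>. \<bar>square_sum X m p \<omega> - weighted_sum m p \<omega>\<bar>)"
    using m nn by (intro integrableI_nonneg) (auto simp: le_less_trans[OF _ ennreal_less_top])
  show "(\<integral>\<omega>. \<bar>square_sum X m p \<omega> - weighted_sum m p \<omega>\<bar> \<partial>M) \<le> (\<delta> + (\<delta>\<^sup>2 + \<delta>) * rem_const \<alpha> t) * energy t"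
    using nn energy_nonneg rc0 d unfolding nn_integral_eq_integral[OF i, simplified] by (subst (asm) ennreal_le_iff) auto
qed

section \<open>Weighted square sums converge to the bracket in L_1\<close>

lemma Q_meas: "0 \<le> t \<Longrightarrow> t < T \<Longrightarrow> Q t \<in> borel_measurable M"
  using bracket subalg[of t] measurable_from_subalg[of M "F t" "Q t"] unfolding square_bracket_def by auto

lemma Q_mono: "\<omega> \<in> space M \<Longrightarrow> 0 \<le> s \<Longrightarrow> s \<le> t \<Longrightarrow> t < T \<Longrightarrow> Q s \<omega> \<le> Q t \<omega>"
  using bracket unfolding square_bracket_def by (auto dest!: bspec[where x=\<omega>] simp: mono_on_def)

lemma Q_nonneg: "\<omega> \<in> space M \<Longrightarrow> 0 \<le> t \<Longrightarrow> t < T \<Longrightarrow> 0 \<le> Q t \<omega>"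
  using Q_mono[of \<omega> 0 t] bracket unfolding square_bracket_def by auto

text \<open>Square sums of X and weighted square sums of L are close in L_1, so by Markov's
  inequality the latter inherit the limit in probability. Their uniform integrability comes from the
  domination by the square sums of L, as all weights are at most 1.\<close>

lemma weighted_sum_tendsto_bracket:
  assumes t: "0 \<le> t" "t < T"
    and p: "\<And>k. is_partition t (m k) (p k)"
    and mesh: "\<And>\<delta>. 0 < \<delta> \<Longrightarrow> \<forall>\<^sub>F k in sequentially. \<forall>i<m k. p k (Suc i) - p k i < \<delta>"
  shows "integrable M (Q t)" and "(\<lambda>k. \<integral>\<omega>. \<bar>weighted_sum (m k) (p k) \<omega> - Q t \<omega>\<bar> \<partial>M) \<longlonglongrightarrow> 0"
proof -
  note [measurable] = Q_meas[OF t]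
  have Wm[measurable]: "weighted_sum (m k) (p k) \<in> borel_measurable M" for k using weighted_sum_meas[OF p t(2)] .
  note Xm[measurable] = square_sum_riemann_liouville_meas[OF p t(2)]
  let ?Y = "\<lambda>k \<omega>. \<bar>square_sum X (m k) (p k) \<omega> - weighted_sum (m k) (p k) \<omega>\<bar>"
  have Y: "(\<lambda>k. \<integral>\<omega>. ?Y k \<omega> \<partial>M) \<longlonglongrightarrow> 0"
  proof (rule LIMSEQ_I)
    fix e :: real assume e: "0 < e"
    have "((\<lambda>\<delta>. (\<delta> + (\<delta>\<^sup>2 + \<delta>) * rem_const \<alpha> t) * energy t) \<longlongrightarrow> (0 + (0\<^sup>2 + 0) * rem_const \<alpha> t) * energy t) (at_right 0)"
      by (intro tendsto_intros)
    then have "eventually (\<lambda>\<delta>. (\<delta> + (\<delta>\<^sup>2 + \<delta>) * rem_const \<alpha> t) * energy t < e) (at_right 0)"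
      by (rule order_tendstoD) (use e in simp)
    then have "eventually (\<lambda>\<delta>. (\<delta> + (\<delta>\<^sup>2 + \<delta>) * rem_const \<alpha> t) * energy t < e \<and> 0 < \<delta>) (at_right 0)"
      using eventually_at_right_less[of 0] by eventually_elim auto
    then obtain \<delta> where \<delta>: "(\<delta> + (\<delta>\<^sup>2 + \<delta>) * rem_const \<alpha> t) * energy t < e" "0 < \<delta>"
      using eventually_happens by force
    obtain N where N: "\<And>k i. k \<ge> N \<Longrightarrow> i < m k \<Longrightarrow> p k (Suc i) - p k i < \<delta>"
      using mesh[OF \<delta>(2)] unfolding eventually_sequentially by blast
    have "norm ((\<integral>\<omega>. ?Y k \<omega> \<partial>M) - 0) < e" if "N \<le> k" for k
    proof -
      have "(\<integral>\<omega>. ?Y k \<omega> \<partial>M) \<le> (\<delta> + (\<delta>\<^sup>2 + \<delta>) * rem_const \<alpha> t) * energy t"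
        using N[OF that] by (intro square_sum_approx(2)[OF p t(2) _ \<delta>(2)] less_imp_le)
      moreover have "0 \<le> (\<integral>\<omega>. ?Y k \<omega> \<partial>M)" by (intro Bochner_Integration.integral_nonneg) simp
      ultimately show ?thesis using \<delta>(1) unfolding real_norm_def by linarith
    qed
    then show "\<exists>no. \<forall>k\<ge>no. norm ((\<integral>\<omega>. ?Y k \<omega> \<partial>M) - 0) < e" by blast
  qed
  \<comment> \<open>\<open>square_sum_approx\<close> is applied with mesh bound 1, which holds only
    for late k; the early ones do not affect the limit.\<close>
  have Yi: "\<exists>N. \<forall>k\<ge>N. integrable M (?Y k)"
  proof -
    obtain N where "\<And>k i. k \<ge> N \<Longrightarrow> i < m k \<Longrightarrow> p k (Suc i) - p k i < 1"
      using mesh[of 1] unfolding eventually_sequentially by auto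
    then show ?thesis by (intro exI[of _ N] allI impI square_sum_approx(1)[OF p t(2), of _ 1] less_imp_le) auto
  qed
  have prob: "(\<lambda>k. measure M {\<omega>\<in>space M. \<bar>weighted_sum (m k) (p k) \<omega> - Q t \<omega>\<bar> > \<epsilon>}) \<longlonglongrightarrow> 0" if e: "0 < \<epsilon>" for \<epsilon>
  proof (rule tendsto_sandwich[of "\<lambda>_. 0"])
    have P1: "(\<lambda>k. measure M {\<omega>\<in>space M. \<bar>square_sum X (m k) (p k) \<omega> - Q t \<omega>\<bar> > \<epsilon> / 2}) \<longlonglongrightarrow> 0"
    proof -
      have "\<forall>m p. (\<forall>k. is_partition t (m k) (p k)) \<longrightarrow>
        (\<forall>\<delta>>0. \<forall>\<^sub>F k in sequentially. \<forall>i<m k. p k (Suc i) - p k i < \<delta>) \<longrightarrow>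
        (\<forall>\<epsilon>>0. (\<lambda>k. measure M {\<omega>\<in>space M.
            \<bar>(\<Sum>i<m k. (X (p k (Suc i)) \<omega> - X (p k i) \<omega>)\<^sup>2) - Q t \<omega>\<bar> > \<epsilon>}) \<longlonglongrightarrow> 0)"
        using bracket t unfolding square_bracket_def by auto
      from this[rule_format, of m p "\<epsilon> / 2"] p mesh e show ?thesis
        unfolding square_sum_def by simp
    qed
    have "(\<lambda>k. (\<integral>\<omega>. ?Y k \<omega> \<partial>M) / (\<epsilon> / 2)) \<longlonglongrightarrow> 0 / (\<epsilon> / 2)"
      by (intro tendsto_intros Y) (use e in auto)
    from tendsto_add[OF P1 this]
    show "(\<lambda>k. measure M {\<omega>\<in>space M. \<bar>square_sum X (m k) (p k) \<omega> - Q t \<omega>\<bar> > \<epsilon> / 2} + (\<integral>\<omega>. ?Y k \<omega> \<partial>M) / (\<epsilon> / 2)) \<longlonglongrightarrow> 0"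
      by simp
    obtain N where N: "\<And>k. k \<ge> N \<Longrightarrow> integrable M (?Y k)" using Yi by blast
    show "eventually (\<lambda>k. measure M {\<omega>\<in>space M. \<bar>weighted_sum (m k) (p k) \<omega> - Q t \<omega>\<bar> > \<epsilon>}
      \<le> measure M {\<omega>\<in>space M. \<bar>square_sum X (m k) (p k) \<omega> - Q t \<omega>\<bar> > \<epsilon> / 2} + (\<integral>\<omega>. ?Y k \<omega> \<partial>M) / (\<epsilon> / 2)) sequentially"
      using eventually_ge_at_top[of N]
    proof eventually_elim
      case (elim k)
      have "measure M {\<omega>\<in>space M. \<bar>weighted_sum (m k) (p k) \<omega> - Q t \<omega>\<bar> > \<epsilon>}
        \<le> measure M ({\<omega>\<in>space M. \<bar>square_sum X (m k) (p k) \<omega> - Q t \<omega>\<bar> > \<epsilon> / 2} \<union> {\<omega>\<in>space M. ?Y k \<omega> \<ge> \<epsilon> / 2})"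
      proof (intro finite_measure_mono subsetI)
        fix \<omega> assume w: "\<omega> \<in> {\<omega>\<in>space M. \<bar>weighted_sum (m k) (p k) \<omega> - Q t \<omega>\<bar> > \<epsilon>}"
        then have "\<bar>weighted_sum (m k) (p k) \<omega> - Q t \<omega>\<bar> > \<epsilon>" by simp
        then have "\<bar>square_sum X (m k) (p k) \<omega> - Q t \<omega>\<bar> > \<epsilon> / 2 \<or> ?Y k \<omega> \<ge> \<epsilon> / 2" by linarith
        then show "\<omega> \<in> {\<omega>\<in>space M. \<bar>square_sum X (m k) (p k) \<omega> - Q t \<omega>\<bar> > \<epsilon> / 2} \<union> {\<omega>\<in>space M. ?Y k \<omega> \<ge> \<epsilon> / 2}"
          using w by blast
      qed measurable
      also have "\<dots> \<le> measure M {\<omega>\<in>space M. \<bar>square_sum X (m k) (p k) \<omega> - Q t \<omega>\<bar> > \<epsilon> / 2} + measure M {\<omega>\<in>space M. ?Y k \<omega> \<ge> \<epsilon> / 2}"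
        by (intro measure_Un_le) measurable
      also have "measure M {\<omega>\<in>space M. ?Y k \<omega> \<ge> \<epsilon> / 2} \<le> (\<integral>\<omega>. ?Y k \<omega> \<partial>M) / (\<epsilon> / 2)"
        using integral_Markov_inequality_measure[OF N[OF elim], of "{}" "\<epsilon> / 2"] e by simp
      finally show ?case by simp
    qed
  qed (auto intro!: always_eventually)
  have ui: "\<exists>a>0. \<forall>k. (\<integral>\<omega>. max 0 (weighted_sum (m k) (p k) \<omega> - a) \<partial>M) \<le> \<epsilon>" if e: "0 < \<epsilon>" for \<epsilon>
  proof -
    obtain a where a: "a > 0" "\<And>m p. is_partition t m p \<Longrightarrow> (\<integral>\<omega>. max 0 (square_sum L m p \<omega> - a) \<partial>M) \<le> \<epsilon>"
      using square_sum_uniformly_integrable[OF t e] by blast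
    have "(\<integral>\<omega>. max 0 (weighted_sum (m k) (p k) \<omega> - a) \<partial>M) \<le> \<epsilon>" for k
    proof (rule order_trans[OF integral_mono a(2)[OF p]])
      show "max 0 (weighted_sum (m k) (p k) \<omega> - a) \<le> max 0 (square_sum L (m k) (p k) \<omega> - a)" for \<omega>
        using weighted_sum_le[OF p t(2), of k \<omega>] by auto
    qed (use weighted_sum_integrable[OF p t(2), of k] square_sum_energy(1)[OF p t(2), of k] in auto)
    then show ?thesis using a by blast
  qed
  note conv = L1_convergence_of_uniformly_integrable[where W="\<lambda>k. weighted_sum (m k) (p k)" and Q="Q t",
      OF weighted_sum_integrable[OF p t(2)] weighted_sum_nonneg Q_meas[OF t] Q_nonneg[OF _ t] prob ui]
  show "integrable M (Q t)" by (rule conv(1))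
  show "(\<lambda>k. \<integral>\<omega>. \<bar>weighted_sum (m k) (p k) \<omega> - Q t \<omega>\<bar> \<partial>M) \<longlonglongrightarrow> 0" by (rule conv(2))
qed

lemma uniform_net_mesh: "0 < \<delta> \<Longrightarrow> \<forall>\<^sub>F k in sequentially. t / real (Suc k) < \<delta>"
proof -
  assume "0 < \<delta>"
  have "(\<lambda>k. t / real (Suc k)) \<longlonglongrightarrow> 0"
    using LIMSEQ_Suc[OF lim_const_over_n[of t]] by simp
  from order_tendstoD(2)[OF this \<open>0 < \<delta>\<close>] show ?thesis .
qed

lemma Q_integrable:
  assumes "0 \<le> t" "t < T"
  shows "integrable M (Q t)"
proof (rule weighted_sum_tendsto_bracket(1)[OF assms])
  show "is_partition t (Suc k) (uniform_net t (Suc k))" for k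
    using uniform_net_partition[OF assms(1)] by blast
  show "\<forall>\<^sub>F k in sequentially. \<forall>i<Suc k. uniform_net t (Suc k) (Suc i) - uniform_net t (Suc k) i < \<delta>" if "0 < \<delta>" for \<delta>
    unfolding uniform_net_step using uniform_net_mesh[OF that, of t] by eventually_elim blast
qed

text \<open>If no threshold worked, a bad partition of mesh below 1/(k + 1) could be picked for each
  k, and this sequence would contradict \<open>weighted_sum_tendsto_bracket\<close>. The uniform
  form is what families of nets with several parameters require.\<close>

lemma weighted_sum_near_bracket:
  assumes t: "0 \<le> t" "t < T" and e: "0 < \<epsilon>"
  shows "\<exists>\<delta>>0. \<forall>m p. is_partition t m p \<longrightarrow> (\<forall>i<m. p (Suc i) - p i < \<delta>) \<longrightarrow>
     (\<integral>\<omega>. \<bar>weighted_sum m p \<omega> - Q t \<omega>\<bar> \<partial>M) < \<epsilon>"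
proof (rule ccontr)
  assume neg: "\<not> ?thesis"
  define P where "P k m p \<longleftrightarrow> is_partition t m p \<and> (\<forall>i<m. p (Suc i) - p i < 1 / real (Suc k)) \<and>
     \<epsilon> \<le> (\<integral>\<omega>. \<bar>weighted_sum m p \<omega> - Q t \<omega>\<bar> \<partial>M)" for k m p
  have "\<exists>m p. P k m p" for k
  proof -
    have "0 < 1 / real (Suc k)" by simp
    with neg have "\<not> (\<forall>m p. is_partition t m p \<longrightarrow> (\<forall>i<m. p (Suc i) - p i < 1 / real (Suc k)) \<longrightarrow>
      (\<integral>\<omega>. \<bar>weighted_sum m p \<omega> - Q t \<omega>\<bar> \<partial>M) < \<epsilon>)" by blast
    then show ?thesis unfolding P_def not_all not_imp not_less by blast
  qed
  then obtain m p where P: "\<And>k. P k (m k) (p k)" by metis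
  have p: "is_partition t (m k) (p k)"
    and mesh: "i < m k \<Longrightarrow> p k (Suc i) - p k i < 1 / real (Suc k)"
    and far: "\<epsilon> \<le> (\<integral>\<omega>. \<bar>weighted_sum (m k) (p k) \<omega> - Q t \<omega>\<bar> \<partial>M)" for k i
    using P[of k] unfolding P_def by blast+
  have "(\<lambda>k. \<integral>\<omega>. \<bar>weighted_sum (m k) (p k) \<omega> - Q t \<omega>\<bar> \<partial>M) \<longlonglongrightarrow> 0"
  proof (rule weighted_sum_tendsto_bracket(2)[OF t p])
    show "\<forall>\<^sub>F k in sequentially. \<forall>i<m k. p k (Suc i) - p k i < \<delta>" if "0 < \<delta>" for \<delta>
      using uniform_net_mesh[OF that, of 1]
    proof eventually_elim
      case (elim k)
      then show ?case using mesh[of _ k] less_trans by blast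
    qed
  qed
  from LIMSEQ_le_const[OF this, of \<epsilon>] far have "\<epsilon> \<le> 0" by blast
  then show False using e by simp
qed

text \<open>Up to t0 the squared weights are at least c > 0, and square sums of L have expectation
  \<open>energy t\<close>; in the limit c E L_t^2 \<le> E Q_t. The right side tends to 0 by
  right-continuity of Q, by Q_0 = 0 and by domination through the integrable Q at t0.\<close>

lemma energy_vanishes_at_0:
  assumes e: "0 < \<epsilon>"
  shows "\<exists>\<delta>>0. \<delta> < T \<and> (\<forall>t. 0 \<le> t \<longrightarrow> t \<le> \<delta> \<longrightarrow> energy t \<le> \<epsilon>)"
proof -
  define t0 where "t0 = T / 2"
  have t0: "0 < t0" "t0 < T" using T_pos by (auto simp: t0_def)
  define c where "c = (wt \<alpha> t0)\<^sup>2"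
  have c: "0 < c" using wt_bounds[OF al(1), of t0] t0 by (simp add: c_def)
  have key: "c * energy t \<le> (\<integral>\<omega>. Q t \<omega> \<partial>M)" if t: "0 \<le> t" "t \<le> t0" for t
  proof (rule field_le_epsilon)
    fix e :: real assume e: "0 < e"
    have tT: "t < T" using t t0 by auto
    obtain \<delta> where \<delta>: "0 < \<delta>" "\<And>m p. is_partition t m p \<Longrightarrow> (\<And>i. i < m \<Longrightarrow> p (Suc i) - p i < \<delta>) \<Longrightarrow>
       (\<integral>\<omega>. \<bar>weighted_sum m p \<omega> - Q t \<omega>\<bar> \<partial>M) < e"
      using weighted_sum_near_bracket[OF t(1) tT e] by blast
    obtain k where k: "t / real (Suc k) < \<delta>"
      using eventually_happens[OF uniform_net_mesh[OF \<delta>(1), of t]] by auto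
    let ?p = "uniform_net t (Suc k)"
    have p: "is_partition t (Suc k) ?p" using uniform_net_partition[OF t(1)] by blast
    have near: "(\<integral>\<omega>. \<bar>weighted_sum (Suc k) ?p \<omega> - Q t \<omega>\<bar> \<partial>M) < e"
      by (rule \<delta>(2)[OF p]) (use k in \<open>simp only: uniform_net_step\<close>)
    have le: "c * square_sum L (Suc k) ?p \<omega> \<le> weighted_sum (Suc k) ?p \<omega>" for \<omega>
      unfolding square_sum_def weighted_sum_def sum_distrib_left
    proof (rule sum_mono)
      fix i assume "i \<in> {..<Suc k}"
      then have "?p (Suc i) \<in> {0..t}" using is_partition_range[OF p, of "Suc i"] by auto
      then have "wt \<alpha> t0 \<le> wt \<alpha> (?p (Suc i))" using t t0 al by (intro wt_antimono) auto
      then show "c * (L (?p (Suc i)) \<omega> - L (?p i) \<omega>)\<^sup>2 \<le> (wt \<alpha> (?p (Suc i)))\<^sup>2 * (L (?p (Suc i)) \<omega> - L (?p i) \<omega>)\<^sup>2"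
        unfolding c_def using wt_bounds[OF al(1), of t0] t0 by (intro mult_right_mono power_mono) auto
    qed
    have "c * energy t = (\<integral>\<omega>. c * square_sum L (Suc k) ?p \<omega> \<partial>M)"
      using square_sum_energy[OF p tT] by simp
    also have "\<dots> \<le> (\<integral>\<omega>. weighted_sum (Suc k) ?p \<omega> \<partial>M)"
      using square_sum_energy(1)[OF p tT] weighted_sum_integrable[OF p tT] by (intro integral_mono le) auto
    also have "\<dots> \<le> (\<integral>\<omega>. Q t \<omega> + \<bar>weighted_sum (Suc k) ?p \<omega> - Q t \<omega>\<bar> \<partial>M)"
      using weighted_sum_integrable[OF p tT] Q_integrable[OF t(1) tT] by (intro integral_mono) auto
    also have "\<dots> \<le> (\<integral>\<omega>. Q t \<omega> \<partial>M) + e"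
      using weighted_sum_integrable[OF p tT] Q_integrable[OF t(1) tT] near by (subst Bochner_Integration.integral_add) auto
    finally show "c * energy t \<le> (\<integral>\<omega>. Q t \<omega> \<partial>M) + e" .
  qed
  have "(\<lambda>k. \<integral>\<omega>. Q (t0 / real (Suc k)) \<omega> \<partial>M) \<longlonglongrightarrow> (\<integral>\<omega>. 0 \<partial>M)"
  proof (rule integral_dominated_convergence[where w="Q t0"])
    have le: "t0 / real (Suc k) \<le> t0" for k using t0 by (simp add: divide_simps)
    have pos: "0 < t0 / real (Suc k)" for k using t0 by simp
    show "AE \<omega> in M. (\<lambda>k. Q (t0 / real (Suc k)) \<omega>) \<longlonglongrightarrow> 0"
    proof (rule AE_I2)
      fix \<omega> assume w: "\<omega> \<in> space M"
      have "continuous (at_right 0) (\<lambda>t. Q t \<omega>)" "Q 0 \<omega> = 0"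
        using bracket w T_pos unfolding square_bracket_def cadlag_on_def by auto
      then have c: "((\<lambda>t. Q t \<omega>) \<longlongrightarrow> 0) (at_right 0)" by (simp add: continuous_within)
      have l: "(\<lambda>k. t0 / real (Suc k)) \<longlonglongrightarrow> 0" using LIMSEQ_Suc[OF lim_const_over_n[of t0]] by simp
      have "filterlim (\<lambda>k. t0 / real (Suc k)) (at_right 0) sequentially"
        unfolding filterlim_at using l pos by (auto intro!: always_eventually simp del: of_nat_Suc)
      from filterlim_compose[OF c this] show "(\<lambda>k. Q (t0 / real (Suc k)) \<omega>) \<longlonglongrightarrow> 0" .
    qed
    show "AE \<omega> in M. norm (Q (t0 / real (Suc k)) \<omega>) \<le> Q t0 \<omega>" for k
    proof (rule AE_I2)
      fix \<omega> assume w: "\<omega> \<in> space M"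
      show "norm (Q (t0 / real (Suc k)) \<omega>) \<le> Q t0 \<omega>"
        using Q_mono[OF w _ le t0(2), of k] Q_nonneg[OF w, of "t0 / real (Suc k)"] le[of k] pos[of k] t0 by auto
    qed
    show "Q (t0 / real (Suc k)) \<in> borel_measurable M" for k
      using le[of k] pos[of k] t0 by (intro Q_meas) auto
    show "integrable M (Q t0)" using t0 by (intro Q_integrable) auto
  qed simp
  then have "eventually (\<lambda>k. (\<integral>\<omega>. Q (t0 / real (Suc k)) \<omega> \<partial>M) < c * \<epsilon>) sequentially"
    using c e by (intro order_tendstoD(2)) auto
  then obtain k where k: "(\<integral>\<omega>. Q (t0 / real (Suc k)) \<omega> \<partial>M) < c * \<epsilon>"
    using eventually_happens by force
  define \<delta> where "\<delta> = t0 / real (Suc k)"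
  have \<delta>: "0 < \<delta>" "\<delta> \<le> t0" using t0 by (auto simp: \<delta>_def divide_simps)
  have "c * energy \<delta> < c * \<epsilon>" using key[of \<delta>] \<delta> k by (simp add: \<delta>_def)
  then have "energy \<delta> \<le> \<epsilon>" using c by simp
  then show ?thesis using \<delta> t0 energy_mono[of _ \<delta>] by (intro exI[of _ \<delta>]) (auto intro: order_trans)
qed

section \<open>The left limit of the bracket at b\<close>

definition Q_left :: "real \<Rightarrow> 'a \<Rightarrow> real" where "Q_left b \<omega> = Lim (at_left b) (\<lambda>t. Q t \<omega>)"

context
  fixes b :: real
  assumes b: "0 < b" "b < T"
begin

text \<open>\<open>Lim\<close> means something only once a limit exists; here existence comes from
  the cadlag paths of Q.\<close>

lemma Q_left_tendsto: "\<omega> \<in> space M \<Longrightarrow> ((\<lambda>t. Q t \<omega>) \<longlongrightarrow> Q_left b \<omega>) (at_left b)"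
proof -
  assume w: "\<omega> \<in> space M"
  have "\<forall>\<omega>\<in>space M. \<forall>t\<in>{0<..<T}. \<exists>l. ((\<lambda>t. Q t \<omega>) \<longlongrightarrow> l) (at_left t)"
    using bracket unfolding square_bracket_def cadlag_on_def by blast
  then obtain l where "((\<lambda>t. Q t \<omega>) \<longlongrightarrow> l) (at_left b)"
    using w b by fastforce
  then show ?thesis unfolding Q_left_def using tendsto_Lim[OF trivial_limit_at_left_real, of "\<lambda>t. Q t \<omega>" l b] by simp
qed

lemma Q_le_Q_left: "\<omega> \<in> space M \<Longrightarrow> 0 \<le> t \<Longrightarrow> t < b \<Longrightarrow> Q t \<omega> \<le> Q_left b \<omega>"
proof (rule tendsto_lowerbound[OF Q_left_tendsto])
  assume "\<omega> \<in> space M" "0 \<le> t" "t < b"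
  have "eventually (\<lambda>x. t < x \<and> x < b) (at_left b)"
    using \<open>t < b\<close> eventually_at_left_field by blast
  then show "eventually (\<lambda>x. Q t \<omega> \<le> Q x \<omega>) (at_left b)"
    by eventually_elim (use \<open>\<omega> \<in> space M\<close> \<open>0 \<le> t\<close> b in \<open>auto intro!: Q_mono\<close>)
qed auto

lemma Q_left_le: "\<omega> \<in> space M \<Longrightarrow> Q_left b \<omega> \<le> Q b \<omega>"
proof (rule tendsto_upperbound[OF Q_left_tendsto])
  assume "\<omega> \<in> space M"
  have "eventually (\<lambda>x. 0 < x \<and> x < b) (at_left b)"
    using b eventually_at_left_field by blast
  then show "eventually (\<lambda>x. Q x \<omega> \<le> Q b \<omega>) (at_left b)"
    by eventually_elim (use \<open>\<omega> \<in> space M\<close> b in \<open>auto intro!: Q_mono\<close>)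
qed auto

text \<open>The shift by 2 keeps already the first member strictly positive.\<close>

definition approach :: "nat \<Rightarrow> real" where "approach k = b - b / real (Suc (Suc k))"

lemma approach_bounds: "0 < approach k" "approach k < b"
proof -
  have "b / real (Suc (Suc k)) < b / 1"
    using b by (intro divide_strict_left_mono) auto
  then show "0 < approach k" by (simp add: approach_def)
  show "approach k < b" using b by (simp add: approach_def)
qed

lemma Q_approach: "\<omega> \<in> space M \<Longrightarrow> (\<lambda>k. Q (approach k) \<omega>) \<longlonglongrightarrow> Q_left b \<omega>"
proof (rule filterlim_compose[OF Q_left_tendsto])
  have "(\<lambda>k. b - b / real (Suc (Suc k))) \<longlonglongrightarrow> b - 0"
    by (intro tendsto_diff tendsto_const LIMSEQ_Suc[OF LIMSEQ_Suc[OF lim_const_over_n[of b]]])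
  then have "approach \<longlonglongrightarrow> b" by (simp add: approach_def[abs_def])
  then show "filterlim approach (at_left b) sequentially"
    unfolding filterlim_at using approach_bounds(2) by (auto intro!: always_eventually) (metis less_irrefl)
qed

lemma Q_left_meas: "Q_left b \<in> borel_measurable M"
  by (rule borel_measurable_LIMSEQ_real[OF Q_approach])
    (use approach_bounds b in \<open>auto intro!: Q_meas intro: less_imp_le less_trans\<close>)

lemma Q_left_nonneg: "\<omega> \<in> space M \<Longrightarrow> 0 \<le> Q_left b \<omega>"
  using Q_le_Q_left[of \<omega> 0] Q_nonneg[of \<omega> 0] b by force

lemma Q_left_integrable: "integrable M (Q_left b)"
proof (rule Bochner_Integration.integrable_bound[of _ "Q b"])
  show "integrable M (Q b)" using b by (intro Q_integrable) auto
  show "AE \<omega> in M. norm (Q_left b \<omega>) \<le> norm (Q b \<omega>)"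
    using Q_left_nonneg Q_left_le by (intro AE_I2) fastforce
qed (rule Q_left_meas)

text \<open>Dominated convergence gives one member of the sequence \<open>approach\<close> with
  small error. By monotonicity Q_x lies between Q at this point and the left limit for all later x <
  b, so the error only decreases.\<close>

lemma Q_near_left:
  assumes e: "0 < \<epsilon>"
  shows "\<exists>x0. 0 < x0 \<and> x0 < b \<and> (\<forall>x. x0 \<le> x \<longrightarrow> x < b \<longrightarrow> (\<integral>\<omega>. \<bar>Q x \<omega> - Q_left b \<omega>\<bar> \<partial>M) < \<epsilon>)"
proof -
  have "(\<lambda>k. \<integral>\<omega>. \<bar>Q (approach k) \<omega> - Q_left b \<omega>\<bar> \<partial>M) \<longlonglongrightarrow> (\<integral>\<omega>. 0 \<partial>M)"
  proof (rule integral_dominated_convergence[where w="Q_left b"])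
    show "AE \<omega> in M. (\<lambda>k. \<bar>Q (approach k) \<omega> - Q_left b \<omega>\<bar>) \<longlonglongrightarrow> 0"
    proof (rule AE_I2)
      fix \<omega> assume "\<omega> \<in> space M"
      from Q_approach[OF this] show "(\<lambda>k. \<bar>Q (approach k) \<omega> - Q_left b \<omega>\<bar>) \<longlonglongrightarrow> 0"
        using LIM_zero tendsto_rabs_zero by blast
    qed
    show "AE \<omega> in M. norm \<bar>Q (approach k) \<omega> - Q_left b \<omega>\<bar> \<le> Q_left b \<omega>" for k
    proof (rule AE_I2)
      fix \<omega> assume w: "\<omega> \<in> space M"
      have ap: "0 \<le> approach k" "approach k < b" "approach k < T" using approach_bounds[of k] b by auto
      show "norm \<bar>Q (approach k) \<omega> - Q_left b \<omega>\<bar> \<le> Q_left b \<omega>"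
        using Q_le_Q_left[OF w ap(1,2)] Q_nonneg[OF w ap(1,3)] by auto
    qed
    show "(\<lambda>\<omega>. \<bar>Q (approach k) \<omega> - Q_left b \<omega>\<bar>) \<in> borel_measurable M" for k
    proof -
      have "Q (approach k) \<in> borel_measurable M" using approach_bounds[of k] b by (intro Q_meas) auto
      then show ?thesis using Q_left_meas by measurable
    qed
  qed (simp_all add: Q_left_integrable)
  then have "eventually (\<lambda>k. (\<integral>\<omega>. \<bar>Q (approach k) \<omega> - Q_left b \<omega>\<bar> \<partial>M) < \<epsilon>) sequentially"
    using e by (intro order_tendstoD(2)) auto
  then obtain k where k: "(\<integral>\<omega>. \<bar>Q (approach k) \<omega> - Q_left b \<omega>\<bar> \<partial>M) < \<epsilon>"
    using eventually_happens by force
  have "(\<integral>\<omega>. \<bar>Q x \<omega> - Q_left b \<omega>\<bar> \<partial>M) < \<epsilon>" if x: "approach k \<le> x" "x < b" for x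
  proof -
    have ap: "0 \<le> approach k" "approach k < T" using approach_bounds[of k] b by auto
    have "(\<integral>\<omega>. \<bar>Q x \<omega> - Q_left b \<omega>\<bar> \<partial>M) \<le> (\<integral>\<omega>. \<bar>Q (approach k) \<omega> - Q_left b \<omega>\<bar> \<partial>M)"
    proof (rule integral_mono)
      fix \<omega> assume w: "\<omega> \<in> space M"
      show "\<bar>Q x \<omega> - Q_left b \<omega>\<bar> \<le> \<bar>Q (approach k) \<omega> - Q_left b \<omega>\<bar>"
        using Q_mono[OF w ap(1) x(1)] Q_le_Q_left[OF w, of x] ap x b by auto
    qed (use Q_integrable[of x] Q_integrable[OF ap] Q_left_integrable ap x b in auto)
    then show ?thesis using k by simp
  qed
  then show ?thesis using approach_bounds[of k] by blast
qed

text \<open>The threshold of \<open>weighted_sum_near_bracket\<close> depends on the interval, so it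
  cannot be used directly for varying x. Instead the given net and a very fine net of [0, x] are
  both prolonged to b: each is then close to Q_b, and the added term is the same for both. Hence the
  two nets agree up to \<epsilon>/2, the fine one is close to Q_x, and Q_x to the left
  limit.\<close>

lemma weighted_sum_near_left_bracket:
  assumes e: "0 < \<epsilon>"
  shows "\<exists>\<delta>>0. \<forall>x m p. 0 \<le> x \<longrightarrow> b - \<delta> < x \<longrightarrow> x < b \<longrightarrow> is_partition x m p \<longrightarrow> (\<forall>i<m. p (Suc i) - p i < \<delta>) \<longrightarrow>
     (\<integral>\<omega>. \<bar>weighted_sum m p \<omega> - Q_left b \<omega>\<bar> \<partial>M) < \<epsilon>"
proof -
  have e4: "0 < \<epsilon> / 4" using e by simp
  have b0: "0 \<le> b" using b by simp
  obtain d1 where d1: "0 < d1" "\<And>m p. is_partition b m p \<Longrightarrow> (\<And>i. i < m \<Longrightarrow> p (Suc i) - p i < d1) \<Longrightarrow>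
     (\<integral>\<omega>. \<bar>weighted_sum m p \<omega> - Q b \<omega>\<bar> \<partial>M) < \<epsilon> / 4"
    using weighted_sum_near_bracket[OF b0 b(2) e4] by blast
  obtain x0 where x0: "0 < x0" "x0 < b" "\<And>x. x0 \<le> x \<Longrightarrow> x < b \<Longrightarrow> (\<integral>\<omega>. \<bar>Q x \<omega> - Q_left b \<omega>\<bar> \<partial>M) < \<epsilon> / 4"
    using Q_near_left[OF e4] by blast
  \<comment> \<open>The bound d1 controls the given mesh and also the added last step b - x; the
    bound b - x0 forces x beyond x0.\<close>
  define \<delta> where "\<delta> = min d1 (b - x0)"
  have "(\<integral>\<omega>. \<bar>weighted_sum m p \<omega> - Q_left b \<omega>\<bar> \<partial>M) < \<epsilon>"
    if x: "0 \<le> x" "b - \<delta> < x" "x < b" and p: "is_partition x m p" and mesh: "\<And>i. i < m \<Longrightarrow> p (Suc i) - p i < \<delta>" for x m p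
  proof -
    have xT: "x < T" using x b by simp
    \<comment> \<open>This threshold may depend on x, which is harmless: it constrains only the
      auxiliary fine net and not the given one.\<close>
    obtain d2 where d2: "0 < d2" "\<And>m p. is_partition x m p \<Longrightarrow> (\<And>i. i < m \<Longrightarrow> p (Suc i) - p i < d2) \<Longrightarrow>
      (\<integral>\<omega>. \<bar>weighted_sum m p \<omega> - Q x \<omega>\<bar> \<partial>M) < \<epsilon> / 4"
      using weighted_sum_near_bracket[OF x(1) xT e4] by blast
    obtain k where k: "x / real (Suc k) < min d1 d2"
      using eventually_happens[OF uniform_net_mesh[of "min d1 d2" x]] d1 d2 by auto
    define n q where "n = Suc k" and "q = uniform_net x n"
    have q: "is_partition x n q" unfolding q_def n_def using uniform_net_partition[OF x(1)] by blast
    have qstep: "q (Suc i) - q i < min d1 d2" for i unfolding q_def uniform_net_step n_def using k .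
    have qx: "(\<integral>\<omega>. \<bar>weighted_sum n q \<omega> - Q x \<omega>\<bar> \<partial>M) < \<epsilon> / 4"
      by (rule d2(2)[OF q]) (use qstep in auto)
    define c where "c \<omega> = (wt \<alpha> b)\<^sup>2 * (L b \<omega> - L x \<omega>)\<^sup>2" for \<omega>
    have append: "(\<integral>\<omega>. \<bar>weighted_sum m p \<omega> + c \<omega> - Q b \<omega>\<bar> \<partial>M) < \<epsilon> / 4 \<and> integrable M (\<lambda>\<omega>. weighted_sum m p \<omega> + c \<omega>)"
      if p: "is_partition x m p" and mesh: "\<And>i. i < m \<Longrightarrow> p (Suc i) - p i < d1" for m p
    proof -
      define p' where "p' i = (if i \<le> m then p i else b)" for i
      have p': "is_partition b (Suc m) p'"
        using p x by (auto simp: is_partition_def p'_def le_Suc_eq not_le less_Suc_eq)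
      have "p' (Suc i) - p' i < d1" if "i < Suc m" for i
        using that mesh[of i] p x by (auto simp: p'_def is_partition_def \<delta>_def less_Suc_eq)
      from d1(2)[OF p' this] have *: "(\<integral>\<omega>. \<bar>weighted_sum (Suc m) p' \<omega> - Q b \<omega>\<bar> \<partial>M) < \<epsilon> / 4" by simp
      have "(\<Sum>i<m. (wt \<alpha> (p' (Suc i)))\<^sup>2 * (L (p' (Suc i)) \<omega> - L (p' i) \<omega>)\<^sup>2)
          = (\<Sum>i<m. (wt \<alpha> (p (Suc i)))\<^sup>2 * (L (p (Suc i)) \<omega> - L (p i) \<omega>)\<^sup>2)" for \<omega>
        by (rule sum.cong) (auto simp: p'_def)
      moreover have "p' m = x" "p' (Suc m) = b" using p by (auto simp: p'_def is_partition_def)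
      ultimately have "weighted_sum (Suc m) p' = (\<lambda>\<omega>. weighted_sum m p \<omega> + c \<omega>)"
        by (simp add: weighted_sum_def c_def fun_eq_iff)
      then show ?thesis using * weighted_sum_integrable[OF p' b(2)] by simp
    qed
    note P = append[OF p order.strict_trans2[OF mesh]]
    have P': "(\<integral>\<omega>. \<bar>weighted_sum m p \<omega> + c \<omega> - Q b \<omega>\<bar> \<partial>M) < \<epsilon> / 4" "integrable M (\<lambda>\<omega>. weighted_sum m p \<omega> + c \<omega>)"
      using P by (auto simp: \<delta>_def)
    have Q': "(\<integral>\<omega>. \<bar>weighted_sum n q \<omega> + c \<omega> - Q b \<omega>\<bar> \<partial>M) < \<epsilon> / 4" "integrable M (\<lambda>\<omega>. weighted_sum n q \<omega> + c \<omega>)"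
      using append[OF q] qstep by auto
    have Qb: "integrable M (Q b)" "integrable M (Q x)" using Q_integrable b x by auto
    have Ql: "(\<integral>\<omega>. \<bar>Q x \<omega> - Q_left b \<omega>\<bar> \<partial>M) < \<epsilon> / 4" using x x0 by (auto simp: \<delta>_def)
    have Wi: "integrable M (weighted_sum m p)" "integrable M (weighted_sum n q)"
      using weighted_sum_integrable[OF p xT] weighted_sum_integrable[OF q xT] by auto
    note ints = P'(2) Q'(2) Qb Wi Q_left_integrable
    have "(\<integral>\<omega>. \<bar>weighted_sum m p \<omega> - Q_left b \<omega>\<bar> \<partial>M) \<le>
      (\<integral>\<omega>. \<bar>weighted_sum m p \<omega> + c \<omega> - Q b \<omega>\<bar> + \<bar>weighted_sum n q \<omega> + c \<omega> - Q b \<omega>\<bar>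
         + \<bar>weighted_sum n q \<omega> - Q x \<omega>\<bar> + \<bar>Q x \<omega> - Q_left b \<omega>\<bar> \<partial>M)"
      by (intro integral_mono Bochner_Integration.integrable_add integrable_abs Bochner_Integration.integrable_diff ints) arith
    also have "\<dots> = (\<integral>\<omega>. \<bar>weighted_sum m p \<omega> + c \<omega> - Q b \<omega>\<bar> \<partial>M) + (\<integral>\<omega>. \<bar>weighted_sum n q \<omega> + c \<omega> - Q b \<omega>\<bar> \<partial>M)
         + (\<integral>\<omega>. \<bar>weighted_sum n q \<omega> - Q x \<omega>\<bar> \<partial>M) + (\<integral>\<omega>. \<bar>Q x \<omega> - Q_left b \<omega>\<bar> \<partial>M)"
      by (subst Bochner_Integration.integral_add | intro Bochner_Integration.integrable_add integrable_abs Bochner_Integration.integrable_diff ints | rule refl)+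
    also have "\<dots> < \<epsilon>" using P'(1) Q'(1) qx Ql by linarith
    finally show ?thesis .
  qed
  moreover have "0 < \<delta>" using d1 x0 by (simp add: \<delta>_def)
  ultimately show ?thesis by blast
qed

end

end

section \<open>Averages of square sums over equidistant nets\<close>

text \<open>The half-line is tiled by the intervals from k v to (k + 1) v, each of which is
  translated back to [0, v).\<close>

lemma nn_integral_periodic_unfold:
  fixes H :: "real \<Rightarrow> ennreal"
  assumes [measurable]: "H \<in> borel_measurable borel" and v: "0 < v"
  shows "(\<integral>\<^sup>+y. H y * indicator {0..} y \<partial>lborel)
    = (\<integral>\<^sup>+\<rho>. (\<Sum>k. H (\<rho> + real k * v)) * indicator {0..<v} \<rho> \<partial>lborel)"
proof -
  define A where "A k = {real k * v..<(real k + 1) * v}" for k :: nat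
  have A[measurable]: "A k \<in> sets borel" for k by (simp add: A_def)
  have A_iff: "y \<in> A k \<longleftrightarrow> real k \<le> y / v \<and> y / v < real k + 1" for y k
    using v by (simp add: A_def pos_le_divide_eq pos_divide_less_eq)
  have disj: "disjoint_family A"
    unfolding disjoint_family_on_def
  proof (intro ballI impI)
    fix j k :: nat assume "j \<noteq> k"
    then have "j + 1 \<le> k \<or> k + 1 \<le> j" by linarith
    then have "real j + 1 \<le> real k \<or> real k + 1 \<le> real j" by linarith
    then have "y \<notin> A j \<or> y \<notin> A k" for y unfolding A_iff by linarith
    then show "A j \<inter> A k = {}" by blast
  qed
  have sum: "(\<Sum>k. H y * indicator (A k) y) = H y * indicator {0..} y" for y
  proof (cases "0 \<le> y")
    case True
    then have "real (nat \<lfloor>y / v\<rfloor>) = of_int \<lfloor>y / v\<rfloor>" using v by simp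
    then have "y \<in> A (nat \<lfloor>y / v\<rfloor>)" unfolding A_iff by linarith
    from suminf_cmult_indicator[OF disj this, of "\<lambda>_. H y"] show ?thesis using True by simp
  next
    case False
    have "y \<notin> A k" for k
    proof
      assume "y \<in> A k"
      then have "0 \<le> y / v" unfolding A_iff by linarith
      then show False using False v by (simp add: zero_le_divide_iff)
    qed
    then show ?thesis using False by simp
  qed
  have shift: "(\<integral>\<^sup>+y. H y * indicator (A k) y \<partial>lborel) = (\<integral>\<^sup>+\<rho>. H (\<rho> + real k * v) * indicator {0..<v} \<rho> \<partial>lborel)" for k
  proof -
    have "indicator (A k) (real k * v + \<rho>) = (indicator {0..<v} \<rho> :: ennreal)" for \<rho>
      by (auto simp: A_def indicator_def algebra_simps)
    then show ?thesis
      by (subst nn_integral_real_affine[of _ 1 "real k * v"]) (auto simp: add.commute)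
  qed
  have "(\<integral>\<^sup>+y. H y * indicator {0..} y \<partial>lborel) = (\<integral>\<^sup>+y. (\<Sum>k. H y * indicator (A k) y) \<partial>lborel)"
    unfolding sum ..
  also have "\<dots> = (\<Sum>k. \<integral>\<^sup>+y. H y * indicator (A k) y \<partial>lborel)"
    by (rule nn_integral_suminf) measurable
  also have "\<dots> = (\<Sum>k. \<integral>\<^sup>+\<rho>. H (\<rho> + real k * v) * indicator {0..<v} \<rho> \<partial>lborel)"
    by (simp add: shift)
  also have "\<dots> = (\<integral>\<^sup>+\<rho>. (\<Sum>k. H (\<rho> + real k * v) * indicator {0..<v} \<rho>) \<partial>lborel)"
    by (rule nn_integral_suminf[symmetric]) measurable
  finally show ?thesis by simp
qed

text \<open>Tonelli applied to |\<Phi> - q|. Finiteness of the double integral yields integrability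
  in x for almost every outcome, and then the triangle inequality moves the absolute value outside
  the average.\<close>

lemma L1_distance_of_average:
  fixes \<Phi> :: "'b \<Rightarrow> 'a \<Rightarrow> real" and q :: "'a \<Rightarrow> real"
  assumes N: "prob_space N" and M: "prob_space M"
    and [measurable]: "(\<lambda>(x, \<omega>). \<Phi> x \<omega>) \<in> borel_measurable (N \<Otimes>\<^sub>M M)" and [measurable]: "q \<in> borel_measurable M"
    and close: "AE x in N. (\<integral>\<^sup>+\<omega>. ennreal \<bar>\<Phi> x \<omega> - q \<omega>\<bar> \<partial>M) \<le> ennreal e"
  shows "AE \<omega> in M. integrable N (\<lambda>x. \<Phi> x \<omega>)"
    and "(\<integral>\<^sup>+\<omega>. ennreal \<bar>(\<integral>x. \<Phi> x \<omega> \<partial>N) - q \<omega>\<bar> \<partial>M) \<le> ennreal e"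
proof -
  interpret N: prob_space N by fact
  interpret M: prob_space M by fact
  interpret P: pair_sigma_finite N M by unfold_locales
  have "(\<integral>\<^sup>+\<omega>. (\<integral>\<^sup>+x. ennreal \<bar>\<Phi> x \<omega> - q \<omega>\<bar> \<partial>N) \<partial>M) = (\<integral>\<^sup>+x. (\<integral>\<^sup>+\<omega>. ennreal \<bar>\<Phi> x \<omega> - q \<omega>\<bar> \<partial>M) \<partial>N)"
    by (rule P.Fubini') measurable
  also have "\<dots> \<le> (\<integral>\<^sup>+x. ennreal e \<partial>N)" by (rule nn_integral_mono_AE[OF close])
  also have "\<dots> = ennreal e" by (simp add: N.emeasure_space_1)
  finally have le: "(\<integral>\<^sup>+\<omega>. (\<integral>\<^sup>+x. ennreal \<bar>\<Phi> x \<omega> - q \<omega>\<bar> \<partial>N) \<partial>M) \<le> ennreal e" .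
  have "AE \<omega> in M. (\<integral>\<^sup>+x. ennreal \<bar>\<Phi> x \<omega> - q \<omega>\<bar> \<partial>N) \<noteq> \<infinity>"
  proof (rule nn_integral_PInf_AE)
    show "(\<integral>\<^sup>+\<omega>. (\<integral>\<^sup>+x. ennreal \<bar>\<Phi> x \<omega> - q \<omega>\<bar> \<partial>N) \<partial>M) \<noteq> \<infinity>"
      using le by (metis ennreal_neq_top infinity_ennreal_def top.extremum_unique)
  qed measurable
  then have ae: "AE \<omega> in M. integrable N (\<lambda>x. \<Phi> x \<omega>) \<and>
      ennreal \<bar>(\<integral>x. \<Phi> x \<omega> \<partial>N) - q \<omega>\<bar> \<le> (\<integral>\<^sup>+x. ennreal \<bar>\<Phi> x \<omega> - q \<omega>\<bar> \<partial>N)"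
    using AE_space
  proof eventually_elim
    case (elim \<omega>)
    have [measurable]: "(\<lambda>x. \<Phi> x \<omega>) \<in> borel_measurable N"
      using measurable_compose[OF measurable_Pair2'[of \<omega> M N] assms(3)] elim by simp
    have d: "integrable N (\<lambda>x. \<Phi> x \<omega> - q \<omega>)"
      by (rule integrableI_bounded) (use elim in \<open>auto simp: top.not_eq_extremum\<close>)
    then have i: "integrable N (\<lambda>x. \<Phi> x \<omega>)"
      using Bochner_Integration.integrable_add[OF d, of "\<lambda>_. q \<omega>"] by simp
    have "(\<integral>x. \<Phi> x \<omega> \<partial>N) - q \<omega> = (\<integral>x. \<Phi> x \<omega> - q \<omega> \<partial>N)"
      using i by (simp add: N.prob_space)
    moreover have "\<bar>\<integral>x. \<Phi> x \<omega> - q \<omega> \<partial>N\<bar> \<le> (\<integral>x. \<bar>\<Phi> x \<omega> - q \<omega>\<bar> \<partial>N)"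
      by (rule integral_abs_bound)
    moreover have "ennreal (\<integral>x. \<bar>\<Phi> x \<omega> - q \<omega>\<bar> \<partial>N) = (\<integral>\<^sup>+x. ennreal \<bar>\<Phi> x \<omega> - q \<omega>\<bar> \<partial>N)"
      using d by (intro nn_integral_eq_integral[symmetric]) auto
    ultimately have "ennreal \<bar>(\<integral>x. \<Phi> x \<omega> \<partial>N) - q \<omega>\<bar> \<le> (\<integral>\<^sup>+x. ennreal \<bar>\<Phi> x \<omega> - q \<omega>\<bar> \<partial>N)"
      by (metis ennreal_leI)
    then show ?case using i by blast
  qed
  show "AE \<omega> in M. integrable N (\<lambda>x. \<Phi> x \<omega>)" using ae by eventually_elim blast
  have "(\<integral>\<^sup>+\<omega>. ennreal \<bar>(\<integral>x. \<Phi> x \<omega> \<partial>N) - q \<omega>\<bar> \<partial>M) \<le> (\<integral>\<^sup>+\<omega>. (\<integral>\<^sup>+x. ennreal \<bar>\<Phi> x \<omega> - q \<omega>\<bar> \<partial>N) \<partial>M)"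
    by (rule nn_integral_mono_AE) (use ae in \<open>eventually_elim, blast\<close>)
  with le show "(\<integral>\<^sup>+\<omega>. ennreal \<bar>(\<integral>x. \<Phi> x \<omega> \<partial>N) - q \<omega>\<bar> \<partial>M) \<le> ennreal e" by (rule order_trans[rotated])
qed

text \<open>The uniform distribution on the triangle of all steps \<open>v < h\<close> and offsets \<open>\<rho> < v\<close>.\<close>

definition triangle :: "real \<Rightarrow> (real \<times> real) measure" where
  "triangle h = density (lborel \<Otimes>\<^sub>M lborel)
     (\<lambda>x. if 0 < fst x \<and> fst x < h \<and> 0 \<le> snd x \<and> snd x < fst x then ennreal (2 / h\<^sup>2) else 0)"

lemma sets_triangle[measurable_cong]: "sets (triangle h) = sets (borel \<Otimes>\<^sub>M borel)"
proof -
  have "sets (lborel \<Otimes>\<^sub>M lborel) = sets (borel \<Otimes>\<^sub>M borel :: (real \<times> real) measure)"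
    by (rule sets_pair_measure_cong) simp_all
  then show ?thesis by (simp add: triangle_def)
qed

lemma nn_integral_triangle:
  assumes f[measurable]: "f \<in> borel_measurable (borel \<Otimes>\<^sub>M borel)"
  shows "(\<integral>\<^sup>+x. f x \<partial>triangle h)
    = ennreal (2 / h\<^sup>2) * (\<integral>\<^sup>+v. indicator {0<..<h} v * (\<integral>\<^sup>+\<rho>. f (v, \<rho>) * indicator {0..<v} \<rho> \<partial>lborel) \<partial>lborel)"
proof -
  have fl[measurable]: "f \<in> borel_measurable (lborel \<Otimes>\<^sub>M lborel)"
    using f by (simp cong: measurable_cong_sets sets_pair_measure_cong)
  have fv[measurable]: "(\<lambda>\<rho>. f (v, \<rho>)) \<in> borel_measurable borel" for v
    by measurable
  define d where "d x = (if 0 < fst x \<and> fst x < h \<and> 0 \<le> snd x \<and> snd x < fst x then ennreal (2 / h\<^sup>2) else 0)"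
    for x :: "real \<times> real"
  have d[measurable]: "d \<in> borel_measurable (lborel \<Otimes>\<^sub>M lborel)"
    unfolding d_def by measurable
  have "(\<integral>\<^sup>+x. f x \<partial>triangle h) = (\<integral>\<^sup>+x. d x * f x \<partial>(lborel \<Otimes>\<^sub>M lborel))"
    unfolding triangle_def d_def[symmetric] by (rule nn_integral_density[OF d fl])
  also have "\<dots> = (\<integral>\<^sup>+v. \<integral>\<^sup>+\<rho>. d (v, \<rho>) * f (v, \<rho>) \<partial>lborel \<partial>lborel)"
    by (rule lborel.nn_integral_fst[symmetric]) measurable
  also have "\<dots> = (\<integral>\<^sup>+v. ennreal (2 / h\<^sup>2) * (indicator {0<..<h} v * (\<integral>\<^sup>+\<rho>. f (v, \<rho>) * indicator {0..<v} \<rho> \<partial>lborel)) \<partial>lborel)"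
  proof (rule nn_integral_cong)
    fix v
    have "(\<integral>\<^sup>+\<rho>. d (v, \<rho>) * f (v, \<rho>) \<partial>lborel)
      = (\<integral>\<^sup>+\<rho>. (ennreal (2 / h\<^sup>2) * indicator {0<..<h} v) * (f (v, \<rho>) * indicator {0..<v} \<rho>) \<partial>lborel)"
      by (rule nn_integral_cong) (auto simp: d_def indicator_def)
    also have "\<dots> = (ennreal (2 / h\<^sup>2) * indicator {0<..<h} v) * (\<integral>\<^sup>+\<rho>. f (v, \<rho>) * indicator {0..<v} \<rho> \<partial>lborel)"
      by (rule nn_integral_cmult) measurable
    finally show "(\<integral>\<^sup>+\<rho>. d (v, \<rho>) * f (v, \<rho>) \<partial>lborel)
      = ennreal (2 / h\<^sup>2) * (indicator {0<..<h} v * (\<integral>\<^sup>+\<rho>. f (v, \<rho>) * indicator {0..<v} \<rho> \<partial>lborel))"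
      by (simp only: mult.assoc)
  qed
  also have "\<dots> = ennreal (2 / h\<^sup>2) * (\<integral>\<^sup>+v. indicator {0<..<h} v * (\<integral>\<^sup>+\<rho>. f (v, \<rho>) * indicator {0..<v} \<rho> \<partial>lborel) \<partial>lborel)"
  proof (rule nn_integral_cmult)
    \<comment> \<open>The set {0..<v} varies with v; written as a condition on both variables, its
      indicator is visibly jointly measurable.\<close>
    have "(\<lambda>v. \<integral>\<^sup>+\<rho>. f (v, \<rho>) * (if 0 \<le> \<rho> \<and> \<rho> < v then 1 else 0) \<partial>lborel) \<in> borel_measurable lborel"
      by measurable
    also have "(\<lambda>v. \<integral>\<^sup>+\<rho>. f (v, \<rho>) * (if 0 \<le> \<rho> \<and> \<rho> < v then 1 else 0) \<partial>lborel)
      = (\<lambda>v. \<integral>\<^sup>+\<rho>. f (v, \<rho>) * indicator {0..<v} \<rho> \<partial>lborel)"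
      by (intro ext nn_integral_cong) (simp add: indicator_def)
    finally show "(\<lambda>v. indicator {0<..<h} v * (\<integral>\<^sup>+\<rho>. f (v, \<rho>) * indicator {0..<v} \<rho> \<partial>lborel)) \<in> borel_measurable lborel"
      by measurable
  qed
  finally show ?thesis .
qed

lemma prob_space_triangle:
  assumes h: "0 < h"
  shows "prob_space (triangle h)"
proof (rule prob_spaceI)
  have "emeasure (triangle h) (space (triangle h)) = (\<integral>\<^sup>+x. 1 \<partial>triangle h)" by simp
  also have "\<dots> = ennreal (2 / h\<^sup>2) * (\<integral>\<^sup>+v. indicator {0<..<h} v * (\<integral>\<^sup>+\<rho>. 1 * indicator {0..<v} \<rho> \<partial>lborel) \<partial>lborel)"
    by (rule nn_integral_triangle) simp
  also have "(\<integral>\<^sup>+v. indicator {0<..<h} v * (\<integral>\<^sup>+\<rho>. 1 * indicator {0..<v} \<rho> \<partial>lborel) \<partial>lborel)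
      = (\<integral>\<^sup>+v. ennreal v * indicator {0..h} v \<partial>lborel)"
  proof (rule nn_integral_cong_AE)
    have "AE v in lborel. v \<noteq> h" by (rule AE_lborel_singleton)
    then show "AE v in lborel. indicator {0<..<h} v * (\<integral>\<^sup>+\<rho>. 1 * indicator {0..<v} \<rho> \<partial>lborel) = ennreal v * indicator {0..h} v"
    proof eventually_elim
      case (elim v)
      have "(\<integral>\<^sup>+\<rho>. 1 * indicator {0..<v} \<rho> \<partial>lborel) = ennreal v" if "0 < v" using that by simp
      then show ?case using elim h by (cases "0 < v"; cases "v < h") (auto simp: not_less ennreal_neg)
    qed
  qed
  also have "\<dots> = ennreal (h\<^sup>2 / 2 - 0\<^sup>2 / 2)"
    by (rule nn_integral_FTC_Icc) (use h in \<open>auto intro!: derivative_eq_intros\<close>)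
  also have "ennreal (2 / h\<^sup>2) * ennreal (h\<^sup>2 / 2 - 0\<^sup>2 / 2) = 1"
    using h by (simp add: ennreal_mult[symmetric])
  finally show "emeasure (triangle h) (space (triangle h)) = 1" .
qed


section \<open>The equidistant time scale\<close>

locale theta_bracket = l2_bracket M F L T "(1 - \<theta>) / 2" Q
  for M :: "'a measure" and F L T and \<theta> :: real and Q +
  fixes b :: real
  assumes th: "0 < \<theta>" "\<theta> \<le> 1" and b: "0 < b" "b < T"
begin

definition phi :: "real \<Rightarrow> real" where "phi y = T - T * (1 - y) powr (1 / \<theta>)"
definition dphi :: "real \<Rightarrow> real" where "dphi y = T / \<theta> * (1 - y) powr (1 / \<theta> - 1)"
text \<open>The preimage of b under \<open>phi\<close>. It lies below 1, so [0, beta] stays away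
  from the point that corresponds to T.\<close>

definition beta :: real where "beta = 1 - ((T - b) / T) powr \<theta>"

abbreviation w :: "real \<Rightarrow> real" where "w \<equiv> wt ((1 - \<theta>) / 2)"

lemma phi_measurable[measurable]: "phi \<in> borel_measurable borel"
  unfolding phi_def by measurable

lemma dphi_measurable[measurable]: "dphi \<in> borel_measurable borel"
  unfolding dphi_def by measurable

lemma w_measurable[measurable]: "w \<in> borel_measurable borel"
  unfolding wt_def by measurable

lemma phi_0[simp]: "phi 0 = 0" by (simp add: phi_def)

lemma phi_strict_mono: "x < y \<Longrightarrow> y \<le> 1 \<Longrightarrow> phi x < phi y"
  unfolding phi_def using T_pos th by (auto intro!: powr_less_mono2)

lemma phi_mono: "x \<le> y \<Longrightarrow> y \<le> 1 \<Longrightarrow> phi x \<le> phi y"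
  using phi_strict_mono[of x y] by (cases "x = y") auto

lemma phi_less_iff: "x \<le> 1 \<Longrightarrow> y \<le> 1 \<Longrightarrow> phi x < phi y \<longleftrightarrow> x < y"
  using phi_strict_mono phi_mono by (metis not_less)

lemma phi_range: "0 \<le> y \<Longrightarrow> y < 1 \<Longrightarrow> 0 \<le> phi y \<and> phi y < T"
  using phi_mono[of 0 y] T_pos by (auto simp: phi_def)

lemma beta_range: "0 < beta" "beta < 1"
proof -
  have "((T - b) / T) powr \<theta> < 1 powr \<theta>"
    using b T_pos th by (intro powr_less_mono2) auto
  then show "0 < beta" by (simp add: beta_def)
  show "beta < 1" using b T_pos by (simp add: beta_def)
qed

lemma phi_beta: "phi beta = b"
  using b th T_pos by (simp add: phi_def beta_def powr_powr)

lemma phi_deriv: "y < 1 \<Longrightarrow> (phi has_real_derivative dphi y) (at y)"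
  unfolding phi_def[abs_def] dphi_def
  by (auto intro!: derivative_eq_intros simp: powr_diff field_simps)

lemma dphi_pos: "y < 1 \<Longrightarrow> 0 < dphi y"
  unfolding dphi_def using T_pos th by auto

lemma dphi_antimono: "x \<le> y \<Longrightarrow> y < 1 \<Longrightarrow> dphi y \<le> dphi x"
  unfolding dphi_def using T_pos th by (intro mult_left_mono powr_mono2) auto

lemma dphi_le: "0 \<le> y \<Longrightarrow> y < 1 \<Longrightarrow> dphi y \<le> T / \<theta>"
  using dphi_antimono[of 0 y] by (simp add: dphi_def)

lemma phi_mean_value: "x < y \<Longrightarrow> y < 1 \<Longrightarrow> \<exists>z. x < z \<and> z < y \<and> phi y - phi x = (y - x) * dphi z"
  by (rule MVT2) (auto intro: phi_deriv)

lemma phi_lipschitz: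
  assumes "0 \<le> x" "x \<le> y" "y < 1"
  shows "phi y - phi x \<le> (y - x) * (T / \<theta>)"
proof (cases "x = y")
  case False
  then obtain z where z: "x < z" "z < y" "phi y - phi x = (y - x) * dphi z"
    using phi_mean_value[of x y] assms by auto
  then show ?thesis using dphi_le[of z] assms unfolding z(3) by (intro mult_left_mono) auto
qed simp

text \<open>The order (1 - \<theta>)/2 is made for this identity: squaring the weight doubles the
  exponent (1/\<theta>) (1 - \<theta>)/2 to 1/\<theta> - 1, the exponent of \<open>dphi\<close>. The
  Jacobian of the time change thus turns into the squared weight.\<close>

lemma w_phi: "y < 1 \<Longrightarrow> (w (phi y))\<^sup>2 = \<theta> * dphi y / T"
proof -
  assume y: "y < 1"
  have "(T - phi y) / T = (1 - y) powr (1 / \<theta>)" using T_pos by (simp add: phi_def)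
  then have "w (phi y) = (1 - y) powr (1 / \<theta> * ((1 - \<theta>) / 2))" by (simp add: wt_def powr_powr)
  then have "(w (phi y))\<^sup>2 = (1 - y) powr (1 / \<theta> * ((1 - \<theta>) / 2) + 1 / \<theta> * ((1 - \<theta>) / 2))"
    by (simp only: power2_eq_square powr_add)
  also have "1 / \<theta> * ((1 - \<theta>) / 2) + 1 / \<theta> * ((1 - \<theta>) / 2) = 1 / \<theta> - 1"
    using th by (simp add: field_simps)
  finally show ?thesis using T_pos th by (simp add: dphi_def)
qed

section \<open>Weighted square sums along nets with equal steps in this scale\<close>

definition G :: "real \<Rightarrow> real \<Rightarrow> 'a \<Rightarrow> real" where
  "G y z \<omega> = (w (phi z))\<^sup>2 * (Lz (phi z) \<omega> - Lz (phi y) \<omega>)\<^sup>2"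

lemma G_nonneg: "0 \<le> G y z \<omega>" by (simp add: G_def)

lemma G_measurable[measurable (raw)]:
  assumes [measurable]: "f \<in> borel_measurable N" "g \<in> borel_measurable N" "h \<in> measurable N M"
  shows "(\<lambda>x. G (f x) (g x) (h x)) \<in> borel_measurable N"
  unfolding G_def by measurable

text \<open>For \<open>0 < v\<close> and \<open>\<rho> < beta\<close> only finitely many terms are nonzero; other values are irrelevant.\<close>

definition cell_sum :: "real \<Rightarrow> real \<Rightarrow> 'a \<Rightarrow> real" where
  "cell_sum v \<rho> \<omega> = enn2real (\<Sum>k. indicator {..<beta} (\<rho> + (real k + 1) * v)
     * ennreal (G (\<rho> + real k * v) (\<rho> + (real k + 1) * v) \<omega>))"

lemma cell_sum_measurable:
  "(\<lambda>(x, \<omega>). cell_sum (fst x) (snd x) \<omega>) \<in> borel_measurable ((borel \<Otimes>\<^sub>M borel) \<Otimes>\<^sub>M M)"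
  unfolding cell_sum_def case_prod_beta' by measurable

lemma cell_count:
  assumes "0 < v" "\<rho> < beta"
  obtains K :: nat where "\<rho> + real K * v < beta" "beta \<le> \<rho> + (real K + 1) * v"
proof -
  define x where "x = (beta - \<rho>) / v"
  have x: "0 < x" using assms by (simp add: x_def)
  \<comment> \<open>Ceiling minus one rather than floor: a node that falls exactly on beta must be
    excluded, since all nodes have to be mapped strictly below b.\<close>
  define K where "K = nat (\<lceil>x\<rceil> - 1)"
  have "real K = of_int \<lceil>x\<rceil> - 1" using x by (simp add: K_def)
  then have "real K < x" "x \<le> real K + 1" by linarith+
  then have "\<rho> + real K * v < beta" "beta \<le> \<rho> + (real K + 1) * v"
    using assms by (simp_all add: x_def field_simps)
  then show ?thesis by (rule that)
qed

lemma cell_indicator: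
  assumes "0 < v" "\<rho> + real K * v < beta" "beta \<le> \<rho> + (real K + 1) * v"
  shows "\<rho> + (real k + 1) * v < beta \<longleftrightarrow> k < K"
proof
  assume "k < K"
  then have "real k + 1 \<le> real K" by linarith
  then have "(real k + 1) * v \<le> real K * v" using assms by (intro mult_right_mono) auto
  then show "\<rho> + (real k + 1) * v < beta" using assms by linarith
next
  assume *: "\<rho> + (real k + 1) * v < beta"
  show "k < K"
  proof (rule ccontr)
    assume "\<not> k < K"
    then have "(real K + 1) * v \<le> (real k + 1) * v" using assms by (intro mult_right_mono) auto
    then show False using * assms by linarith
  qed
qed

lemma cell_sum_finite:
  assumes "0 < v" "\<rho> + real K * v < beta" "beta \<le> \<rho> + (real K + 1) * v"
  shows "cell_sum v \<rho> \<omega> = (\<Sum>k<K. G (\<rho> + real k * v) (\<rho> + (real k + 1) * v) \<omega>)"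
    and "ennreal (cell_sum v \<rho> \<omega>)
      = (\<Sum>k. indicator {..<beta} (\<rho> + (real k + 1) * v) * ennreal (G (\<rho> + real k * v) (\<rho> + (real k + 1) * v) \<omega>))"
proof -
  let ?f = "\<lambda>k. indicator {..<beta} (\<rho> + (real k + 1) * v) * ennreal (G (\<rho> + real k * v) (\<rho> + (real k + 1) * v) \<omega>)"
  have "suminf ?f = sum ?f {..<K}"
    by (rule suminf_finite) (use cell_indicator[OF assms] in auto)
  also have "\<dots> = (\<Sum>k<K. ennreal (G (\<rho> + real k * v) (\<rho> + (real k + 1) * v) \<omega>))"
    using cell_indicator[OF assms] by (intro sum.cong) auto
  also have "\<dots> = ennreal (\<Sum>k<K. G (\<rho> + real k * v) (\<rho> + (real k + 1) * v) \<omega>)"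
    by (rule sum_ennreal) (simp add: G_nonneg)
  finally have e: "suminf ?f = ennreal (\<Sum>k<K. G (\<rho> + real k * v) (\<rho> + (real k + 1) * v) \<omega>)" .
  then show "cell_sum v \<rho> \<omega> = (\<Sum>k<K. G (\<rho> + real k * v) (\<rho> + (real k + 1) * v) \<omega>)"
    unfolding cell_sum_def by (simp add: sum_nonneg G_nonneg)
  with e show "ennreal (cell_sum v \<rho> \<omega>) = suminf ?f" by simp
qed

text \<open>With 0 put in front, the images of \<rho>, \<rho> + v, ... form a partition of some
  [0, x] with x < b close to b. Its weighted sum exceeds the cell sum by one term, the weighted
  square of L at phi(\<rho>), whose expectation is at most the energy at a time near 0.\<close>

lemma cell_sum_near_left_bracket:
  assumes e: "0 < \<epsilon>"
  shows "\<exists>h0>0. h0 \<le> beta \<and> (\<forall>v \<rho>. 0 < v \<longrightarrow> v < h0 \<longrightarrow> 0 \<le> \<rho> \<longrightarrow> \<rho> < v \<longrightarrow>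
    (\<integral>\<^sup>+\<omega>. ennreal \<bar>cell_sum v \<rho> \<omega> - Q_left b \<omega>\<bar> \<partial>M) \<le> ennreal \<epsilon>)"
proof -
  have e2: "0 < \<epsilon> / 2" using e by simp
  obtain d1 where d1: "0 < d1" "\<And>x m p. 0 \<le> x \<Longrightarrow> b - d1 < x \<Longrightarrow> x < b \<Longrightarrow> is_partition x m p \<Longrightarrow>
     (\<And>i. i < m \<Longrightarrow> p (Suc i) - p i < d1) \<Longrightarrow> (\<integral>\<omega>. \<bar>weighted_sum m p \<omega> - Q_left b \<omega>\<bar> \<partial>M) < \<epsilon> / 2"
    using weighted_sum_near_left_bracket[OF b e2] by blast
  obtain d2 where d2: "0 < d2" "\<And>t. 0 \<le> t \<Longrightarrow> t \<le> d2 \<Longrightarrow> energy t \<le> \<epsilon> / 2"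
    using energy_vanishes_at_0[OF e2] by blast
  define c where "c = T / \<theta>"
  have c: "0 < c" using T_pos th by (simp add: c_def)
  \<comment> \<open>The bound beta ensures \<rho> < v < beta. Division by c, the Lipschitz constant
    of \<open>phi\<close>, converts the thresholds d1 and d2 for times into thresholds for steps
    v.\<close>
  define h0 where "h0 = min beta (min d1 d2 / c)"
  have h0: "0 < h0" "h0 \<le> beta" using d1 d2 c beta_range by (auto simp: h0_def)
  have "(\<integral>\<^sup>+\<omega>. ennreal \<bar>cell_sum v \<rho> \<omega> - Q_left b \<omega>\<bar> \<partial>M) \<le> ennreal \<epsilon>"
    if v: "0 < v" "v < h0" and r: "0 \<le> \<rho>" "\<rho> < v" for v \<rho>
  proof -
    have "v < min d1 d2 / c" using v by (simp add: h0_def)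
    then have vc: "v * c < d1" "v * c < d2" using c by (simp_all add: pos_less_divide_eq)
    have rb: "\<rho> < beta" using r v h0 by linarith
    obtain K where K: "\<rho> + real K * v < beta" "beta \<le> \<rho> + (real K + 1) * v"
      using cell_count[OF v(1) rb] .
    define y where "y i = \<rho> + real i * v" for i :: nat
    have y_mono: "y i \<le> y j" if "i \<le> j" for i j using that v by (auto simp: y_def mult_right_mono)
    have y: "0 \<le> y i" "y i < 1" if "i \<le> K" for i
    proof -
      have "y i < beta" using y_mono[OF that] K by (simp add: y_def)
      then show "y i < 1" using beta_range by simp
      show "0 \<le> y i" using r v by (simp add: y_def)
    qed
    \<comment> \<open>Indices are shifted by one against \<open>y\<close>, to make room for the
      mandatory starting point 0.\<close>
    define p where "p i = (case i of 0 \<Rightarrow> 0 | Suc j \<Rightarrow> phi (y j))" for i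
    define x where "x = phi (y K)"
    have step: "phi (y (Suc i)) - phi (y i) \<le> v * c" if "i < K" for i
    proof -
      have "phi (y (Suc i)) - phi (y i) \<le> (y (Suc i) - y i) * (T / \<theta>)"
        using that y[of i] y[of "Suc i"] y_mono[of i "Suc i"] by (intro phi_lipschitz) auto
      also have "y (Suc i) - y i = v" by (simp add: y_def algebra_simps)
      finally show ?thesis by (simp add: c_def)
    qed
    have rho_c: "phi \<rho> \<le> v * c"
    proof -
      have "phi \<rho> - phi 0 \<le> (\<rho> - 0) * (T / \<theta>)"
        using r rb beta_range by (intro phi_lipschitz) auto
      also have "\<dots> \<le> v * c" using r c unfolding c_def by (intro mult_right_mono) auto
      finally show ?thesis by simp
    qed
    have y0: "y 0 = \<rho>" by (simp add: y_def)
    have part: "is_partition x (Suc K) p"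
      unfolding is_partition_def
    proof (intro conjI allI impI)
      fix i assume i: "i < Suc K"
      show "p i \<le> p (Suc i)"
      proof (cases i)
        case 0
        then show ?thesis using phi_range[of "y 0"] y[of 0] by (simp add: p_def)
      next
        case (Suc j)
        then show ?thesis using i y_mono[of j "Suc j"] y[of "Suc j"] by (auto simp: p_def intro!: phi_mono)
      qed
    qed (simp_all add: p_def x_def)
    have mesh: "p (Suc i) - p i < d1" if "i < Suc K" for i
    proof (cases i)
      case 0
      then show ?thesis using rho_c vc y0 by (simp add: p_def)
    next
      case (Suc j)
      then show ?thesis using step[of j] vc that by (simp add: p_def)
    qed
    have yK: "y K < beta" "beta - y K \<le> v" using K by (auto simp: y_def algebra_simps)
    have xb: "x < b"
      using yK beta_range phi_beta phi_less_iff[of "y K" beta] by (simp add: x_def)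
    have "b - x \<le> (beta - y K) * (T / \<theta>)"
      using phi_lipschitz[of "y K" beta] y[of K] yK beta_range phi_beta by (simp add: x_def)
    also have "\<dots> \<le> v * c" using yK c unfolding c_def by (intro mult_right_mono) auto
    finally have bx: "b - d1 < x" using vc by linarith
    have x0: "0 \<le> x" using phi_range[of "y K"] y[of K] by (simp add: x_def)
    have xT: "x < T" using xb b by simp
    have W: "(\<integral>\<omega>. \<bar>weighted_sum (Suc K) p \<omega> - Q_left b \<omega>\<bar> \<partial>M) < \<epsilon> / 2"
      by (rule d1(2)[OF x0 bx xb part mesh])
    define s where "s = phi \<rho>"
    have s: "0 \<le> s" "s < T" "s \<le> d2" using phi_range[of \<rho>] r rb beta_range rho_c vc by (auto simp: s_def)
    define f where "f \<omega> = (w s)\<^sup>2 * (L s \<omega>)\<^sup>2" for \<omega>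
    have decomp: "weighted_sum (Suc K) p \<omega> = f \<omega> + cell_sum v \<rho> \<omega>" if w: "\<omega> \<in> space M" for \<omega>
    proof -
      have "weighted_sum (Suc K) p \<omega> = (w (p (Suc 0)))\<^sup>2 * (L (p (Suc 0)) \<omega> - L (p 0) \<omega>)\<^sup>2
         + (\<Sum>i<K. (w (p (Suc (Suc i))))\<^sup>2 * (L (p (Suc (Suc i))) \<omega> - L (p (Suc i)) \<omega>)\<^sup>2)"
        unfolding weighted_sum_def by (rule sum.lessThan_Suc_shift)
      also have "(w (p (Suc 0)))\<^sup>2 * (L (p (Suc 0)) \<omega> - L (p 0) \<omega>)\<^sup>2 = f \<omega>"
        using L_0[OF w] y0 by (simp add: p_def f_def s_def)
      also have "(\<Sum>i<K. (w (p (Suc (Suc i))))\<^sup>2 * (L (p (Suc (Suc i))) \<omega> - L (p (Suc i)) \<omega>)\<^sup>2)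
        = (\<Sum>i<K. G (y i) (y (Suc i)) \<omega>)"
      proof (rule sum.cong)
        fix i assume "i \<in> {..<K}"
        then have "0 \<le> phi (y i)" "phi (y i) < T" "0 \<le> phi (y (Suc i))" "phi (y (Suc i)) < T"
          using phi_range y[of i] y[of "Suc i"] by auto
        then show "(w (p (Suc (Suc i))))\<^sup>2 * (L (p (Suc (Suc i))) \<omega> - L (p (Suc i)) \<omega>)\<^sup>2 = G (y i) (y (Suc i)) \<omega>"
          by (simp add: p_def G_def Lz_eq)
      qed simp
      also have "\<dots> = cell_sum v \<rho> \<omega>"
        unfolding cell_sum_finite(1)[OF v(1) K] by (simp add: y_def add.commute)
      finally show ?thesis .
    qed
    have fi: "integrable M f" unfolding f_def[abs_def] using sq[of s] s by simp
    have "(w s)\<^sup>2 \<le> 1"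
      using wt_bounds[OF al(1) s(1,2)] by (simp add: power_le_one)
    then have "(\<integral>\<omega>. f \<omega> \<partial>M) \<le> energy s"
      unfolding f_def energy_def using mult_right_mono[of "(w s)\<^sup>2" 1 "energy s"] energy_nonneg[of s]
      by (simp add: energy_def)
    then have fe: "(\<integral>\<omega>. f \<omega> \<partial>M) \<le> \<epsilon> / 2" using d2(2)[of s] s by simp
    have Wi: "integrable M (\<lambda>\<omega>. \<bar>weighted_sum (Suc K) p \<omega> - Q_left b \<omega>\<bar>)"
      using weighted_sum_integrable[OF part xT] Q_left_integrable[OF b] by simp
    have "(\<integral>\<^sup>+\<omega>. ennreal \<bar>cell_sum v \<rho> \<omega> - Q_left b \<omega>\<bar> \<partial>M)
      \<le> (\<integral>\<^sup>+\<omega>. ennreal (\<bar>weighted_sum (Suc K) p \<omega> - Q_left b \<omega>\<bar> + f \<omega>) \<partial>M)"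
    proof (rule nn_integral_mono, rule ennreal_leI)
      fix \<omega> assume w: "\<omega> \<in> space M"
      have "0 \<le> f \<omega>" by (simp add: f_def)
      then show "\<bar>cell_sum v \<rho> \<omega> - Q_left b \<omega>\<bar> \<le> \<bar>weighted_sum (Suc K) p \<omega> - Q_left b \<omega>\<bar> + f \<omega>"
        unfolding decomp[OF w] by linarith
    qed
    also have "\<dots> = ennreal (\<integral>\<omega>. \<bar>weighted_sum (Suc K) p \<omega> - Q_left b \<omega>\<bar> + f \<omega> \<partial>M)"
    proof (intro nn_integral_eq_integral Bochner_Integration.integrable_add Wi fi AE_I2)
      show "0 \<le> \<bar>weighted_sum (Suc K) p \<omega> - Q_left b \<omega>\<bar> + f \<omega>" for \<omega> by (simp add: f_def)
    qed
    also have "\<dots> \<le> ennreal \<epsilon>"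
      using Wi fi W fe by (intro ennreal_leI) simp
    finally show ?thesis .
  qed
  then show ?thesis using h0 by blast
qed

definition cell_average :: "real \<Rightarrow> 'a \<Rightarrow> real" where
  "cell_average h \<omega> = (\<integral>x. cell_sum (fst x) (snd x) \<omega> \<partial>triangle h)"

definition diagonal_integral :: "real \<Rightarrow> 'a \<Rightarrow> ennreal" where
  "diagonal_integral h \<omega> = (\<integral>\<^sup>+y. (\<integral>\<^sup>+z. (if 0 \<le> y \<and> y < z \<and> z < y + h \<and> z < beta then ennreal (G y z \<omega>) else 0) \<partial>lborel) \<partial>lborel)"

text \<open>For fixed v, the k-sum and the offset \<rho> combine into one variable y = \<rho> + k v
  on the half-line. Tonelli and the shift z = y + v then yield the strip. The condition h \<le> beta
  guarantees \<rho> < beta, where \<open>cell_sum\<close> is a genuine finite sum.\<close>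

lemma nn_integral_triangle_cell_sum:
  assumes h: "0 < h" "h \<le> beta" and w: "\<omega> \<in> space M"
  shows "(\<integral>\<^sup>+x. ennreal (cell_sum (fst x) (snd x) \<omega>) \<partial>triangle h) = ennreal (2 / h\<^sup>2) * diagonal_integral h \<omega>"
proof -
  have Gm[measurable]: "(\<lambda>x. G (fst x) (snd x) \<omega>) \<in> borel_measurable (borel \<Otimes>\<^sub>M borel)"
    using w by (intro G_measurable) auto
  have Gm2[measurable]: "(\<lambda>x. G (f x) (g x) \<omega>) \<in> borel_measurable N"
    if "f \<in> borel_measurable N" "g \<in> borel_measurable N" for f g and N :: "'c measure"
    using w that by (intro G_measurable) auto
  define H where "H v y = (if y + v < beta then ennreal (G y (y + v) \<omega>) else 0)" for v y
  have Hm: "H v \<in> borel_measurable borel" for v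
    unfolding H_def by measurable
  have csm: "(\<lambda>x. ennreal (cell_sum (fst x) (snd x) \<omega>)) \<in> borel_measurable (borel \<Otimes>\<^sub>M borel)"
    using measurable_compose[OF measurable_Pair2'[OF w] cell_sum_measurable] by simp
  have inner: "(\<integral>\<^sup>+\<rho>. ennreal (cell_sum v \<rho> \<omega>) * indicator {0..<v} \<rho> \<partial>lborel) = (\<integral>\<^sup>+y. H v y * indicator {0..} y \<partial>lborel)"
    if v: "0 < v" "v < h" for v
  proof -
    have "(\<integral>\<^sup>+\<rho>. ennreal (cell_sum v \<rho> \<omega>) * indicator {0..<v} \<rho> \<partial>lborel)
      = (\<integral>\<^sup>+\<rho>. (\<Sum>k. H v (\<rho> + real k * v)) * indicator {0..<v} \<rho> \<partial>lborel)"
    proof (rule nn_integral_cong)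
      fix \<rho>
      show "ennreal (cell_sum v \<rho> \<omega>) * indicator {0..<v} \<rho> = (\<Sum>k. H v (\<rho> + real k * v)) * indicator {0..<v} \<rho>"
      proof (cases "\<rho> \<in> {0..<v}")
        case True
        then have "\<rho> < beta" using v h by auto
        then obtain K where K: "\<rho> + real K * v < beta" "beta \<le> \<rho> + (real K + 1) * v"
          using cell_count[OF v(1)] by blast
        have e: "\<rho> + (real k + 1) * v = \<rho> + real k * v + v" for k by (simp add: algebra_simps)
        have "ennreal (cell_sum v \<rho> \<omega>) = (\<Sum>k. H v (\<rho> + real k * v))"
          unfolding cell_sum_finite(2)[OF v(1) K] H_def e by (intro suminf_cong) (simp add: indicator_def)
        then show ?thesis by simp
      qed simp
    qed
    also have "\<dots> = (\<integral>\<^sup>+y. H v y * indicator {0..} y \<partial>lborel)"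
      by (rule nn_integral_periodic_unfold[OF Hm v(1), symmetric])
    finally show ?thesis .
  qed
  have "(\<integral>\<^sup>+x. ennreal (cell_sum (fst x) (snd x) \<omega>) \<partial>triangle h)
     = ennreal (2 / h\<^sup>2) * (\<integral>\<^sup>+v. indicator {0<..<h} v * (\<integral>\<^sup>+\<rho>. ennreal (cell_sum v \<rho> \<omega>) * indicator {0..<v} \<rho> \<partial>lborel) \<partial>lborel)"
    using nn_integral_triangle[OF csm, of h] by simp
  also have "(\<integral>\<^sup>+v. indicator {0<..<h} v * (\<integral>\<^sup>+\<rho>. ennreal (cell_sum v \<rho> \<omega>) * indicator {0..<v} \<rho> \<partial>lborel) \<partial>lborel)
     = (\<integral>\<^sup>+v. (\<integral>\<^sup>+y. (if 0 < v \<and> v < h \<and> 0 \<le> y \<and> y + v < beta then ennreal (G y (y + v) \<omega>) else 0) \<partial>lborel) \<partial>lborel)"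
  proof (rule nn_integral_cong)
    fix v
    show "indicator {0<..<h} v * (\<integral>\<^sup>+\<rho>. ennreal (cell_sum v \<rho> \<omega>) * indicator {0..<v} \<rho> \<partial>lborel)
      = (\<integral>\<^sup>+y. (if 0 < v \<and> v < h \<and> 0 \<le> y \<and> y + v < beta then ennreal (G y (y + v) \<omega>) else 0) \<partial>lborel)"
    proof (cases "0 < v \<and> v < h")
      case True
      then have "indicator {0<..<h} v * (\<integral>\<^sup>+\<rho>. ennreal (cell_sum v \<rho> \<omega>) * indicator {0..<v} \<rho> \<partial>lborel)
        = (\<integral>\<^sup>+y. H v y * indicator {0..} y \<partial>lborel)" using inner by simp
      also have "\<dots> = (\<integral>\<^sup>+y. (if 0 < v \<and> v < h \<and> 0 \<le> y \<and> y + v < beta then ennreal (G y (y + v) \<omega>) else 0) \<partial>lborel)"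
        using True by (intro nn_integral_cong) (simp add: H_def indicator_def)
      finally show ?thesis .
    qed auto
  qed
  also have "\<dots> = (\<integral>\<^sup>+y. (\<integral>\<^sup>+v. (if 0 < v \<and> v < h \<and> 0 \<le> y \<and> y + v < beta then ennreal (G y (y + v) \<omega>) else 0) \<partial>lborel) \<partial>lborel)"
    by (rule lborel_pair.Fubini') measurable
  also have "\<dots> = diagonal_integral h \<omega>"
    unfolding diagonal_integral_def
  proof (rule nn_integral_cong)
    fix y
    have m: "(\<lambda>z. if 0 \<le> y \<and> y < z \<and> z < y + h \<and> z < beta then ennreal (G y z \<omega>) else 0) \<in> borel_measurable borel"
      by measurable
    show "(\<integral>\<^sup>+v. (if 0 < v \<and> v < h \<and> 0 \<le> y \<and> y + v < beta then ennreal (G y (y + v) \<omega>) else 0) \<partial>lborel)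
      = (\<integral>\<^sup>+z. (if 0 \<le> y \<and> y < z \<and> z < y + h \<and> z < beta then ennreal (G y z \<omega>) else 0) \<partial>lborel)"
      by (subst nn_integral_real_affine[OF m, of 1 y]) (auto intro!: nn_integral_cong)
  qed
  finally show ?thesis .
qed

text \<open>Almost every point of \<open>triangle h\<close> is an admissible pair of step and
  offset, so the uniform estimate survives averaging. The almost sure identity with
  \<open>diagonal_integral\<close> ties the real-valued average to the nonnegative integral in which
  the sandwich is carried out.\<close>

lemma cell_average_near_left_bracket:
  assumes e: "0 < \<epsilon>"
  shows "\<exists>h0>0. \<forall>h. 0 < h \<longrightarrow> h \<le> h0 \<longrightarrow>
    cell_average h \<in> borel_measurable M \<and>
    (\<integral>\<^sup>+\<omega>. ennreal \<bar>cell_average h \<omega> - Q_left b \<omega>\<bar> \<partial>M) \<le> ennreal \<epsilon> \<and>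
    (AE \<omega> in M. 0 \<le> cell_average h \<omega> \<and> ennreal (cell_average h \<omega>) = ennreal (2 / h\<^sup>2) * diagonal_integral h \<omega>)"
proof -
  obtain h0 where h0: "0 < h0" "h0 \<le> beta"
    and close: "\<And>v \<rho>. 0 < v \<Longrightarrow> v < h0 \<Longrightarrow> 0 \<le> \<rho> \<Longrightarrow> \<rho> < v \<Longrightarrow>
      (\<integral>\<^sup>+\<omega>. ennreal \<bar>cell_sum v \<rho> \<omega> - Q_left b \<omega>\<bar> \<partial>M) \<le> ennreal \<epsilon>"
    using cell_sum_near_left_bracket[OF e] by blast
  have "cell_average h \<in> borel_measurable M \<and>
    (\<integral>\<^sup>+\<omega>. ennreal \<bar>cell_average h \<omega> - Q_left b \<omega>\<bar> \<partial>M) \<le> ennreal \<epsilon> \<and>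
    (AE \<omega> in M. 0 \<le> cell_average h \<omega> \<and> ennreal (cell_average h \<omega>) = ennreal (2 / h\<^sup>2) * diagonal_integral h \<omega>)"
    if h: "0 < h" "h \<le> h0" for h
  proof -
    interpret N: prob_space "triangle h" by (rule prob_space_triangle[OF h(1)])
    have csm: "(\<lambda>(x, \<omega>). cell_sum (fst x) (snd x) \<omega>) \<in> borel_measurable (triangle h \<Otimes>\<^sub>M M)"
      using cell_sum_measurable by (simp cong: measurable_cong_sets sets_pair_measure_cong add: sets_triangle)
    have "AE x in triangle h. 0 < fst x \<and> fst x < h \<and> 0 \<le> snd x \<and> snd x < fst x"
      unfolding triangle_def by (subst AE_density) (auto simp: split: if_splits)
    then have ae: "AE x in triangle h. (\<integral>\<^sup>+\<omega>. ennreal \<bar>cell_sum (fst x) (snd x) \<omega> - Q_left b \<omega>\<bar> \<partial>M) \<le> ennreal \<epsilon>"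
      by eventually_elim (use h close in auto)
    note dist = L1_distance_of_average[OF N.prob_space_axioms prob_space_axioms csm Q_left_meas[OF b] ae]
    have "(\<lambda>\<omega>. \<integral>x. cell_sum (fst x) (snd x) \<omega> \<partial>triangle h) \<in> borel_measurable M"
    proof (rule N.borel_measurable_lebesgue_integral)
      show "(\<lambda>(\<omega>, x). cell_sum (fst x) (snd x) \<omega>) \<in> borel_measurable (M \<Otimes>\<^sub>M triangle h)"
        using measurable_compose[OF measurable_pair_swap' csm] by (simp add: case_prod_beta')
    qed
    then have m: "cell_average h \<in> borel_measurable M" by (simp add: cell_average_def[abs_def])
    have "AE \<omega> in M. 0 \<le> cell_average h \<omega> \<and> ennreal (cell_average h \<omega>) = ennreal (2 / h\<^sup>2) * diagonal_integral h \<omega>"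
      using dist(1) AE_space
    proof eventually_elim
      case (elim \<omega>)
      have nn: "0 \<le> cell_sum v \<rho> \<omega>" for v \<rho> by (simp add: cell_sum_def)
      have "ennreal (cell_average h \<omega>) = (\<integral>\<^sup>+x. ennreal (cell_sum (fst x) (snd x) \<omega>) \<partial>triangle h)"
        unfolding cell_average_def by (rule nn_integral_eq_integral[symmetric]) (use elim nn in auto)
      also have "\<dots> = ennreal (2 / h\<^sup>2) * diagonal_integral h \<omega>"
        by (rule nn_integral_triangle_cell_sum) (use h h0 elim in auto)
      finally show ?case unfolding cell_average_def by (auto intro!: Bochner_Integration.integral_nonneg nn)
    qed
    then show ?thesis using m dist(2) unfolding cell_average_def by blast
  qed
  then show ?thesis using h0 by blast
qed

section \<open>The error of the shifted nets\<close>

definition node :: "nat \<Rightarrow> nat \<Rightarrow> real" where "node n i = phi (real i / real n)"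

lemma theta_node_eq: "theta_node T \<theta> n i = node n i"
  by (simp add: theta_node_def node_def phi_def)

abbreviation net :: "nat \<Rightarrow> real \<Rightarrow> nat \<Rightarrow> real" where "net n r \<equiv> shifted_net T \<theta> n r"

lemma net_0: "net n r 0 = 0" by (simp add: shifted_net_def)

lemma net_last: "net n r (Suc n) = T" by (simp add: shifted_net_def)

lemma net_Suc: "j < n \<Longrightarrow> net n r (Suc j) = node n j + r * (node n (Suc j) - node n j)"
  by (simp add: shifted_net_def theta_node_eq)

lemma net_measurable[measurable]: "(\<lambda>r. net n r j) \<in> borel_measurable borel"
  unfolding shifted_net_def by measurable

lemma node_mono: "i \<le> j \<Longrightarrow> j \<le> n \<Longrightarrow> node n i \<le> node n j"
  unfolding node_def by (intro phi_mono divide_right_mono) (auto simp: divide_le_eq_1)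

lemma node_0: "node n 0 = 0" by (simp add: node_def)

lemma node_n: "0 < n \<Longrightarrow> node n n = T" by (simp add: node_def phi_def)

lemma net_between:
  assumes "j < n" "0 \<le> r" "r \<le> 1"
  shows "node n j \<le> net n r (Suc j)" "net n r (Suc j) \<le> node n (Suc j)"
proof -
  have d: "0 \<le> node n (Suc j) - node n j" using node_mono[of j "Suc j" n] assms by simp
  show "node n j \<le> net n r (Suc j)" unfolding net_Suc[OF assms(1)] using d assms by simp
  have "r * (node n (Suc j) - node n j) \<le> 1 * (node n (Suc j) - node n j)"
    using d assms by (intro mult_right_mono) auto
  then show "net n r (Suc j) \<le> node n (Suc j)" unfolding net_Suc[OF assms(1)] by simp
qed

lemma net_step:
  assumes "0 < n" "0 \<le> r" "r \<le> 1" "i \<le> n"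
  shows "net n r i \<le> net n r (Suc i)"
proof (cases i)
  case 0
  then show ?thesis using net_between(1)[of 0 n r] assms by (simp add: net_0 node_0)
next
  case (Suc j)
  then have j: "j < n" using assms by simp
  show ?thesis
  proof (cases "i = n")
    case True
    then show ?thesis using net_between(2)[OF j assms(2,3)] node_n[OF assms(1)] Suc by (simp add: net_last)
  next
    case False
    then have "Suc j < n" using assms Suc by simp
    from net_between(2)[OF j assms(2,3)] net_between(1)[OF this assms(2,3)] show ?thesis using Suc by simp
  qed
qed

lemma net_mono:
  assumes n: "0 < n" "0 \<le> r" "r \<le> 1" and "i \<le> j" "j \<le> Suc n"
  shows "net n r i \<le> net n r j"
  using assms(4,5)
proof (induction j rule: dec_induct)
  case (step k)
  then show ?case using net_step[OF n, of k] by auto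
qed simp

text \<open>Index 0 is the irregular cell from 0 to the first shifted node. The cell with index
  \<open>Suc j\<close>, for j < n, starts at the shifted node between \<open>node n j\<close> and
  \<open>node n (Suc j)\<close>.\<close>

definition cell_err :: "nat \<Rightarrow> nat \<Rightarrow> real \<Rightarrow> real \<Rightarrow> 'a \<Rightarrow> real" where
  "cell_err n j r u \<omega> = (if net n r j < u \<and> u \<le> net n r (Suc j) then (Lz u \<omega> - Lz (net n r j) \<omega>)\<^sup>2 else 0)"

lemma cell_err_nonneg: "0 \<le> cell_err n j r u \<omega>" by (simp add: cell_err_def)

lemma cell_err_measurable[measurable (raw)]:
  assumes [measurable]: "f \<in> borel_measurable N" "g \<in> borel_measurable N" "h \<in> measurable N M"
  shows "(\<lambda>x. cell_err n j (f x) (g x) (h x)) \<in> borel_measurable N"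
  unfolding cell_err_def by measurable

text \<open>The half-open cells are disjoint and cover (0, b], so exactly one of them contributes at
  u > 0 and the square may be taken inside the sum. At u = 0 no cell contributes, and L_0 = 0 makes
  both sides vanish.\<close>

lemma net_error_pointwise:
  assumes n: "0 < n" and r: "0 \<le> r" "r \<le> 1" and u: "0 \<le> u" "u \<le> b" and w: "\<omega> \<in> space M"
  shows "\<bar>L u \<omega> - (\<Sum>i=1..n + 1. L (net n r (i - 1)) \<omega> * indicator {net n r (i - 1)<..net n r i} u)\<bar>\<^sup>2
     = (\<Sum>j<Suc n. cell_err n j r u \<omega>)"
proof -
  have shift: "(\<Sum>i=1..n + 1. L (net n r (i - 1)) \<omega> * indicator {net n r (i - 1)<..net n r i} u)
    = (\<Sum>j<Suc n. L (net n r j) \<omega> * indicator {net n r j<..net n r (Suc j)} u)"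
    by (rule sum.reindex_bij_witness[of _ Suc "\<lambda>i. i - 1"]) auto
  show ?thesis
  proof (cases "u = 0")
    case True
    have "0 \<le> net n r j" if "j < Suc n" for j
      using net_mono[OF n r, of 0 j] that by (simp add: net_0)
    then have "u \<notin> {net n r j<..net n r (Suc j)}" if "j < Suc n" for j using that True by force
    then have "(\<Sum>j<Suc n. L (net n r j) \<omega> * indicator {net n r j<..net n r (Suc j)} u) = 0" "(\<Sum>j<Suc n. cell_err n j r u \<omega>) = 0"
      by (auto intro!: sum.neutral simp: cell_err_def simp del: sum.lessThan_Suc)
    then show ?thesis unfolding shift using True L_0[OF w] by simp
  next
    case False
    then have u0: "0 < u" using u by simp
    \<comment> \<open>The first node not before u is the right end of the cell containing u; it is
      not node 0 because u > 0.\<close>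
    define k where "k = (LEAST i. u \<le> net n r i)"
    have ex: "u \<le> net n r (Suc n)" using u b by (simp add: net_last)
    have k: "u \<le> net n r k" unfolding k_def by (rule LeastI[of "\<lambda>i. u \<le> net n r i", OF ex])
    have kn: "k \<le> Suc n" unfolding k_def by (rule Least_le[of "\<lambda>i. u \<le> net n r i", OF ex])
    have "k \<noteq> 0" using k u0 net_0 by (metis not_le)
    then obtain j where j: "k = Suc j" by (cases k) auto
    have jn: "j < Suc n" using kn j by simp
    have "j < k" using j by simp
    then have lt: "net n r j < u"
      using not_less_Least[of j "\<lambda>i. u \<le> net n r i"] unfolding k_def by auto
    have iff: "net n r i < u \<and> u \<le> net n r (Suc i) \<longleftrightarrow> i = j" if "i < Suc n" for i
    proof
      assume i: "net n r i < u \<and> u \<le> net n r (Suc i)"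
      show "i = j"
      proof (rule ccontr)
        assume "i \<noteq> j"
        then consider "Suc i \<le> j" | "Suc j \<le> i" by linarith
        then show False
        proof cases
          case 1
          from net_mono[OF n r this] jn lt i show False by linarith
        next
          case 2
          from net_mono[OF n r this] that k j i show False by (metis less_imp_le not_le order_trans)
        qed
      qed
    qed (use lt k j in auto)
    have "(\<Sum>i<Suc n. L (net n r i) \<omega> * indicator {net n r i<..net n r (Suc i)} u)
      = (\<Sum>i<Suc n. if i = j then L (net n r j) \<omega> else 0)"
      by (rule sum.cong) (use iff in \<open>auto simp: indicator_def\<close>)
    also have "\<dots> = L (net n r j) \<omega>" using jn by (simp add: sum.delta)
    finally have 1: "(\<Sum>i<Suc n. L (net n r i) \<omega> * indicator {net n r i<..net n r (Suc i)} u) = L (net n r j) \<omega>" .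
    have "(\<Sum>i<Suc n. cell_err n i r u \<omega>) = (\<Sum>i<Suc n. if i = j then (Lz u \<omega> - Lz (net n r j) \<omega>)\<^sup>2 else 0)"
      by (rule sum.cong) (use iff in \<open>auto simp: cell_err_def\<close>)
    also have "\<dots> = (Lz u \<omega> - Lz (net n r j) \<omega>)\<^sup>2" using jn by (simp add: sum.delta)
    finally have 2: "(\<Sum>i<Suc n. cell_err n i r u \<omega>) = (Lz u \<omega> - Lz (net n r j) \<omega>)\<^sup>2" .
    have "0 \<le> net n r j" using net_mono[OF n r, of 0 j] jn by (simp add: net_0)
    then have "Lz (net n r j) = L (net n r j)" "Lz u = L u" using lt u b by (auto intro!: Lz_eq)
    then show ?thesis unfolding shift 1 2 by simp
  qed
qed

section \<open>Reduction of the averaged error to single cells\<close>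

definition net_mean :: "nat \<Rightarrow> 'a \<Rightarrow> real" where
  "net_mean n \<omega> = 2 * \<theta> * real n / T * (LBINT r:{0..<1}. net_square_error L (n + 1) (net n r) b \<omega>)"

text \<open>Extended nonnegative values allow summation over cells and Tonelli without prior
  integrability.\<close>

definition cell_mean :: "nat \<Rightarrow> nat \<Rightarrow> 'a \<Rightarrow> ennreal" where
  "cell_mean n j \<omega> = ennreal (2 * \<theta> * real n / T) *
     (\<integral>\<^sup>+r. indicator {0..<1} r * (\<integral>\<^sup>+u. indicator {0..b} u * ennreal (cell_err n j r u \<omega>) \<partial>lborel) \<partial>lborel)"

lemma cell_err_section_measurable:
  assumes w: "\<omega> \<in> space M" and fg: "f \<in> borel_measurable N" "g \<in> borel_measurable N"
  shows "(\<lambda>x. cell_err n j (f x) (g x) \<omega>) \<in> borel_measurable N"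
  by (rule cell_err_measurable[OF fg measurable_const[OF w]])

lemma cell_mean_measurable: "cell_mean n j \<in> borel_measurable M"
  unfolding cell_mean_def by measurable

text \<open>A crude bound that grows with n. It serves only to make the averaged error finite almost
  surely and integrable for each fixed n.\<close>

lemma cell_mean_energy:
  assumes n: "0 < n" and j: "j \<le> n"
  shows "(\<integral>\<^sup>+\<omega>. cell_mean n j \<omega> \<partial>M) \<le> ennreal (2 * \<theta> * real n / T * (b * energy b))"
proof -
  interpret P: pair_sigma_finite M lborel by unfold_locales
  have total: "(\<integral>\<^sup>+\<omega>. cell_mean n j \<omega> \<partial>M) = ennreal (2 * \<theta> * real n / T) *
     (\<integral>\<^sup>+\<omega>. (\<integral>\<^sup>+r. indicator {0..<1} r * (\<integral>\<^sup>+u. indicator {0..b} u * ennreal (cell_err n j r u \<omega>) \<partial>lborel) \<partial>lborel) \<partial>M)"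
    unfolding cell_mean_def by (rule nn_integral_cmult) measurable
  have "(\<integral>\<^sup>+\<omega>. (\<integral>\<^sup>+r. indicator {0..<1} r * (\<integral>\<^sup>+u. indicator {0..b} u * ennreal (cell_err n j r u \<omega>) \<partial>lborel) \<partial>lborel) \<partial>M)
    = (\<integral>\<^sup>+r. (\<integral>\<^sup>+\<omega>. indicator {0..<1} r * (\<integral>\<^sup>+u. indicator {0..b} u * ennreal (cell_err n j r u \<omega>) \<partial>lborel) \<partial>M) \<partial>lborel)"
    by (rule P.Fubini'[symmetric]) measurable
  also have "\<dots> = (\<integral>\<^sup>+r. indicator {0..<1} r * (\<integral>\<^sup>+u. indicator {0..b} u * (\<integral>\<^sup>+\<omega>. ennreal (cell_err n j r u \<omega>) \<partial>M) \<partial>lborel) \<partial>lborel)"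
  proof (rule nn_integral_cong)
    fix r
    have "(\<integral>\<^sup>+\<omega>. indicator {0..<1} r * (\<integral>\<^sup>+u. indicator {0..b} u * ennreal (cell_err n j r u \<omega>) \<partial>lborel) \<partial>M)
      = indicator {0..<1} r * (\<integral>\<^sup>+\<omega>. (\<integral>\<^sup>+u. indicator {0..b} u * ennreal (cell_err n j r u \<omega>) \<partial>lborel) \<partial>M)"
      by (rule nn_integral_cmult) measurable
    also have "(\<integral>\<^sup>+\<omega>. (\<integral>\<^sup>+u. indicator {0..b} u * ennreal (cell_err n j r u \<omega>) \<partial>lborel) \<partial>M)
      = (\<integral>\<^sup>+u. (\<integral>\<^sup>+\<omega>. indicator {0..b} u * ennreal (cell_err n j r u \<omega>) \<partial>M) \<partial>lborel)"
      by (rule P.Fubini'[symmetric]) measurable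
    also have "\<dots> = (\<integral>\<^sup>+u. indicator {0..b} u * (\<integral>\<^sup>+\<omega>. ennreal (cell_err n j r u \<omega>) \<partial>M) \<partial>lborel)"
      by (intro nn_integral_cong nn_integral_cmult) measurable
    finally show "(\<integral>\<^sup>+\<omega>. indicator {0..<1} r * (\<integral>\<^sup>+u. indicator {0..b} u * ennreal (cell_err n j r u \<omega>) \<partial>lborel) \<partial>M)
      = indicator {0..<1} r * (\<integral>\<^sup>+u. indicator {0..b} u * (\<integral>\<^sup>+\<omega>. ennreal (cell_err n j r u \<omega>) \<partial>M) \<partial>lborel)" .
  qed
  also have "\<dots> \<le> (\<integral>\<^sup>+r. indicator {0..<1} r * (\<integral>\<^sup>+u. indicator {0..b} u * ennreal (energy b) \<partial>lborel) \<partial>(lborel :: real measure))"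
  proof (rule nn_integral_mono)
    fix r :: real
    have "(\<integral>\<^sup>+\<omega>. ennreal (cell_err n j r u \<omega>) \<partial>M) \<le> ennreal (energy b)" if r: "0 \<le> r" "r < 1" and u: "0 \<le> u" "u \<le> b" for u
    proof (cases "net n r j < u \<and> u \<le> net n r (Suc j)")
      case True
      have "0 \<le> net n r j" using net_mono[of n r 0 j] n r j by (simp add: net_0)
      then have "(\<integral>\<^sup>+\<omega>. ennreal ((L u \<omega> - L (net n r j) \<omega>)\<^sup>2) \<partial>M) = ennreal (energy u - energy (net n r j))"
        using True u b by (intro nn_increment_energy) auto
      also have "\<dots> \<le> ennreal (energy b)"
        using energy_mono[of u b] energy_nonneg[of "net n r j"] u b by (intro ennreal_leI) auto
      finally show ?thesis using True \<open>0 \<le> net n r j\<close> u b by (simp add: cell_err_def Lz_eq)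
    next
      case False
      then have "cell_err n j r u \<omega> = 0" for \<omega> by (auto simp: cell_err_def)
      then show ?thesis by simp
    qed
    then show "indicator {0..<1} r * (\<integral>\<^sup>+u. indicator {0..b} u * (\<integral>\<^sup>+\<omega>. ennreal (cell_err n j r u \<omega>) \<partial>M) \<partial>lborel)
      \<le> indicator {0..<1} r * (\<integral>\<^sup>+u. indicator {0..b} u * ennreal (energy b) \<partial>lborel)"
      by (auto simp: indicator_def intro!: nn_integral_mono)
  qed
  also have "\<dots> = ennreal b * ennreal (energy b)"
    using b by (simp add: nn_integral_multc)
  finally have "(\<integral>\<^sup>+\<omega>. cell_mean n j \<omega> \<partial>M) \<le> ennreal (2 * \<theta> * real n / T) * (ennreal b * ennreal (energy b))"
    unfolding total by (rule mult_left_mono) simp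
  also have "\<dots> = ennreal (2 * \<theta> * real n / T * (b * energy b))"
    using th T_pos b energy_nonneg[of b] by (simp add: ennreal_mult[symmetric])
  finally show ?thesis .
qed

text \<open>Bochner integrals and nonnegative integrals agree once the total is finite, which holds
  for almost every outcome because its expectation is finite.\<close>

lemma net_mean_eq:
  assumes n: "0 < n"
  shows "net_mean n \<in> borel_measurable M"
    and "AE \<omega> in M. 0 \<le> net_mean n \<omega> \<and> ennreal (net_mean n \<omega>) = (\<Sum>j<Suc n. cell_mean n j \<omega>)"
    and "integrable M (net_mean n)"
proof -
  define C where "C = 2 * \<theta> * real n / T"
  have C: "0 \<le> C" using th T_pos by (simp add: C_def)
  define E where "E r \<omega> = (\<integral>u. indicator {0..b} u * (\<Sum>j<Suc n. cell_err n j r u \<omega>) \<partial>lborel)" for r \<omega>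
  have [measurable]: "(\<lambda>x. E (fst x) (snd x)) \<in> borel_measurable (borel \<Otimes>\<^sub>M M)"
    unfolding E_def by measurable
  have Em: "(\<lambda>x. E (fst x) (snd x)) \<in> borel_measurable (lborel \<Otimes>\<^sub>M M)"
    unfolding E_def by measurable
  have eq: "net_mean n \<omega> = C * (\<integral>r. indicator {0..<1} r * E r \<omega> \<partial>lborel)" if w: "\<omega> \<in> space M" for \<omega>
  proof -
    have "net_square_error L (n + 1) (net n r) b \<omega> = E r \<omega>" if r: "0 \<le> r" "r < 1" for r
    proof -
      have e: "indicator {0..b} u *\<^sub>R \<bar>L u \<omega> - (\<Sum>i=1..n + 1. L (net n r (i - 1)) \<omega> * indicator {net n r (i - 1)<..net n r i} u)\<bar>\<^sup>2
        = indicator {0..b} u * (\<Sum>j<Suc n. cell_err n j r u \<omega>)" for u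
      proof (cases "u \<in> {0..b}")
        case True
        then show ?thesis using net_error_pointwise[OF n, of r u \<omega>] r w by simp
      qed simp
      show ?thesis unfolding net_square_error_def set_lebesgue_integral_def e E_def ..
    qed
    then have e: "indicator {0..<1} r *\<^sub>R net_square_error L (n + 1) (net n r) b \<omega> = indicator {0..<1} r * E r \<omega>" for r
      by (simp add: indicator_def)
    show ?thesis unfolding net_mean_def set_lebesgue_integral_def e C_def ..
  qed
  have "(\<lambda>\<omega>. C * (\<integral>r. indicator {0..<1} r * E r \<omega> \<partial>lborel)) \<in> borel_measurable M"
    unfolding E_def by measurable
  then show m: "net_mean n \<in> borel_measurable M" using eq by (simp cong: measurable_cong)
  have fin: "(\<integral>\<^sup>+\<omega>. (\<Sum>j<Suc n. cell_mean n j \<omega>) \<partial>M) < \<infinity>"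
  proof -
    have "(\<integral>\<^sup>+\<omega>. (\<Sum>j<Suc n. cell_mean n j \<omega>) \<partial>M) = (\<Sum>j<Suc n. \<integral>\<^sup>+\<omega>. cell_mean n j \<omega> \<partial>M)"
      by (rule nn_integral_sum) (rule cell_mean_measurable)
    also have "\<dots> \<le> (\<Sum>j<Suc n. ennreal (2 * \<theta> * real n / T * (b * energy b)))"
      by (intro sum_mono cell_mean_energy n) auto
    also have "\<dots> < \<infinity>" by (simp add: ennreal_mult_less_top of_nat_less_top)
    finally show ?thesis .
  qed
  have "AE \<omega> in M. (\<Sum>j<Suc n. cell_mean n j \<omega>) \<noteq> \<infinity>"
    by (rule nn_integral_PInf_AE) (use fin cell_mean_measurable in \<open>auto simp del: sum.lessThan_Suc\<close>)
  then show ae: "AE \<omega> in M. 0 \<le> net_mean n \<omega> \<and> ennreal (net_mean n \<omega>) = (\<Sum>j<Suc n. cell_mean n j \<omega>)"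
    using AE_space
  proof eventually_elim
    case (elim \<omega>)
    note w = elim(2)
    have em[measurable]: "(\<lambda>u. cell_err n j r u \<omega>) \<in> borel_measurable borel" for j r
      by (rule cell_err_section_measurable[OF w]) auto
    define N where "N r = (\<integral>\<^sup>+u. ennreal (indicator {0..b} u * (\<Sum>j<Suc n. cell_err n j r u \<omega>)) \<partial>lborel)" for r
    have em2[measurable]: "(\<lambda>x. cell_err n j (fst x) (snd x) \<omega>) \<in> borel_measurable (borel \<Otimes>\<^sub>M borel)" for j
      by (rule cell_err_section_measurable[OF w]) auto
    have em3: "(\<lambda>r. \<integral>\<^sup>+u. indicator {0..b} u * ennreal (cell_err n j r u \<omega>) \<partial>lborel) \<in> borel_measurable borel" for j
      by (rule lborel.borel_measurable_nn_integral) (use em2[of j] in \<open>simp add: case_prod_beta'\<close>)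
    have Nsum: "N r = (\<Sum>j<Suc n. \<integral>\<^sup>+u. indicator {0..b} u * ennreal (cell_err n j r u \<omega>) \<partial>lborel)" for r
    proof -
      have "ennreal (indicator {0..b} u * (\<Sum>j<Suc n. cell_err n j r u \<omega>)) = (\<Sum>j<Suc n. indicator {0..b} u * ennreal (cell_err n j r u \<omega>))" for u
        unfolding sum_distrib_left[symmetric] by (subst sum_ennreal) (auto simp: cell_err_nonneg indicator_def)
      then have "N r = (\<integral>\<^sup>+u. (\<Sum>j<Suc n. indicator {0..b} u * ennreal (cell_err n j r u \<omega>)) \<partial>lborel)"
        unfolding N_def by (simp only:)
      also have "\<dots> = (\<Sum>j<Suc n. \<integral>\<^sup>+u. indicator {0..b} u * ennreal (cell_err n j r u \<omega>) \<partial>lborel)"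
        by (rule nn_integral_sum) (use em in simp)
      finally show ?thesis .
    qed
    have Nm[measurable]: "N \<in> borel_measurable borel"
      unfolding Nsum[abs_def] by (intro borel_measurable_sum em3)
    have E: "E r \<omega> = enn2real (N r)" for r
      unfolding E_def N_def
    proof (rule integral_eq_nn_integral)
      show "(\<lambda>u. indicator {0..b} u * (\<Sum>j<Suc n. cell_err n j r u \<omega>)) \<in> borel_measurable lborel"
        by (intro borel_measurable_times borel_measurable_sum) (use em in simp_all)
    qed (auto intro!: AE_I2 mult_nonneg_nonneg sum_nonneg cell_err_nonneg simp del: sum.lessThan_Suc)
    have total: "(\<Sum>j<Suc n. cell_mean n j \<omega>) = ennreal C * (\<integral>\<^sup>+r. indicator {0..<1} r * N r \<partial>lborel)"
    proof -
      have "(\<integral>\<^sup>+r. indicator {0..<1} r * N r \<partial>lborel)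
        = (\<integral>\<^sup>+r. (\<Sum>j<Suc n. indicator {0..<1} r * (\<integral>\<^sup>+u. indicator {0..b} u * ennreal (cell_err n j r u \<omega>) \<partial>lborel)) \<partial>lborel)"
        unfolding Nsum sum_distrib_left ..
      also have "\<dots> = (\<Sum>j<Suc n. \<integral>\<^sup>+r. indicator {0..<1} r * (\<integral>\<^sup>+u. indicator {0..b} u * ennreal (cell_err n j r u \<omega>) \<partial>lborel) \<partial>lborel)"
        by (rule nn_integral_sum) (use em3 in simp)
      finally show ?thesis unfolding cell_mean_def C_def sum_distrib_left[symmetric] by (simp only:)
    qed
    have Cpos: "0 < C" using th T_pos n by (simp add: C_def)
    have "(\<integral>\<^sup>+r. indicator {0..<1} r * N r \<partial>lborel) \<noteq> \<infinity>"
      using elim(1) Cpos unfolding total by (auto simp: ennreal_mult_eq_top_iff)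
    then have "AE r in lborel. indicator {0..<1} r * N r \<noteq> \<infinity>"
      by (intro nn_integral_PInf_AE) auto
    \<comment> \<open>Where \<open>N r\<close> is infinite, \<open>E r \<omega>\<close> takes the
      default value 0; finiteness of the total confines this to a null set of r.\<close>
    then have Nae: "AE r in lborel. ennreal (indicator {0..<1} r * E r \<omega>) = indicator {0..<1} r * N r"
      by eventually_elim (auto simp: E indicator_def top.not_eq_extremum)
    have Enn: "0 \<le> indicator {0..<1} r * E r \<omega>" for r by (simp add: E)
    have Erm: "(\<lambda>r. indicator {0..<1} r * E r \<omega>) \<in> borel_measurable lborel" unfolding E by measurable
    have "(\<integral>r. indicator {0..<1} r * E r \<omega> \<partial>lborel) = enn2real (\<integral>\<^sup>+r. ennreal (indicator {0..<1} r * E r \<omega>) \<partial>lborel)"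
      by (rule integral_eq_nn_integral[OF Erm]) (use Enn in auto)
    also have "(\<integral>\<^sup>+r. ennreal (indicator {0..<1} r * E r \<omega>) \<partial>lborel) = (\<integral>\<^sup>+r. indicator {0..<1} r * N r \<partial>lborel)"
      by (rule nn_integral_cong_AE[OF Nae])
    finally have I: "(\<integral>r. indicator {0..<1} r * E r \<omega> \<partial>lborel) = enn2real (\<integral>\<^sup>+r. indicator {0..<1} r * N r \<partial>lborel)" .
    have "ennreal (net_mean n \<omega>) = ennreal C * (\<integral>\<^sup>+r. indicator {0..<1} r * N r \<partial>lborel)"
      unfolding eq[OF w] I using C \<open>(\<integral>\<^sup>+r. indicator {0..<1} r * N r \<partial>lborel) \<noteq> \<infinity>\<close>
      by (simp add: ennreal_mult top.not_eq_extremum)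
    moreover have "0 \<le> net_mean n \<omega>" unfolding eq[OF w] I using C by simp
    ultimately show ?case unfolding total by simp
  qed
  show "integrable M (net_mean n)"
  proof (rule integrableI_nonneg[OF m])
    show "AE \<omega> in M. 0 \<le> net_mean n \<omega>" using ae by eventually_elim blast
    have "(\<integral>\<^sup>+\<omega>. ennreal (net_mean n \<omega>) \<partial>M) = (\<integral>\<^sup>+\<omega>. (\<Sum>j<Suc n. cell_mean n j \<omega>) \<partial>M)"
      by (rule nn_integral_cong_AE) (use ae in \<open>eventually_elim, blast\<close>)
    then show "(\<integral>\<^sup>+\<omega>. ennreal (net_mean n \<omega>) \<partial>M) < \<infinity>" using fin by simp
  qed
qed

text \<open>The initial cell lies in [0, s] with s = phi(1/n), and its error there is L_u^2, of
  expectation at most \<open>energy s\<close>. By the Lipschitz bound s \<le> T/(\<theta> n), so the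
  prefactor 2 \<theta> n / T times s is at most 2.\<close>

lemma first_cell_energy:
  assumes n: "2 \<le> n"
  shows "(\<integral>\<^sup>+\<omega>. cell_mean n 0 \<omega> \<partial>M) \<le> ennreal (2 * energy (phi (1 / real n)))"
proof -
  interpret P: pair_sigma_finite M lborel by unfold_locales
  define C where "C = 2 * \<theta> * real n / T"
  have C: "0 \<le> C" using th T_pos by (simp add: C_def)
  define s where "s = phi (1 / real n)"
  have n1: "1 / real n < 1" using n by simp
  have s: "0 \<le> s" "s < T" using phi_range[of "1 / real n"] n1 by (auto simp: s_def)
  have "phi (1 / real n) - phi 0 \<le> (1 / real n - 0) * (T / \<theta>)"
    using n1 by (intro phi_lipschitz) auto
  then have "C * s \<le> C * (1 / real n * (T / \<theta>))" using C by (intro mult_left_mono) (simp_all add: s_def)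
  also have "\<dots> = 2" using n th T_pos by (simp add: C_def)
  finally have Cs: "C * s \<le> 2" .
  have le: "cell_mean n 0 \<omega> \<le> ennreal C * (\<integral>\<^sup>+u. indicator {0..s} u * ennreal ((Lz u \<omega>)\<^sup>2) \<partial>lborel)"
    if w: "\<omega> \<in> space M" for \<omega>
  proof -
    have "(\<integral>\<^sup>+r. indicator {0..<1} r * (\<integral>\<^sup>+u. indicator {0..b} u * ennreal (cell_err n 0 r u \<omega>) \<partial>lborel) \<partial>lborel)
      \<le> (\<integral>\<^sup>+r. indicator {0..<1} r * (\<integral>\<^sup>+u. indicator {0..s} u * ennreal ((Lz u \<omega>)\<^sup>2) \<partial>lborel) \<partial>(lborel :: real measure))"
    proof (rule nn_integral_mono)
      fix r :: real
      have "indicator {0..b} u * ennreal (cell_err n 0 r u \<omega>) \<le> indicator {0..s} u * ennreal ((Lz u \<omega>)\<^sup>2)" if "0 \<le> r" "r < 1" for u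
      proof -
        have "net n r 1 \<le> s" using net_between(2)[of 0 n r] n that by (simp add: s_def node_def)
        moreover have "Lz 0 \<omega> = 0" using L_0[OF w] T_pos by (simp add: Lz_def)
        ultimately show ?thesis by (auto simp: cell_err_def net_0 indicator_def)
      qed
      then show "indicator {0..<1} r * (\<integral>\<^sup>+u. indicator {0..b} u * ennreal (cell_err n 0 r u \<omega>) \<partial>lborel)
        \<le> indicator {0..<1} r * (\<integral>\<^sup>+u. indicator {0..s} u * ennreal ((Lz u \<omega>)\<^sup>2) \<partial>lborel)"
        by (cases "r \<in> {0..<1}") (auto intro!: nn_integral_mono)
    qed
    also have "\<dots> = (\<integral>\<^sup>+u. indicator {0..s} u * ennreal ((Lz u \<omega>)\<^sup>2) \<partial>lborel)"
      by (subst nn_integral_multc) auto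
    finally show ?thesis unfolding cell_mean_def C_def by (rule mult_left_mono) simp
  qed
  have "(\<integral>\<^sup>+\<omega>. cell_mean n 0 \<omega> \<partial>M) \<le> (\<integral>\<^sup>+\<omega>. ennreal C * (\<integral>\<^sup>+u. indicator {0..s} u * ennreal ((Lz u \<omega>)\<^sup>2) \<partial>lborel) \<partial>M)"
    by (rule nn_integral_mono[OF le])
  also have "\<dots> = ennreal C * (\<integral>\<^sup>+\<omega>. (\<integral>\<^sup>+u. indicator {0..s} u * ennreal ((Lz u \<omega>)\<^sup>2) \<partial>lborel) \<partial>M)"
    by (rule nn_integral_cmult) measurable
  also have "(\<integral>\<^sup>+\<omega>. (\<integral>\<^sup>+u. indicator {0..s} u * ennreal ((Lz u \<omega>)\<^sup>2) \<partial>lborel) \<partial>M)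
     = (\<integral>\<^sup>+u. (\<integral>\<^sup>+\<omega>. indicator {0..s} u * ennreal ((Lz u \<omega>)\<^sup>2) \<partial>M) \<partial>lborel)"
    by (rule P.Fubini'[symmetric]) measurable
  finally have 1: "(\<integral>\<^sup>+\<omega>. cell_mean n 0 \<omega> \<partial>M) \<le> ennreal C * (\<integral>\<^sup>+u. (\<integral>\<^sup>+\<omega>. indicator {0..s} u * ennreal ((Lz u \<omega>)\<^sup>2) \<partial>M) \<partial>lborel)" .
  have 2: "(\<integral>\<^sup>+u. (\<integral>\<^sup>+\<omega>. indicator {0..s} u * ennreal ((Lz u \<omega>)\<^sup>2) \<partial>M) \<partial>lborel) \<le> (\<integral>\<^sup>+u. ennreal (energy s) * indicator {0..s} u \<partial>lborel)"
  proof (rule nn_integral_mono)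
    fix u
    show "(\<integral>\<^sup>+\<omega>. indicator {0..s} u * ennreal ((Lz u \<omega>)\<^sup>2) \<partial>M) \<le> ennreal (energy s) * indicator {0..s} u"
    proof (cases "u \<in> {0..s}")
      case True
      then have "(\<integral>\<^sup>+\<omega>. ennreal ((L u \<omega>)\<^sup>2) \<partial>M) = ennreal (energy u)"
        unfolding energy_def using s by (intro nn_integral_eq_integral sq) auto
      then show ?thesis using True s by (auto simp: Lz_eq intro!: ennreal_leI energy_mono)
    qed simp
  qed
  also have "\<dots> = ennreal (energy s * s)" using s energy_nonneg[of s] by (simp add: nn_integral_cmult ennreal_mult)
  finally have "ennreal C * (\<integral>\<^sup>+u. (\<integral>\<^sup>+\<omega>. indicator {0..s} u * ennreal ((Lz u \<omega>)\<^sup>2) \<partial>M) \<partial>lborel) \<le> ennreal C * ennreal (energy s * s)"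
    by (rule mult_left_mono) simp
  also have "\<dots> = ennreal ((C * s) * energy s)"
    using C s energy_nonneg[of s] by (simp add: ennreal_mult[symmetric] mult.commute mult.left_commute)
  also have "\<dots> \<le> ennreal (2 * energy s)"
    using Cs energy_nonneg[of s] by (intro ennreal_leI mult_right_mono) auto
  finally show ?thesis using 1 unfolding s_def by (rule order_trans[rotated])
qed

text \<open>Uniform continuity gives an absolute bound on [0, c]. It becomes a relative one because
  \<open>dphi\<close> is antitone and hence at least \<open>dphi c > 0\<close> there; this is why c
  must stay below 1.\<close>

lemma dphi_ratio:
  assumes c: "0 < c" "c < 1" and e: "0 < \<eta>"
  shows "\<exists>d>0. \<forall>x\<in>{0..c}. \<forall>y\<in>{0..c}. \<bar>x - y\<bar> < d \<longrightarrow> dphi x \<le> (1 + \<eta>) * dphi y"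
proof -
  have "continuous_on {0..c} dphi"
    unfolding dphi_def[abs_def] using c by (intro continuous_intros) auto
  then have "uniformly_continuous_on {0..c} dphi" by (rule compact_uniformly_continuous) simp
  moreover have ec: "0 < \<eta> * dphi c" using e dphi_pos[OF c(2)] by simp
  ultimately obtain d where d: "0 < d" "\<And>x y. x \<in> {0..c} \<Longrightarrow> y \<in> {0..c} \<Longrightarrow> dist x y < d \<Longrightarrow> dist (dphi x) (dphi y) < \<eta> * dphi c"
    unfolding uniformly_continuous_on_def by metis
  have "dphi x \<le> (1 + \<eta>) * dphi y" if "x \<in> {0..c}" "y \<in> {0..c}" "\<bar>x - y\<bar> < d" for x y
  proof -
    have "\<bar>dphi x - dphi y\<bar> < \<eta> * dphi c" using d(2)[OF that(1,2)] that(3) by (simp add: dist_real_def)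
    moreover have "\<eta> * dphi c \<le> \<eta> * dphi y" using that c e by (intro mult_left_mono dphi_antimono) auto
    ultimately show ?thesis by (simp add: distrib_right)
  qed
  then show ?thesis using d(1) by blast
qed

section \<open>From the offset of the net to the strip above the diagonal\<close>

definition diagonal_section :: "real \<Rightarrow> real \<Rightarrow> 'a \<Rightarrow> ennreal" where
  "diagonal_section h y \<omega> = (\<integral>\<^sup>+z. (if 0 \<le> y \<and> y < z \<and> z < y + h \<and> z < beta then ennreal (G y z \<omega>) else 0) \<partial>lborel)"

lemma diagonal_integral_eq: "diagonal_integral h \<omega> = (\<integral>\<^sup>+y. diagonal_section h y \<omega> \<partial>lborel)"
  by (simp add: diagonal_integral_def diagonal_section_def)

lemma G_section_measurable:
  assumes w: "\<omega> \<in> space M" and fg: "f \<in> borel_measurable N" "g \<in> borel_measurable N"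
  shows "(\<lambda>x. G (f x) (g x) \<omega>) \<in> borel_measurable N"
  by (rule G_measurable[OF fg measurable_const[OF w]])

lemma diagonal_section_measurable:
  assumes w: "\<omega> \<in> space M"
  shows "(\<lambda>y. diagonal_section h y \<omega>) \<in> borel_measurable borel"
proof -
  have [measurable]: "(\<lambda>x. G (fst x) (snd x) \<omega>) \<in> borel_measurable (borel \<Otimes>\<^sub>M lborel)"
    by (rule G_section_measurable[OF w]) auto
  have "(\<lambda>x. if 0 \<le> fst x \<and> fst x < snd x \<and> snd x < fst x + h \<and> snd x < beta then ennreal (G (fst x) (snd x) \<omega>) else 0)
     \<in> borel_measurable (borel \<Otimes>\<^sub>M lborel)" by measurable
  then show ?thesis unfolding diagonal_section_def
    by (intro lborel.borel_measurable_nn_integral) (simp add: case_prod_beta')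
qed

lemma diagonal_section_eq_0: "y < 0 \<or> beta \<le> y \<Longrightarrow> diagonal_section h y \<omega> = 0"
  unfolding diagonal_section_def by (subst nn_integral_cong[of _ _ "\<lambda>_. 0"]) auto

lemma sum_cell_indicator:
  assumes "0 < n"
  shows "(\<Sum>j<m. indicator {real j / real n..<real (Suc j) / real n} y) = (indicator {0..<real m / real n} y :: ennreal)"
proof (induction m)
  case (Suc m)
  have "real m / real n \<le> real (Suc m) / real n" "0 \<le> real m / real n" by (simp_all add: divide_right_mono)
  then have "0 \<le> y" if "real m / real n \<le> y" using that by linarith
  then show ?case using \<open>real m / real n \<le> real (Suc m) / real n\<close> unfolding sum.lessThan_Suc Suc
    by (auto simp: indicator_def simp del: of_nat_Suc)
qed simp

lemma sum_diagonal_section: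
  assumes n: "0 < n" and w: "\<omega> \<in> space M"
  shows "(\<Sum>j<n. \<integral>\<^sup>+y. indicator {real j / real n..<real (Suc j) / real n} y * diagonal_section h y \<omega> \<partial>lborel) = diagonal_integral h \<omega>"
proof -
  note m = diagonal_section_measurable[OF w, of h]
  have "(\<Sum>j<n. \<integral>\<^sup>+y. indicator {real j / real n..<real (Suc j) / real n} y * diagonal_section h y \<omega> \<partial>lborel)
    = (\<integral>\<^sup>+y. (\<Sum>j<n. indicator {real j / real n..<real (Suc j) / real n} y * diagonal_section h y \<omega>) \<partial>lborel)"
    by (rule nn_integral_sum[symmetric]) (use m in simp)
  also have "\<dots> = (\<integral>\<^sup>+y. diagonal_section h y \<omega> \<partial>lborel)"
  proof (rule nn_integral_cong)
    fix y
    have "(\<Sum>j<n. indicator {real j / real n..<real (Suc j) / real n} y * diagonal_section h y \<omega>)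
      = indicator {0..<real n / real n} y * diagonal_section h y \<omega>"
      unfolding sum_distrib_right[symmetric] sum_cell_indicator[OF n] ..
    also have "\<dots> = diagonal_section h y \<omega>"
      using n beta_range diagonal_section_eq_0[of y h \<omega>] by (cases "0 \<le> y \<and> y < beta") (auto simp: indicator_def)
    finally show "(\<Sum>j<n. indicator {real j / real n..<real (Suc j) / real n} y * diagonal_section h y \<omega>) = diagonal_section h y \<omega>" .
  qed
  finally show ?thesis by (simp add: diagonal_integral_eq)
qed

text \<open>Such a cell starts at or after phi(beta) = b, so it contains no u \<le> b.\<close>

lemma late_cell_mean:
  assumes j: "j < n" and late: "beta \<le> real j / real n"
  shows "cell_mean n (Suc j) \<omega> = 0"
proof -
  have "cell_err n (Suc j) r u \<omega> = 0" if "0 \<le> r" "r < 1" "u \<le> b" for r u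
  proof -
    have "phi beta \<le> phi (real j / real n)" using late j by (intro phi_mono) (auto simp: divide_le_eq_1)
    then have "b \<le> net n r (Suc j)" using net_between(1)[OF j, of r] that by (simp add: phi_beta node_def)
    then show ?thesis using that by (simp add: cell_err_def)
  qed
  then have z: "indicator {0..<1} r * (\<integral>\<^sup>+u. indicator {0..b} u * ennreal (cell_err n (Suc j) r u \<omega>) \<partial>lborel) = 0" for r
    by (cases "r \<in> {0..<1}") (auto intro!: nn_integral_zero' simp: indicator_def)
  show ?thesis unfolding cell_mean_def z by simp
qed

text \<open>The offset \<open>r\<close> is traded for the position \<open>y\<close> of the node, and both variables are moved to the
  time scale in which the unshifted net is equidistant.\<close>

lemma cell_mean_substitution:
  assumes j: "Suc j < n" and w: "\<omega> \<in> space M"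
  defines "d \<equiv> node n (Suc j) - node n j"
  defines "g \<equiv> \<lambda>y. (phi y - node n j) / d"
  shows "cell_mean n (Suc j) \<omega>
    = (\<integral>\<^sup>+y. indicator {real j / real n..real (Suc j) / real n} y *
        (\<integral>\<^sup>+z. indicator {0..beta} z *
          ennreal (2 * \<theta> * real n / T * (dphi y / d) * dphi z * cell_err n (Suc j) (g y) (phi z) \<omega>) \<partial>lborel) \<partial>lborel)"
proof -
  define C where "C = 2 * \<theta> * real n / T"
  have C: "0 \<le> C" using th T_pos by (simp add: C_def)
  have n: "0 < n" using j by simp
  let ?a = "real j / real n" and ?b = "real (Suc j) / real n"
  \<comment> \<open>The assumption \<open>Suc j < n\<close> keeps the closed cell below 1, where the
    derivative of \<open>phi\<close> is available.\<close>
  have ab: "0 \<le> ?a" "?a < ?b" "?b < 1" using j by (auto simp: divide_strict_right_mono)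
  have d: "0 < d" unfolding d_def node_def using phi_strict_mono[OF ab(2)] ab by simp
  have ga: "g ?a = 0" "g ?b = 1" using d by (simp_all add: g_def d_def node_def)
  define F where "F r = (\<integral>\<^sup>+u. indicator {0..b} u * ennreal (cell_err n (Suc j) r u \<omega>) \<partial>lborel)" for r
  have em2[measurable]: "(\<lambda>x. cell_err n (Suc j) (fst x) (snd x) \<omega>) \<in> borel_measurable (borel \<Otimes>\<^sub>M lborel)"
    by (rule cell_err_section_measurable[OF w]) auto
  have em[measurable]: "(\<lambda>u. cell_err n (Suc j) r u \<omega>) \<in> borel_measurable borel" for r
    by (rule cell_err_section_measurable[OF w]) auto
  have Fm: "F \<in> borel_measurable borel"
    unfolding F_def[abs_def] by (rule lborel.borel_measurable_nn_integral) (use em2 in \<open>simp add: case_prod_beta'\<close>)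
  have "(\<integral>\<^sup>+r. indicator {0..<1} r * F r \<partial>lborel) = (\<integral>\<^sup>+r. F r * indicator {g ?a..g ?b} r \<partial>lborel)"
  proof (rule nn_integral_cong_AE)
    have "AE r in lborel. r \<noteq> (1::real)" by (rule AE_lborel_singleton)
    then show "AE r in lborel. indicator {0..<1} r * F r = F r * indicator {g ?a..g ?b} r"
      unfolding ga by eventually_elim (auto simp: indicator_def)
  qed
  also have "\<dots> = (\<integral>\<^sup>+y. F (g y) * ennreal (dphi y / d) * indicator {?a..?b} y \<partial>lborel)"
  proof (rule nn_integral_substitution_aux[OF Fm _ _ _ _ ab(2)])
    show "(g has_real_derivative dphi y / d) (at y)" if "y \<in> {?a..?b}" for y
      unfolding g_def using that ab d by (auto intro!: derivative_eq_intros phi_deriv)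
    show "continuous_on {?a..?b} (\<lambda>y. dphi y / d)"
      unfolding dphi_def using ab d by (intro continuous_intros) auto
    show "0 \<le> dphi y / d" if "y \<in> {?a..?b}" for y using that ab d dphi_pos[of y] by simp
  qed simp
  finally have 1: "cell_mean n (Suc j) \<omega> = ennreal C * (\<integral>\<^sup>+y. F (g y) * ennreal (dphi y / d) * indicator {?a..?b} y \<partial>lborel)"
    unfolding cell_mean_def C_def F_def by simp
  have gm: "g \<in> borel_measurable borel" unfolding g_def by measurable
  have Fgm: "(\<lambda>y. F (g y)) \<in> borel_measurable borel" by (rule measurable_compose[OF gm Fm])
  have 2: "F r = (\<integral>\<^sup>+z. ennreal (cell_err n (Suc j) r (phi z) \<omega>) * ennreal (dphi z) * indicator {0..beta} z \<partial>lborel)" for r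
  proof -
    have "F r = (\<integral>\<^sup>+u. ennreal (cell_err n (Suc j) r u \<omega>) * indicator {phi 0..phi beta} u \<partial>lborel)"
      unfolding F_def by (simp add: phi_beta mult.commute)
    also have "\<dots> = (\<integral>\<^sup>+z. ennreal (cell_err n (Suc j) r (phi z) \<omega>) * ennreal (dphi z) * indicator {0..beta} z \<partial>lborel)"
    proof (rule nn_integral_substitution_aux)
      show "(phi has_real_derivative dphi y) (at y)" if "y \<in> {0..beta}" for y
        using that beta_range by (intro phi_deriv) auto
      show "continuous_on {0..beta} dphi"
        unfolding dphi_def[abs_def] using beta_range by (intro continuous_intros) auto
      show "0 \<le> dphi y" if "y \<in> {0..beta}" for y using that beta_range dphi_pos[of y] by simp
    qed (use beta_range in auto)
    finally show ?thesis .
  qed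
  have "ennreal C * (F (g y) * ennreal (dphi y / d) * indicator {?a..?b} y)
    = indicator {?a..?b} y * (\<integral>\<^sup>+z. indicator {0..beta} z * ennreal (C * (dphi y / d) * dphi z * cell_err n (Suc j) (g y) (phi z) \<omega>) \<partial>lborel)" for y
  proof (cases "y \<in> {?a..?b}")
    case True
    then have y: "0 \<le> dphi y / d" using ab d dphi_pos[of y] by simp
    have zm: "(\<lambda>z. ennreal (cell_err n (Suc j) (g y) (phi z) \<omega>) * ennreal (dphi z) * indicator {0..beta} z) \<in> borel_measurable lborel"
      using measurable_compose[OF phi_measurable em[of "g y"]] by measurable
    have "ennreal C * (F (g y) * ennreal (dphi y / d)) = ennreal (C * (dphi y / d)) * F (g y)"
      unfolding ennreal_mult[OF C y] by (simp only: mult.assoc mult.commute[of "F (g y)"])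
    also have "\<dots> = (\<integral>\<^sup>+z. ennreal (C * (dphi y / d)) * (ennreal (cell_err n (Suc j) (g y) (phi z) \<omega>) * ennreal (dphi z) * indicator {0..beta} z) \<partial>lborel)"
      unfolding 2 by (rule nn_integral_cmult[OF zm, symmetric])
    also have "\<dots> = (\<integral>\<^sup>+z. indicator {0..beta} z * ennreal (C * (dphi y / d) * dphi z * cell_err n (Suc j) (g y) (phi z) \<omega>) \<partial>lborel)"
    proof (rule nn_integral_cong)
      fix z
      show "ennreal (C * (dphi y / d)) * (ennreal (cell_err n (Suc j) (g y) (phi z) \<omega>) * ennreal (dphi z) * indicator {0..beta} z)
        = indicator {0..beta} z * ennreal (C * (dphi y / d) * dphi z * cell_err n (Suc j) (g y) (phi z) \<omega>)"
      proof (cases "z \<in> {0..beta}")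
        case True
        then have "0 \<le> dphi z" using beta_range dphi_pos[of z] by simp
        moreover have "0 \<le> C * (dphi y / d)" using C y by (rule mult_nonneg_nonneg)
        ultimately show ?thesis using True cell_err_nonneg[of n "Suc j" "g y" "phi z" \<omega>]
          by (simp add: ennreal_mult[symmetric] mult.assoc mult.commute[of "dphi z"])
      qed simp
    qed
    finally show ?thesis using True by simp
  qed simp
  moreover have "ennreal C * (\<integral>\<^sup>+y. F (g y) * ennreal (dphi y / d) * indicator {?a..?b} y \<partial>lborel)
    = (\<integral>\<^sup>+y. ennreal C * (F (g y) * ennreal (dphi y / d) * indicator {?a..?b} y) \<partial>lborel)"
    by (rule nn_integral_cmult[symmetric]) (use Fgm in measurable)
  ultimately show ?thesis unfolding 1 C_def[symmetric] by simp
qed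

section \<open>Comparison with the averages\<close>

context
  fixes n :: nat and c \<eta> :: real
  assumes n: "0 < n" and c: "c < 1" "beta + 4 / real n \<le> c" and eta: "0 < \<eta>" "\<eta> < 1"
    and ratio: "\<And>x y. 0 \<le> x \<Longrightarrow> x \<le> c \<Longrightarrow> 0 \<le> y \<Longrightarrow> y \<le> c \<Longrightarrow> \<bar>x - y\<bar> \<le> 4 / real n \<Longrightarrow> dphi x \<le> (1 + \<eta>) * dphi y"
begin

context
  fixes j :: nat and y :: real
  assumes j: "j < n" "real j / real n < beta" and y: "real j / real n \<le> y" "y \<le> real (Suc j) / real n"
begin

text \<open>Here g is the offset that puts the shifted node at phi(y). The distance to the next
  shifted node is a convex combination of two neighbouring node distances, each equal to 1/n times a
  value of \<open>dphi\<close>, while phi(z) - phi(y) is z - y times another such value. All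
  arguments lie within 4/n of each other, so \<open>ratio\<close> compares the values and confines
  the last admissible z to a window around y + 1/n.\<close>

lemma cell_geometry:
  defines "d \<equiv> node n (Suc j) - node n j"
  defines "g \<equiv> (phi y - node n j) / d"
  shows "Suc j < n" and "0 < d"
    and "net n g (Suc j) = phi y"
    and "\<lbrakk>y < z; z \<le> beta; phi z \<le> net n g (Suc (Suc j))\<rbrakk> \<Longrightarrow> z < y + (1 + 2 * \<eta>) / real n"
    and "\<lbrakk>y < z; z \<le> beta; z < y + (1 - \<eta>) / real n\<rbrakk> \<Longrightarrow> phi z \<le> net n g (Suc (Suc j))"
    and "1 - \<eta> \<le> dphi y / (real n * d)" and "dphi y / (real n * d) \<le> 1 + \<eta>"
proof -
  define h where "h = 1 / real n"
  define a where "a = real j / real n"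
  have h: "0 < h" using n by (simp add: h_def)
  have a1: "real (Suc j) / real n = a + h" and a2: "real (Suc (Suc j)) / real n = a + 2 * h"
    by (simp_all add: a_def h_def add_divide_distrib)
  have h4: "4 / real n = 4 * h" by (simp add: h_def)
  have a: "0 \<le> a" "a < beta" "a + 4 * h \<le> c" using j c by (simp_all add: a_def h_def)
  have ya: "a \<le> y" "y \<le> a + h" using y unfolding a_def[symmetric] a1 by simp_all
  have y01: "0 \<le> y" "y \<le> c" using ya a h by linarith+
  have "a + h < 1" using a h c by linarith
  then show jn: "Suc j < n" using n unfolding a1[symmetric] by (simp add: divide_less_eq)
  have nodes: "node n j = phi a" "node n (Suc j) = phi (a + h)" "node n (Suc (Suc j)) = phi (a + 2 * h)"
    unfolding node_def a1 a2 a_def by simp_all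
  obtain \<xi> where xi: "a < \<xi>" "\<xi> < a + h" "d = h * dphi \<xi>"
    using phi_mean_value[of a "a + h"] a h c unfolding d_def nodes by auto
  define d2 where "d2 = node n (Suc (Suc j)) - node n (Suc j)"
  obtain \<xi>' where xi': "a + h < \<xi>'" "\<xi>' < a + 2 * h" "d2 = h * dphi \<xi>'"
    using phi_mean_value[of "a + h" "a + 2 * h"] a h c unfolding d2_def nodes by auto
  show d: "0 < d" unfolding xi(3) using h xi a c by (intro mult_pos_pos dphi_pos) auto
  have phiy: "phi a \<le> phi y" "phi y \<le> phi (a + h)" using ya a h c by (auto intro!: phi_mono)
  have g: "0 \<le> g" "g \<le> 1" using phiy d by (simp_all add: g_def nodes d_def)
  have gd: "g * d = phi y - node n j" using d by (simp add: g_def)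
  show netj: "net n g (Suc j) = phi y"
    unfolding net_Suc[OF j(1)] d_def[symmetric] gd by simp
  \<comment> \<open>The node distances d and d2 of the two adjacent cells are weighted by 1 - g and
    g, so no bound on g beyond 0 \<le> g \<le> 1 is needed.\<close>
  have netSj: "net n g (Suc (Suc j)) - phi y = (1 - g) * d + g * d2"
  proof -
    have "phi y = node n j + g * d" using gd by simp
    then show ?thesis unfolding net_Suc[OF jn] d2_def[symmetric] by (simp add: d_def algebra_simps)
  qed
  show "z < y + (1 + 2 * \<eta>) / real n" if z: "y < z" "z \<le> beta" "phi z \<le> net n g (Suc (Suc j))"
  proof (rule ccontr)
    assume "\<not> z < y + (1 + 2 * \<eta>) / real n"
    then have zz: "y + (1 + 2 * \<eta>) * h \<le> z" by (simp add: h_def)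
    \<comment> \<open>The point z may be far from y, beyond the reach of \<open>ratio\<close>, so
      the argument uses the nearer x. The width 1 + 2 \<eta> exceeds the factor 1 + \<eta> lost in
      \<open>ratio\<close>, which yields a strict contradiction.\<close>
    define x where "x = y + (1 + 2 * \<eta>) * h"
    have "(1 + 2 * \<eta>) * h < 3 * h" using eta h by (intro mult_strict_right_mono) auto
    then have x: "y < x" "x \<le> z" "x < y + 3 * h" using zz eta h by (auto simp: x_def)
    obtain \<zeta> where zeta: "y < \<zeta>" "\<zeta> < x" "phi x - phi y = (x - y) * dphi \<zeta>"
      using phi_mean_value[OF x(1)] x z beta_range by auto
    have "0 \<le> 4 / real n" by simp
    then have "beta \<le> c" using c(2) by linarith
    then have zc: "0 \<le> \<zeta>" "\<zeta> \<le> c" using zeta x z y01 by linarith+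
    have r1: "dphi \<xi> \<le> (1 + \<eta>) * dphi \<zeta>"
      by (rule ratio) (use zc xi zeta x ya a h in \<open>auto simp: h4 abs_le_iff\<close>)
    have r2: "dphi \<xi>' \<le> (1 + \<eta>) * dphi \<zeta>"
      by (rule ratio) (use zc xi' zeta x ya a h in \<open>auto simp: h4 abs_le_iff\<close>)
    have dz: "0 < dphi \<zeta>" using zc c by (intro dphi_pos) auto
    have "phi x \<le> phi z" using x z beta_range by (intro phi_mono) auto
    then have "(1 + 2 * \<eta>) * h * dphi \<zeta> \<le> (1 - g) * d + g * d2"
      using zeta(3) z(3) netSj by (simp add: x_def)
    also have "\<dots> \<le> (1 - g) * (h * ((1 + \<eta>) * dphi \<zeta>)) + g * (h * ((1 + \<eta>) * dphi \<zeta>))"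
      unfolding xi(3) xi'(3) using g h r1 r2 by (intro add_mono mult_left_mono) auto
    also have "\<dots> = (1 + \<eta>) * h * dphi \<zeta>" by (simp add: algebra_simps)
    finally have "\<eta> * (h * dphi \<zeta>) \<le> 0" by (simp add: algebra_simps)
    moreover have "0 < \<eta> * (h * dphi \<zeta>)" using eta h dz by simp
    ultimately show False by linarith
  qed
  show "phi z \<le> net n g (Suc (Suc j))" if z: "y < z" "z \<le> beta" "z < y + (1 - \<eta>) / real n"
  proof -
    have zh: "z - y \<le> (1 - \<eta>) * h" using z(3) by (simp add: h_def)
    have "(1 - \<eta>) * h \<le> 1 * h" using eta h by (intro mult_right_mono) auto
    then have zh1: "z \<le> y + h" using zh by simp
    obtain \<zeta> where zeta: "y < \<zeta>" "\<zeta> < z" "phi z - phi y = (z - y) * dphi \<zeta>"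
      using phi_mean_value[OF z(1)] z beta_range by auto
    have zc: "0 \<le> \<zeta>" "\<zeta> \<le> c" using zeta z y01 a h c zh1 ya by auto
    have dz: "0 < dphi \<zeta>" using zc c by (intro dphi_pos) auto
    \<comment> \<open>Since (1 - \<eta>) (1 + \<eta>) \<le> 1, the loss in \<open>ratio\<close> is
      absorbed by the width 1 - \<eta>.\<close>
    have shrink: "(1 - \<eta>) * dphi \<zeta> \<le> dphi x" if "dphi \<zeta> \<le> (1 + \<eta>) * dphi x" "0 \<le> dphi x" for x
    proof -
      have "(1 - \<eta>) * dphi \<zeta> \<le> (1 - \<eta>) * ((1 + \<eta>) * dphi x)" using that eta by (intro mult_left_mono) auto
      also have "\<dots> = dphi x - \<eta> * \<eta> * dphi x" by (simp add: algebra_simps)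
      also have "\<dots> \<le> dphi x" using that by simp
      finally show ?thesis .
    qed
    have r1: "(1 - \<eta>) * dphi \<zeta> \<le> dphi \<xi>"
    proof (rule shrink)
      show "dphi \<zeta> \<le> (1 + \<eta>) * dphi \<xi>"
        by (rule ratio) (use zc xi zeta zh1 ya a h in \<open>auto simp: h4 abs_le_iff\<close>)
      show "0 \<le> dphi \<xi>" using xi a h c by (intro less_imp_le dphi_pos) auto
    qed
    have r2: "(1 - \<eta>) * dphi \<zeta> \<le> dphi \<xi>'"
    proof (rule shrink)
      show "dphi \<zeta> \<le> (1 + \<eta>) * dphi \<xi>'"
        by (rule ratio) (use zc xi' zeta zh1 ya a h in \<open>auto simp: h4 abs_le_iff\<close>)
      show "0 \<le> dphi \<xi>'" using xi' a h c by (intro less_imp_le dphi_pos) auto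
    qed
    have "phi z - phi y \<le> (1 - \<eta>) * h * dphi \<zeta>"
      unfolding zeta(3) using zh dz by (intro mult_right_mono) auto
    also have "\<dots> = (1 - g) * (h * ((1 - \<eta>) * dphi \<zeta>)) + g * (h * ((1 - \<eta>) * dphi \<zeta>))"
      by (simp add: algebra_simps)
    also have "\<dots> \<le> (1 - g) * d + g * d2"
      unfolding xi(3) xi'(3) using g h r1 r2 by (intro add_mono mult_left_mono) auto
    finally show ?thesis using netSj by simp
  qed
  have nd: "real n * d = dphi \<xi>" unfolding xi(3) h_def using n by simp
  have pos: "0 < dphi \<xi>" "0 < dphi y" using xi a h c y01 by (auto intro!: dphi_pos)
  have up: "dphi y \<le> (1 + \<eta>) * dphi \<xi>"
    by (rule ratio) (use y01 xi ya a h in \<open>auto simp: h4 abs_le_iff\<close>)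
  then show "dphi y / (real n * d) \<le> 1 + \<eta>" unfolding nd using pos by (simp add: pos_divide_le_eq)
  have lo: "dphi \<xi> \<le> (1 + \<eta>) * dphi y"
    by (rule ratio) (use y01 xi ya a h in \<open>auto simp: h4 abs_le_iff\<close>)
  have "(1 - \<eta>) * dphi \<xi> \<le> (1 - \<eta>) * ((1 + \<eta>) * dphi y)" using lo eta by (intro mult_left_mono) auto
  also have "\<dots> = dphi y - \<eta> * \<eta> * dphi y" by (simp add: algebra_simps)
  also have "\<dots> \<le> dphi y" using pos by simp
  finally show "1 - \<eta> \<le> dphi y / (real n * d)" unfolding nd using pos by (simp add: pos_le_divide_eq)
qed

text \<open>By \<open>w_phi\<close> the coefficient equals 2 n^2 R w(phi(z))^2 with R = dphi y / (n
  d), and \<open>cell_geometry\<close> bounds both R and the range of z on which the error is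
  active.\<close>

lemma cell_density_bounds:
  defines "d \<equiv> node n (Suc j) - node n j"
  defines "g \<equiv> (phi y - node n j) / d"
  assumes z: "0 \<le> z" "z < beta"
  shows "2 * \<theta> * real n / T * (dphi y / d) * dphi z * cell_err n (Suc j) g (phi z) \<omega>
      \<le> (1 + \<eta>) * 2 * (real n)\<^sup>2 * (if 0 \<le> y \<and> y < z \<and> z < y + (1 + 2 * \<eta>) / real n \<and> z < beta then G y z \<omega> else 0)"
    and "(1 - \<eta>) * 2 * (real n)\<^sup>2 * (if 0 \<le> y \<and> y < z \<and> z < y + (1 - \<eta>) / real n \<and> z < beta then G y z \<omega> else 0)
      \<le> 2 * \<theta> * real n / T * (dphi y / d) * dphi z * cell_err n (Suc j) g (phi z) \<omega>"
proof -
  note geo = cell_geometry[folded d_def, folded g_def]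
  have y0: "0 \<le> y" by (rule order_trans[OF _ y(1)]) simp
  have y1: "y < 1"
  proof -
    have "real (Suc j) / real n < 1" using geo(1) by simp
    then show ?thesis using y(2) by linarith
  qed
  have z1: "z < 1" using z beta_range by simp
  define R where "R = dphi y / (real n * d)"
  have Rb: "1 - \<eta> \<le> R" "R \<le> 1 + \<eta>" using geo(6,7) unfolding R_def by auto
  define S where "S = (Lz (phi z) \<omega> - Lz (phi y) \<omega>)\<^sup>2"
  have S: "0 \<le> S" by (simp add: S_def)
  have coef: "2 * \<theta> * real n / T * (dphi y / d) * dphi z = 2 * (real n)\<^sup>2 * R * (w (phi z))\<^sup>2"
    unfolding w_phi[OF z1] R_def using n geo(2) T_pos by (simp add: power2_eq_square field_simps)
  have err: "cell_err n (Suc j) g (phi z) \<omega> = (if y < z \<and> phi z \<le> net n g (Suc (Suc j)) then S else 0)"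
    unfolding cell_err_def geo(3) S_def using phi_less_iff[of y z] y1 z1 by simp
  have G: "G y z \<omega> = (w (phi z))\<^sup>2 * S" by (simp add: G_def S_def)
  have wS: "0 \<le> 2 * (real n)\<^sup>2 * ((w (phi z))\<^sup>2 * S)" using S by simp
  have up: "2 * (real n)\<^sup>2 * R * (w (phi z))\<^sup>2 * S \<le> (1 + \<eta>) * 2 * (real n)\<^sup>2 * ((w (phi z))\<^sup>2 * S)"
    using mult_right_mono[OF Rb(2) wS] by (simp only: ac_simps)
  have lo: "(1 - \<eta>) * 2 * (real n)\<^sup>2 * ((w (phi z))\<^sup>2 * S) \<le> 2 * (real n)\<^sup>2 * R * (w (phi z))\<^sup>2 * S"
    using mult_right_mono[OF Rb(1) wS] by (simp only: ac_simps)
  have nn: "0 \<le> (1 + \<eta>) * 2 * (real n)\<^sup>2 * ((w (phi z))\<^sup>2 * S)" "0 \<le> 2 * (real n)\<^sup>2 * R * (w (phi z))\<^sup>2 * S"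
    using S eta Rb by auto
  show "2 * \<theta> * real n / T * (dphi y / d) * dphi z * cell_err n (Suc j) g (phi z) \<omega>
      \<le> (1 + \<eta>) * 2 * (real n)\<^sup>2 * (if 0 \<le> y \<and> y < z \<and> z < y + (1 + 2 * \<eta>) / real n \<and> z < beta then G y z \<omega> else 0)"
  proof (cases "y < z \<and> phi z \<le> net n g (Suc (Suc j))")
    case True
    then have "z < y + (1 + 2 * \<eta>) / real n" using geo(4)[of z] z by auto
    then show ?thesis unfolding coef err G using True up y0 z by simp
  qed (use eta S in \<open>auto simp: err G\<close>)
  show "(1 - \<eta>) * 2 * (real n)\<^sup>2 * (if 0 \<le> y \<and> y < z \<and> z < y + (1 - \<eta>) / real n \<and> z < beta then G y z \<omega> else 0)
      \<le> 2 * \<theta> * real n / T * (dphi y / d) * dphi z * cell_err n (Suc j) g (phi z) \<omega>"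
  proof (cases "0 \<le> y \<and> y < z \<and> z < y + (1 - \<eta>) / real n \<and> z < beta")
    case True
    then have "phi z \<le> net n g (Suc (Suc j))" using geo(5)[of z] by auto
    then show ?thesis unfolding coef err G using True lo by simp
  next
    case False
    have "0 \<le> R" using Rb eta by linarith
    then show ?thesis unfolding coef err if_not_P[OF False] mult_zero_right
      using S by (intro mult_nonneg_nonneg) auto
  qed
qed

end

text \<open>For cells that start before beta the density bounds are integrated, up to the null sets
  where y is the right end or z = beta. For later cells all three quantities vanish.\<close>

lemma cell_mean_bounds:
  assumes j: "j < n" and w: "\<omega> \<in> space M"
  shows "cell_mean n (Suc j) \<omega> \<le> ennreal ((1 + \<eta>) * 2 * (real n)\<^sup>2) *
      (\<integral>\<^sup>+y. indicator {real j / real n..<real (Suc j) / real n} y * diagonal_section ((1 + 2 * \<eta>) / real n) y \<omega> \<partial>lborel)"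
    and "ennreal ((1 - \<eta>) * 2 * (real n)\<^sup>2) *
      (\<integral>\<^sup>+y. indicator {real j / real n..<real (Suc j) / real n} y * diagonal_section ((1 - \<eta>) / real n) y \<omega> \<partial>lborel)
      \<le> cell_mean n (Suc j) \<omega>"
proof -
  let ?a = "real j / real n" and ?b = "real (Suc j) / real n"
  have m: "(\<lambda>y. indicator {?a..<?b} y * diagonal_section h y \<omega>) \<in> borel_measurable lborel" for h
    using diagonal_section_measurable[OF w, of h] by simp
  define I where "I h y z = (if 0 \<le> y \<and> y < z \<and> z < y + h \<and> z < beta then G y z \<omega> else 0)" for h y z
  have ds: "diagonal_section h y \<omega> = (\<integral>\<^sup>+z. ennreal (I h y z) \<partial>lborel)" for h y
    unfolding diagonal_section_def I_def by (intro nn_integral_cong) simp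
  have I0: "0 \<le> I h y z" for h y z by (simp add: I_def G_nonneg)
  have Im: "(\<lambda>z. ennreal (I h y z)) \<in> borel_measurable lborel" for h y
  proof -
    have "(\<lambda>z. G y z \<omega>) \<in> borel_measurable borel" by (rule G_section_measurable[OF w]) auto
    then show ?thesis unfolding I_def by measurable
  qed
  have k: "0 \<le> (1 + \<eta>) * 2 * (real n)\<^sup>2" "0 \<le> (1 - \<eta>) * 2 * (real n)\<^sup>2" using eta by auto
  have Iout: "I h y z = 0" if "z \<notin> {0..beta}" for h y z using that by (auto simp: I_def)
  have "cell_mean n (Suc j) \<omega> \<le> ennreal ((1 + \<eta>) * 2 * (real n)\<^sup>2) *
      (\<integral>\<^sup>+y. indicator {?a..<?b} y * diagonal_section ((1 + 2 * \<eta>) / real n) y \<omega> \<partial>lborel) \<and>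
    ennreal ((1 - \<eta>) * 2 * (real n)\<^sup>2) *
      (\<integral>\<^sup>+y. indicator {?a..<?b} y * diagonal_section ((1 - \<eta>) / real n) y \<omega> \<partial>lborel) \<le> cell_mean n (Suc j) \<omega>"
  proof (cases "?a < beta")
    case False
    then have "beta \<le> ?a" by simp
    from late_cell_mean[OF j this] have "cell_mean n (Suc j) \<omega> = 0" .
    moreover have z: "indicator {?a..<?b} y * diagonal_section h y \<omega> = 0" for h y
      using False diagonal_section_eq_0[of y h \<omega>] by (auto simp: indicator_def)
    ultimately show ?thesis unfolding z by simp
  next
    case True
    \<comment> \<open>\<open>cell_geometry\<close> carries a position y; the left end of the cell is
      inserted because this conclusion does not involve y.\<close>
    have jn: "Suc j < n"
      by (rule cell_geometry(1)[OF j True, of ?a]) (auto simp: divide_right_mono)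
    define d where "d = node n (Suc j) - node n j"
    define K where "K y z = 2 * \<theta> * real n / T * (dphi y / d) * dphi z * cell_err n (Suc j) ((phi y - node n j) / d) (phi z) \<omega>" for y z
    have cm: "cell_mean n (Suc j) \<omega> = (\<integral>\<^sup>+y. indicator {?a..?b} y * (\<integral>\<^sup>+z. indicator {0..beta} z * ennreal (K y z) \<partial>lborel) \<partial>lborel)"
      unfolding K_def d_def by (rule cell_mean_substitution[OF jn w])
    have Kb: "K y z \<le> (1 + \<eta>) * 2 * (real n)\<^sup>2 * I ((1 + 2 * \<eta>) / real n) y z"
      "(1 - \<eta>) * 2 * (real n)\<^sup>2 * I ((1 - \<eta>) / real n) y z \<le> K y z"
      if "y \<in> {?a..?b}" "0 \<le> z" "z < beta" for y z
      unfolding K_def I_def d_def using cell_density_bounds[OF j True, of y z \<omega>] that by auto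
    have zae: "AE z in lborel. z \<noteq> beta" by (rule AE_lborel_singleton)
    have yae: "AE y in lborel. y \<noteq> ?b" by (rule AE_lborel_singleton)
    have inner_up: "(\<integral>\<^sup>+z. indicator {0..beta} z * ennreal (K y z) \<partial>lborel)
      \<le> ennreal ((1 + \<eta>) * 2 * (real n)\<^sup>2) * diagonal_section ((1 + 2 * \<eta>) / real n) y \<omega>" if y: "y \<in> {?a..?b}" for y
    proof -
      have "(\<integral>\<^sup>+z. indicator {0..beta} z * ennreal (K y z) \<partial>lborel)
        \<le> (\<integral>\<^sup>+z. ennreal ((1 + \<eta>) * 2 * (real n)\<^sup>2) * ennreal (I ((1 + 2 * \<eta>) / real n) y z) \<partial>lborel)"
      proof (rule nn_integral_mono_AE)
        show "AE z in lborel. indicator {0..beta} z * ennreal (K y z) \<le> ennreal ((1 + \<eta>) * 2 * (real n)\<^sup>2) * ennreal (I ((1 + 2 * \<eta>) / real n) y z)"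
          using zae
        proof eventually_elim
          case (elim z)
          show ?case
          proof (cases "z \<in> {0..beta}")
            case True
            then have "ennreal (K y z) \<le> ennreal ((1 + \<eta>) * 2 * (real n)\<^sup>2 * I ((1 + 2 * \<eta>) / real n) y z)"
              using elim by (intro ennreal_leI Kb(1)[OF y]) auto
            then show ?thesis using True by (simp only: ennreal_mult[OF k(1) I0] indicator_simps(1) mult_1)
          qed simp
        qed
      qed
      also have "\<dots> = ennreal ((1 + \<eta>) * 2 * (real n)\<^sup>2) * diagonal_section ((1 + 2 * \<eta>) / real n) y \<omega>"
        unfolding ds by (rule nn_integral_cmult[OF Im])
      finally show ?thesis .
    qed
    have inner_lo: "ennreal ((1 - \<eta>) * 2 * (real n)\<^sup>2) * diagonal_section ((1 - \<eta>) / real n) y \<omega>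
      \<le> (\<integral>\<^sup>+z. indicator {0..beta} z * ennreal (K y z) \<partial>lborel)" if y: "y \<in> {?a..?b}" for y
    proof -
      have "ennreal ((1 - \<eta>) * 2 * (real n)\<^sup>2) * diagonal_section ((1 - \<eta>) / real n) y \<omega>
        = (\<integral>\<^sup>+z. ennreal ((1 - \<eta>) * 2 * (real n)\<^sup>2) * ennreal (I ((1 - \<eta>) / real n) y z) \<partial>lborel)"
        unfolding ds by (rule nn_integral_cmult[OF Im, symmetric])
      also have "\<dots> \<le> (\<integral>\<^sup>+z. indicator {0..beta} z * ennreal (K y z) \<partial>lborel)"
      proof (rule nn_integral_mono_AE)
        show "AE z in lborel. ennreal ((1 - \<eta>) * 2 * (real n)\<^sup>2) * ennreal (I ((1 - \<eta>) / real n) y z) \<le> indicator {0..beta} z * ennreal (K y z)"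
          using zae
        proof eventually_elim
          case (elim z)
          show ?case
          proof (cases "z \<in> {0..beta}")
            case True
            then have "ennreal ((1 - \<eta>) * 2 * (real n)\<^sup>2 * I ((1 - \<eta>) / real n) y z) \<le> ennreal (K y z)"
              using elim by (intro ennreal_leI Kb(2)[OF y]) auto
            then show ?thesis using True by (simp only: ennreal_mult[OF k(2) I0] indicator_simps(1) mult_1)
          qed (simp add: Iout)
        qed
      qed
      finally show ?thesis .
    qed
    have "cell_mean n (Suc j) \<omega> \<le> (\<integral>\<^sup>+y. ennreal ((1 + \<eta>) * 2 * (real n)\<^sup>2) * (indicator {?a..<?b} y * diagonal_section ((1 + 2 * \<eta>) / real n) y \<omega>) \<partial>lborel)"
      unfolding cm
    proof (rule nn_integral_mono_AE)
      show "AE y in lborel. indicator {?a..?b} y * (\<integral>\<^sup>+z. indicator {0..beta} z * ennreal (K y z) \<partial>lborel)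
        \<le> ennreal ((1 + \<eta>) * 2 * (real n)\<^sup>2) * (indicator {?a..<?b} y * diagonal_section ((1 + 2 * \<eta>) / real n) y \<omega>)"
        using yae
      proof eventually_elim
        case (elim y)
        show ?case
        proof (cases "y \<in> {?a..?b}")
          case True
          then have "y \<in> {?a..<?b}" using elim by auto
          then show ?thesis using inner_up[OF True] True by (simp only: indicator_simps(1) mult_1)
        qed simp
      qed
    qed
    also have "\<dots> = ennreal ((1 + \<eta>) * 2 * (real n)\<^sup>2) * (\<integral>\<^sup>+y. indicator {?a..<?b} y * diagonal_section ((1 + 2 * \<eta>) / real n) y \<omega> \<partial>lborel)"
      by (rule nn_integral_cmult[OF m])
    finally have U: "cell_mean n (Suc j) \<omega> \<le> \<dots>" .
    have "ennreal ((1 - \<eta>) * 2 * (real n)\<^sup>2) * (\<integral>\<^sup>+y. indicator {?a..<?b} y * diagonal_section ((1 - \<eta>) / real n) y \<omega> \<partial>lborel)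
      = (\<integral>\<^sup>+y. ennreal ((1 - \<eta>) * 2 * (real n)\<^sup>2) * (indicator {?a..<?b} y * diagonal_section ((1 - \<eta>) / real n) y \<omega>) \<partial>lborel)"
      by (rule nn_integral_cmult[OF m, symmetric])
    also have "\<dots> \<le> cell_mean n (Suc j) \<omega>"
      unfolding cm
    proof (rule nn_integral_mono)
      fix y
      show "ennreal ((1 - \<eta>) * 2 * (real n)\<^sup>2) * (indicator {?a..<?b} y * diagonal_section ((1 - \<eta>) / real n) y \<omega>)
        \<le> indicator {?a..?b} y * (\<integral>\<^sup>+z. indicator {0..beta} z * ennreal (K y z) \<partial>lborel)"
      proof (cases "y \<in> {?a..<?b}")
        case True
        then have y: "y \<in> {?a..?b}" by auto
        show ?thesis using inner_lo[OF y] True y by (simp only: indicator_simps(1) mult_1)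
      qed simp
    qed
    finally show ?thesis using U by blast
  qed
  then show "cell_mean n (Suc j) \<omega> \<le> ennreal ((1 + \<eta>) * 2 * (real n)\<^sup>2) *
      (\<integral>\<^sup>+y. indicator {?a..<?b} y * diagonal_section ((1 + 2 * \<eta>) / real n) y \<omega> \<partial>lborel)"
    and "ennreal ((1 - \<eta>) * 2 * (real n)\<^sup>2) *
      (\<integral>\<^sup>+y. indicator {?a..<?b} y * diagonal_section ((1 - \<eta>) / real n) y \<omega> \<partial>lborel) \<le> cell_mean n (Suc j) \<omega>"
    by blast+
qed

text \<open>The cells tile [0, 1), which contains the range of y in the strip. The initial cell, of
  index 0, has no counterpart there and is left out.\<close>

lemma net_mean_sandwich:
  assumes w: "\<omega> \<in> space M"
  shows "(\<Sum>j<n. cell_mean n (Suc j) \<omega>) \<le> ennreal ((1 + \<eta>) * 2 * (real n)\<^sup>2) * diagonal_integral ((1 + 2 * \<eta>) / real n) \<omega>"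
    and "ennreal ((1 - \<eta>) * 2 * (real n)\<^sup>2) * diagonal_integral ((1 - \<eta>) / real n) \<omega> \<le> (\<Sum>j<n. cell_mean n (Suc j) \<omega>)"
  unfolding sum_diagonal_section[OF n w, symmetric] sum_distrib_left
  by (intro sum_mono cell_mean_bounds w; simp)+

end

text \<open>The factors (1 + 2 \<eta>)^2 and (1 - \<eta>)^2 come from passing between 2 n^2 and the
  normalising constants 2/h^2 of the two strips. For \<eta> \<le> 1/4 the upper factor is 1 + 5
  \<eta> + 8 \<eta>^2 + 4 \<eta>^3 \<le> 1 + 11 \<eta> and also at most 45/16 < 3, while the lower
  one lies between 1 - 11 \<eta> and 1.\<close>

lemma sandwich_arith:
  fixes \<eta> q A U V i :: real
  assumes eta: "0 < \<eta>" "\<eta> \<le> 1 / 4" and q: "0 \<le> q"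
    and A: "A \<le> i + (1 + \<eta>) * (1 + 2 * \<eta>)\<^sup>2 * U" "(1 - \<eta>) * (1 - \<eta>)\<^sup>2 * V \<le> A" and i: "0 \<le> i"
  shows "\<bar>A - q\<bar> \<le> i + 3 * \<bar>U - q\<bar> + \<bar>V - q\<bar> + 11 * \<eta> * q"
proof -
  define k1 k2 where "k1 = (1 + \<eta>) * (1 + 2 * \<eta>)\<^sup>2" and "k2 = (1 - \<eta>) * (1 - \<eta>)\<^sup>2"
  have e2: "\<eta>\<^sup>2 \<le> \<eta> * (1 / 4)" using eta unfolding power2_eq_square by (intro mult_left_mono) auto
  have "\<eta> * \<eta>\<^sup>2 \<le> \<eta> * 1" using eta e2 by (intro mult_left_mono) auto
  then have e3: "\<eta> ^ 3 \<le> \<eta>" "0 \<le> \<eta> ^ 3" using eta by (simp_all add: power3_eq_cube power2_eq_square)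
  have "k1 = 1 + 5 * \<eta> + 8 * \<eta>\<^sup>2 + 4 * \<eta> ^ 3"
    by (simp add: k1_def power2_eq_square power3_eq_cube algebra_simps)
  then have k1: "1 \<le> k1" "k1 \<le> 1 + 11 * \<eta>" using e2 e3 eta zero_le_power2[of \<eta>] by linarith+
  have "k1 \<le> (1 + 1 / 4) * (1 + 2 * (1 / 4))\<^sup>2"
    unfolding k1_def using eta by (intro mult_mono power_mono) auto
  then have k13: "k1 \<le> 3" by (simp add: power2_eq_square)
  have "k2 = 1 - 3 * \<eta> + 3 * \<eta>\<^sup>2 - \<eta> ^ 3"
    by (simp add: k2_def power2_eq_square power3_eq_cube algebra_simps)
  then have k2: "1 - 11 * \<eta> \<le> k2" using e3 eta zero_le_power2[of \<eta>] by linarith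
  have k20: "0 \<le> k2" using eta by (simp add: k2_def)
  have k21: "k2 \<le> 1" unfolding k2_def using eta by (intro mult_le_one power_le_one) auto
  have "k1 * (U - q) \<le> k1 * \<bar>U - q\<bar>" using k1 by (intro mult_left_mono) auto
  also have "\<dots> \<le> 3 * \<bar>U - q\<bar>" using k13 by (intro mult_right_mono) auto
  finally have "k1 * (U - q) \<le> 3 * \<bar>U - q\<bar>" .
  moreover have "(k1 - 1) * q \<le> 11 * \<eta> * q" using k1 q by (intro mult_right_mono) auto
  moreover have "k1 * U = k1 * (U - q) + (k1 - 1) * q + q" by (simp add: algebra_simps)
  ultimately have up: "A - q \<le> i + 3 * \<bar>U - q\<bar> + 11 * \<eta> * q" using A(1) unfolding k1_def[symmetric] by linarith
  have "k2 * (q - V) \<le> k2 * \<bar>V - q\<bar>" using k20 by (intro mult_left_mono) auto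
  also have "\<dots> \<le> 1 * \<bar>V - q\<bar>" using k21 by (intro mult_right_mono) auto
  finally have "k2 * (q - V) \<le> \<bar>V - q\<bar>" by simp
  moreover have "(1 - k2) * q \<le> 11 * \<eta> * q" using k2 q by (intro mult_right_mono) auto
  moreover have "q - k2 * V = k2 * (q - V) + (1 - k2) * q" by (simp add: algebra_simps)
  ultimately have lo: "q - A \<le> \<bar>V - q\<bar> + 11 * \<eta> * q" using A(2) unfolding k2_def[symmetric] by linarith
  have "A - q \<le> i + 3 * \<bar>U - q\<bar> + \<bar>V - q\<bar> + 11 * \<eta> * q" by (rule order_trans[OF up]) simp
  moreover have "q - A \<le> i + 3 * \<bar>U - q\<bar> + \<bar>V - q\<bar> + 11 * \<eta> * q" by (rule order_trans[OF lo]) (simp add: i)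
  ultimately show ?thesis by (simp only: abs_le_iff minus_diff_eq)
qed

text \<open>The error budget is \<epsilon>/8 for the initial cell, 3 \<epsilon>/20 and \<epsilon>/20
  for the two strip averages, and 11 \<epsilon>/80 for the mismatch of the factors, less than
  \<epsilon>/2 in total.\<close>

lemma net_mean_near_left_bracket:
  assumes e: "0 < \<epsilon>"
  shows "\<forall>\<^sub>F n in sequentially. (\<integral>\<omega>. \<bar>net_mean n \<omega> - Q_left b \<omega>\<bar> \<partial>M) < \<epsilon>"
proof -
  define q where "q = (\<integral>\<omega>. Q_left b \<omega> \<partial>M)"
  have q: "0 \<le> q" unfolding q_def by (rule integral_nonneg_AE) (use Q_left_nonneg[OF b] in auto)
  \<comment> \<open>The 1/4 is required by \<open>sandwich_arith\<close>; the other bound makes 11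
    \<eta> q small, with q + 1 in place of q to avoid division by 0.\<close>
  define \<eta> where "\<eta> = min (1 / 4) (\<epsilon> / (80 * (q + 1)))"
  have eta: "0 < \<eta>" "\<eta> \<le> 1 / 4" using e q by (simp_all only: \<eta>_def min.cobounded1) simp
  have "\<eta> * (80 * (q + 1)) \<le> \<epsilon>"
    using q by (subst pos_le_divide_eq[symmetric]) (auto simp: \<eta>_def)
  then have etaq: "11 * \<eta> * q \<le> 11 / 80 * \<epsilon>" using eta q by (simp add: algebra_simps)
  define c where "c = (1 + beta) / 2"
  have c: "0 < c" "c < 1" "beta < c" using beta_range by (simp_all add: c_def)
  obtain d where d: "0 < d" "\<And>x y. x \<in> {0..c} \<Longrightarrow> y \<in> {0..c} \<Longrightarrow> \<bar>x - y\<bar> < d \<Longrightarrow> dphi x \<le> (1 + \<eta>) * dphi y"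
    using dphi_ratio[OF c(1,2) eta(1)] by blast
  have e20: "0 < \<epsilon> / 20" and e16: "0 < \<epsilon> / 16" using e by auto
  obtain h0 where h0: "0 < h0" and avg: "\<And>h. 0 < h \<Longrightarrow> h \<le> h0 \<Longrightarrow>
    cell_average h \<in> borel_measurable M \<and>
    (\<integral>\<^sup>+\<omega>. ennreal \<bar>cell_average h \<omega> - Q_left b \<omega>\<bar> \<partial>M) \<le> ennreal (\<epsilon> / 20) \<and>
    (AE \<omega> in M. 0 \<le> cell_average h \<omega> \<and> ennreal (cell_average h \<omega>) = ennreal (2 / h\<^sup>2) * diagonal_integral h \<omega>)"
    using cell_average_near_left_bracket[OF e20] by blast
  obtain d2 where d2: "0 < d2" "\<And>t. 0 \<le> t \<Longrightarrow> t \<le> d2 \<Longrightarrow> energy t \<le> \<epsilon> / 16"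
    using energy_vanishes_at_0[OF e16] by blast
  \<comment> \<open>For 1/n < \<mu> the entries ensure, in order: cells that meet [0, beta) stay
    below c; the ratio of \<open>dphi\<close> is controlled at distance 4/n; both strip widths, at
    most 2/n, are below h0; and phi(1/n) \<le> d2.\<close>
  define \<mu> where "\<mu> = Min {(c - beta) / 4, d / 4, h0 / 2, d2 * \<theta> / T, 1}"
  have mu: "0 < \<mu>" using c d(1) h0 d2(1) th T_pos by (simp add: \<mu>_def)
  have mu_le: "\<mu> \<le> (c - beta) / 4" "\<mu> \<le> d / 4" "\<mu> \<le> h0 / 2" "\<mu> \<le> d2 * \<theta> / T" "\<mu> \<le> 1"
    unfolding \<mu>_def by (rule Min_le; simp)+
  have "(\<lambda>n. 1 / real n) \<longlonglongrightarrow> 0" by (rule lim_1_over_n)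
  from order_tendstoD(2)[OF this mu] have "\<forall>\<^sub>F n in sequentially. 1 / real n < \<mu> \<and> 2 \<le> n"
    using eventually_ge_at_top[of 2] by eventually_elim auto
  then show ?thesis
  proof eventually_elim
    case (elim n)
    then have n2: "2 \<le> n" and n0: "0 < n" and hmu: "1 / real n < \<mu>" by auto
    have cn: "beta + 4 / real n \<le> c" and dn: "4 / real n < d" using hmu mu_le by simp_all
    have ratio: "dphi x \<le> (1 + \<eta>) * dphi y"
      if "0 \<le> x" "x \<le> c" "0 \<le> y" "y \<le> c" "\<bar>x - y\<bar> \<le> 4 / real n" for x y
      using d(2)[of x y] that dn by auto
    have eta1: "\<eta> < 1" using eta by simp
    note sand = net_mean_sandwich[OF n0 c(2) cn eta(1) eta1 ratio]
    define h1 h2 where "h1 = (1 + 2 * \<eta>) / real n" and "h2 = (1 - \<eta>) / real n"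
    have hs: "0 < h1" "h1 \<le> h0" "0 < h2" "h2 \<le> h0"
    proof -
      have hn: "2 * (1 / real n) \<le> h0" using hmu mu_le by simp
      have "(1 + 2 * \<eta>) * (1 / real n) \<le> 2 * (1 / real n)" "(1 - \<eta>) * (1 / real n) \<le> 2 * (1 / real n)"
        using eta by (intro mult_right_mono; simp)+
      then show "h1 \<le> h0" "h2 \<le> h0" using hn by (simp_all add: h1_def h2_def)
      show "0 < h1" "0 < h2" using eta n0 by (simp_all add: h1_def h2_def)
    qed
    define U V where "U = cell_average h1" and "V = cell_average h2"
    have U: "U \<in> borel_measurable M" "(\<integral>\<^sup>+\<omega>. ennreal \<bar>U \<omega> - Q_left b \<omega>\<bar> \<partial>M) \<le> ennreal (\<epsilon> / 20)"
      "AE \<omega> in M. 0 \<le> U \<omega> \<and> ennreal (U \<omega>) = ennreal (2 / h1\<^sup>2) * diagonal_integral h1 \<omega>"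
      using avg[OF hs(1,2)] unfolding U_def by auto
    have V: "V \<in> borel_measurable M" "(\<integral>\<^sup>+\<omega>. ennreal \<bar>V \<omega> - Q_left b \<omega>\<bar> \<partial>M) \<le> ennreal (\<epsilon> / 20)"
      "AE \<omega> in M. 0 \<le> V \<omega> \<and> ennreal (V \<omega>) = ennreal (2 / h2\<^sup>2) * diagonal_integral h2 \<omega>"
      using avg[OF hs(3,4)] unfolding V_def by auto
    have first: "(\<integral>\<^sup>+\<omega>. cell_mean n 0 \<omega> \<partial>M) \<le> ennreal (\<epsilon> / 8)"
    proof -
      have "phi (1 / real n) - phi 0 \<le> (1 / real n - 0) * (T / \<theta>)"
        using n2 by (intro phi_lipschitz) auto
      also have "\<dots> \<le> (d2 * \<theta> / T) * (T / \<theta>)"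
        using hmu mu_le T_pos th by (intro mult_right_mono) auto
      also have "\<dots> = d2" using T_pos th by simp
      finally have "energy (phi (1 / real n)) \<le> \<epsilon> / 16"
        using phi_range[of "1 / real n"] n2 by (intro d2(2)) auto
      then have "ennreal (2 * energy (phi (1 / real n))) \<le> ennreal (\<epsilon> / 8)" by (intro ennreal_leI) simp
      then show ?thesis using first_cell_energy[OF n2] by (rule order_trans[rotated])
    qed
    \<comment> \<open>The strip widths satisfy n h1 = 1 + 2 \<eta> and n h2 = 1 - \<eta>.\<close>
    have scale1: "(1 + \<eta>) * 2 * (real n)\<^sup>2 = (1 + \<eta>) * (1 + 2 * \<eta>)\<^sup>2 * (2 / h1\<^sup>2)"
      and scale2: "(1 - \<eta>) * 2 * (real n)\<^sup>2 = (1 - \<eta>) * (1 - \<eta>)\<^sup>2 * (2 / h2\<^sup>2)"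
      using eta n0 by (simp_all add: h1_def h2_def power_divide)
    have kpos: "0 \<le> (1 + \<eta>) * (1 + 2 * \<eta>)\<^sup>2" "0 \<le> (1 - \<eta>) * (1 - \<eta>)\<^sup>2" using eta by auto
    have ae: "AE \<omega> in M. ennreal \<bar>net_mean n \<omega> - Q_left b \<omega>\<bar> \<le>
      cell_mean n 0 \<omega> + ennreal 3 * ennreal \<bar>U \<omega> - Q_left b \<omega>\<bar> + ennreal \<bar>V \<omega> - Q_left b \<omega>\<bar> + ennreal (11 * \<eta>) * ennreal (Q_left b \<omega>)"
      using net_mean_eq(2)[OF n0] U(3) V(3) AE_space
    proof eventually_elim
      case (elim \<omega>)
      note w = elim(4)
      let ?S = "\<Sum>j<n. cell_mean n (Suc j) \<omega>"
      have tot: "ennreal (net_mean n \<omega>) = cell_mean n 0 \<omega> + ?S"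
        using elim(1) unfolding sum.lessThan_Suc_shift by simp
      then have fin: "cell_mean n 0 \<omega> < top" "?S < top"
        by (metis ennreal_less_top ennreal_add_eq_top top.not_eq_extremum)+
      define i where "i = enn2real (cell_mean n 0 \<omega>)"
      have i: "0 \<le> i" "cell_mean n 0 \<omega> = ennreal i" using fin by (simp_all add: i_def)
      have Q0: "0 \<le> Q_left b \<omega>" by (rule Q_left_nonneg[OF b w])
      have Sup: "?S \<le> ennreal ((1 + \<eta>) * (1 + 2 * \<eta>)\<^sup>2 * U \<omega>)"
      proof -
        have "?S \<le> ennreal ((1 + \<eta>) * 2 * (real n)\<^sup>2) * diagonal_integral h1 \<omega>"
          unfolding h1_def by (rule sand(1)[OF _ _ _ _ _ w])
        also have "\<dots> = ennreal ((1 + \<eta>) * (1 + 2 * \<eta>)\<^sup>2) * (ennreal (2 / h1\<^sup>2) * diagonal_integral h1 \<omega>)"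
          unfolding scale1 using kpos(1) by (subst ennreal_mult) (simp_all add: mult.assoc)
        also have "\<dots> = ennreal ((1 + \<eta>) * (1 + 2 * \<eta>)\<^sup>2 * U \<omega>)"
          using elim(2) kpos(1) by (simp add: ennreal_mult)
        finally show ?thesis .
      qed
      have Slo: "ennreal ((1 - \<eta>) * (1 - \<eta>)\<^sup>2 * V \<omega>) \<le> ?S"
      proof -
        have "ennreal ((1 - \<eta>) * (1 - \<eta>)\<^sup>2 * V \<omega>) = ennreal ((1 - \<eta>) * (1 - \<eta>)\<^sup>2) * (ennreal (2 / h2\<^sup>2) * diagonal_integral h2 \<omega>)"
          using elim(3) kpos(2) by (simp add: ennreal_mult)
        also have "\<dots> = ennreal ((1 - \<eta>) * 2 * (real n)\<^sup>2) * diagonal_integral h2 \<omega>"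
          unfolding scale2 using kpos(2) by (subst (2) ennreal_mult) (simp_all add: mult.assoc)
        also have "\<dots> \<le> ?S" unfolding h2_def by (rule sand(2)[OF _ _ _ _ _ w])
        finally show ?thesis .
      qed
      have A1: "net_mean n \<omega> \<le> i + (1 + \<eta>) * (1 + 2 * \<eta>)\<^sup>2 * U \<omega>"
      proof -
        have "ennreal (net_mean n \<omega>) \<le> ennreal i + ennreal ((1 + \<eta>) * (1 + 2 * \<eta>)\<^sup>2 * U \<omega>)"
          unfolding tot i(2) using Sup by (rule add_left_mono)
        also have "\<dots> = ennreal (i + (1 + \<eta>) * (1 + 2 * \<eta>)\<^sup>2 * U \<omega>)"
          using i(1) kpos(1) elim(2) by (intro ennreal_plus[symmetric]) auto
        finally show ?thesis using i(1) kpos(1) elim(2) by (subst (asm) ennreal_le_iff) auto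
      qed
      have A2: "(1 - \<eta>) * (1 - \<eta>)\<^sup>2 * V \<omega> \<le> net_mean n \<omega>"
      proof -
        have "ennreal ((1 - \<eta>) * (1 - \<eta>)\<^sup>2 * V \<omega>) \<le> ennreal (net_mean n \<omega>)"
          unfolding tot using Slo by (rule order_trans) simp
        then show ?thesis using elim(1) by (subst (asm) ennreal_le_iff) auto
      qed
      have "ennreal \<bar>net_mean n \<omega> - Q_left b \<omega>\<bar> \<le> ennreal (i + 3 * \<bar>U \<omega> - Q_left b \<omega>\<bar> + \<bar>V \<omega> - Q_left b \<omega>\<bar> + 11 * \<eta> * Q_left b \<omega>)"
        by (rule ennreal_leI[OF sandwich_arith[OF eta Q0 A1 A2 i(1)]])
      also have "\<dots> = ennreal i + ennreal (3 * \<bar>U \<omega> - Q_left b \<omega>\<bar>) + ennreal \<bar>V \<omega> - Q_left b \<omega>\<bar> + ennreal (11 * \<eta> * Q_left b \<omega>)"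
        using i(1) eta Q0 by (simp add: ennreal_plus)
      also have "\<dots> = cell_mean n 0 \<omega> + ennreal 3 * ennreal \<bar>U \<omega> - Q_left b \<omega>\<bar> + ennreal \<bar>V \<omega> - Q_left b \<omega>\<bar> + ennreal (11 * \<eta>) * ennreal (Q_left b \<omega>)"
        using eta Q0 by (simp only: i(2) ennreal_mult[of 3] ennreal_mult[of "11 * \<eta>"] abs_ge_zero)
      finally show ?case .
    qed
    note [measurable] = U(1) V(1) Q_left_meas[OF b] cell_mean_measurable
    have "(\<integral>\<^sup>+\<omega>. ennreal \<bar>net_mean n \<omega> - Q_left b \<omega>\<bar> \<partial>M) \<le>
      (\<integral>\<^sup>+\<omega>. cell_mean n 0 \<omega> + ennreal 3 * ennreal \<bar>U \<omega> - Q_left b \<omega>\<bar> + ennreal \<bar>V \<omega> - Q_left b \<omega>\<bar> + ennreal (11 * \<eta>) * ennreal (Q_left b \<omega>) \<partial>M)"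
      by (rule nn_integral_mono_AE[OF ae])
    also have "\<dots> = (\<integral>\<^sup>+\<omega>. cell_mean n 0 \<omega> \<partial>M) + ennreal 3 * (\<integral>\<^sup>+\<omega>. ennreal \<bar>U \<omega> - Q_left b \<omega>\<bar> \<partial>M)
        + (\<integral>\<^sup>+\<omega>. ennreal \<bar>V \<omega> - Q_left b \<omega>\<bar> \<partial>M) + ennreal (11 * \<eta>) * (\<integral>\<^sup>+\<omega>. ennreal (Q_left b \<omega>) \<partial>M)"
      by (simp add: nn_integral_add nn_integral_cmult)
    also have "(\<integral>\<^sup>+\<omega>. ennreal (Q_left b \<omega>) \<partial>M) = ennreal q"
      unfolding q_def by (rule nn_integral_eq_integral[OF Q_left_integrable[OF b]]) (use Q_left_nonneg[OF b] in auto)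
    also have "(\<integral>\<^sup>+\<omega>. cell_mean n 0 \<omega> \<partial>M) + ennreal 3 * (\<integral>\<^sup>+\<omega>. ennreal \<bar>U \<omega> - Q_left b \<omega>\<bar> \<partial>M)
        + (\<integral>\<^sup>+\<omega>. ennreal \<bar>V \<omega> - Q_left b \<omega>\<bar> \<partial>M) + ennreal (11 * \<eta>) * ennreal q
      \<le> ennreal (\<epsilon> / 8) + ennreal 3 * ennreal (\<epsilon> / 20) + ennreal (\<epsilon> / 20) + ennreal (11 * \<eta>) * ennreal q"
      by (intro add_mono mult_left_mono first U(2) V(2)) auto
    also have "\<dots> = ennreal (\<epsilon> / 8 + 3 * (\<epsilon> / 20) + \<epsilon> / 20 + 11 * \<eta> * q)"
    proof -
      have "ennreal 3 * ennreal (\<epsilon> / 20) = ennreal (3 * (\<epsilon> / 20))"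
        by (rule ennreal_mult[symmetric]) (use e in auto)
      moreover have "ennreal (11 * \<eta>) * ennreal q = ennreal (11 * \<eta> * q)"
        by (rule ennreal_mult[symmetric]) (use eta q in auto)
      ultimately show ?thesis using e eta q by (simp add: ennreal_plus[symmetric] del: ennreal_plus)
    qed
    finally have nn: "(\<integral>\<^sup>+\<omega>. ennreal \<bar>net_mean n \<omega> - Q_left b \<omega>\<bar> \<partial>M) \<le> ennreal (\<epsilon> / 8 + 3 * (\<epsilon> / 20) + \<epsilon> / 20 + 11 * \<eta> * q)" .
    have "integrable M (\<lambda>\<omega>. \<bar>net_mean n \<omega> - Q_left b \<omega>\<bar>)"
      using net_mean_eq(3)[OF n0] Q_left_integrable[OF b] by simp
    from nn_integral_eq_integral[OF this]
    have "ennreal (\<integral>\<omega>. \<bar>net_mean n \<omega> - Q_left b \<omega>\<bar> \<partial>M) \<le> ennreal (\<epsilon> / 8 + 3 * (\<epsilon> / 20) + \<epsilon> / 20 + 11 * \<eta> * q)"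
      using nn by simp
    then have "(\<integral>\<omega>. \<bar>net_mean n \<omega> - Q_left b \<omega>\<bar> \<partial>M) \<le> \<epsilon> / 8 + 3 * (\<epsilon> / 20) + \<epsilon> / 20 + 11 * \<eta> * q"
      using e eta q by (subst (asm) ennreal_le_iff) auto
    also have "\<dots> < \<epsilon>" using etaq e by linarith
    finally show ?case .
  qed
qed

lemma net_mean_tendsto_left_bracket:
  "(\<lambda>n. \<integral>\<omega>. \<bar>net_mean n \<omega> - Q_left b \<omega>\<bar> \<partial>M) \<longlonglongrightarrow> 0"
proof (rule order_tendstoI)
  show "\<forall>\<^sub>F n in sequentially. a < (\<integral>\<omega>. \<bar>net_mean n \<omega> - Q_left b \<omega>\<bar> \<partial>M)" if "a < 0" for a
    using that by (intro always_eventually allI) (auto intro: less_le_trans Bochner_Integration.integral_nonneg)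
qed (rule net_mean_near_left_bracket)

end

text \<open>Integrability is part of the conclusion because the integral of a non-integrable
  function is 0 by convention, so the limit alone would not express convergence in L_1. The range n
  \<ge> 1 excludes the division by n = 0 in the nodes, and \<open>n + 1\<close> is the last index of
  a net with n + 2 points.\<close>

theorem theorem4p2:
  fixes M :: "'a measure" and F :: "real \<Rightarrow> 'a measure"
    and L Q :: "real \<Rightarrow> 'a \<Rightarrow> real" and T \<theta> b :: real
  assumes "0 < T"
    and "prob_space M" and "complete_measure M"
    and "usual_filtration M T F"
    and "cadlag_martingale M T F L"
    and "\<And>t. t \<in> {0..<T} \<Longrightarrow> integrable M (\<lambda>\<omega>. (L t \<omega>)\<^sup>2)"
    and "\<And>\<omega>. \<omega> \<in> space M \<Longrightarrow> L 0 \<omega> = 0"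
    and "0 < \<theta>" and "\<theta> \<le> 1"
    and "0 < b" and "b < T"
    and "square_bracket M T F (riemann_liouville T ((1 - \<theta>) / 2) L) Q"
  defines "D \<equiv> (\<lambda>(n::nat) \<omega>.
      2 * \<theta> * real n / T
        * (LBINT r:{0..<1}. net_square_error L (n + 1) (shifted_net T \<theta> n r) b \<omega>)
      - Lim (at_left b) (\<lambda>t. Q t \<omega>))"
  shows "(\<forall>n\<ge>1. integrable M (D n)) \<and> (\<lambda>n. \<integral>\<omega>. \<bar>D n \<omega>\<bar> \<partial>M) \<longlonglongrightarrow> 0"
proof -
  interpret prob_space M by fact
  interpret theta_bracket M F L T \<theta> Q b
    by unfold_locales (use assms in auto)
  have D: "D n = (\<lambda>\<omega>. net_mean n \<omega> - Q_left b \<omega>)" for n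
    by (simp add: D_def net_mean_def Q_left_def)
  have "integrable M (D n)" if "n \<ge> 1" for n
    unfolding D using net_mean_eq(3)[of n] Q_left_integrable[OF b] that by simp
  then show ?thesis using net_mean_tendsto_left_bracket unfolding D by blast
qed

end
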